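(* Let $m>0$ and let $\mathscr{L}_m:H^1(\mathbb{R},\mathbb{C}^2)\to L^2(\mathbb{R},\mathbb{C}^2)$ be the operator $$(\mathscr{L}_m f)(x)=\begin{pmatrix} m & -\partial_x\\ \partial_x & -m\end{pmatrix}f(x)+i\,\mathrm{sgn}(x)f(x).$$ Assume that $z\in\mathbb{C}$ is such that $|\mathrm{Im}\,z|<1$. Then $$\left\|(\mathscr{L}_m-z)^{-1}\right\|=\frac{|\mathrm{Re}\,z|^2}{m(1-|\mathrm{Im}\,z|^2)}\left(1+\mathcal{O}\big(|\mathrm{Re}\,z|^{-2}\big)\right)\qquad\text{as } |\mathrm{Re}\,z|\to\infty.$$ The $\mathcal{O}$ term is uniform in $|\mathrm{Im}\,z|$ and locally uniform in $m$, i.e. the constants involved can be chosen independent of $z$ for all $|\mathrm{Im}\,z|<1$ and of $m$ on any fixed compact subset of $(0,\infty)$.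
   Context: $\|\cdot\|$ is the operator norm on $L^2(\mathbb{R},\mathbb{C}^2)$. For $m>0$ the spectrum of $\mathscr{L}_m$ is $\{z:|\mathrm{Re}\,z|\ge m,\ |\mathrm{Im}\,z|=1\}$, so every $z$ with $|\mathrm{Im}\,z|<1$ is in the resolvent set. *)

theory Defs
  imports "HOL-Analysis.Analysis"
begin

section \<open>The Hilbert space of square-integrable functions from the real line to the complex plane squared\<close>

definition square_integrable :: "(real \<Rightarrow> complex^2) \<Rightarrow> bool" where
  "square_integrable f \<longleftrightarrow>
     f \<in> borel_measurable lborel \<and> integrable lborel (\<lambda>x. (norm (f x))\<^sup>2)"

definition L2_eq :: "(real \<Rightarrow> complex^2) \<Rightarrow> (real \<Rightarrow> complex^2) \<Rightarrow> bool" where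
  "L2_eq f g \<longleftrightarrow> square_integrable f \<and> square_integrable g \<and> (AE x in lborel. f x = g x)"

lemma square_integrableI_bound:
  assumes "f \<in> borel_measurable lborel" "integrable lborel h" "\<And>x. (norm (f x))\<^sup>2 \<le> h x"
  shows "square_integrable f"
  unfolding square_integrable_def
proof
  show "integrable lborel (\<lambda>x. (norm (f x))\<^sup>2)"
    by (rule Bochner_Integration.integrable_bound[OF assms(2)])
      (use assms(1,3) order_trans[OF assms(3) abs_ge_self] in \<open>auto\<close>)
qed fact

lemma square_integrable_zero: "square_integrable (\<lambda>x. 0)"
  by (simp add: square_integrable_def)

lemma square_integrable_add:
  assumes "square_integrable f" "square_integrable g"
  shows "square_integrable (\<lambda>x. f x + g x)"
proof (rule square_integrableI_bound)
  show "(\<lambda>x. f x + g x) \<in> borel_measurable lborel"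
    using assms by (auto simp: square_integrable_def)
  show "integrable lborel (\<lambda>x. 2 * (norm (f x))\<^sup>2 + 2 * (norm (g x))\<^sup>2)"
    using assms by (auto simp: square_integrable_def)
  show "(norm (f x + g x))\<^sup>2 \<le> 2 * (norm (f x))\<^sup>2 + 2 * (norm (g x))\<^sup>2" for x
  proof -
    have "(norm (f x + g x))\<^sup>2 \<le> (norm (f x) + norm (g x))\<^sup>2"
      by (simp add: norm_triangle_ineq power_mono)
    also have "\<dots> \<le> 2 * (norm (f x))\<^sup>2 + 2 * (norm (g x))\<^sup>2"
      using zero_le_power2[of "norm (f x) - norm (g x)"]
      by (simp add: power2_eq_square algebra_simps)
    finally show ?thesis .
  qed
qed

lemma square_integrable_bounded:
  assumes "square_integrable f" "g \<in> borel_measurable lborel" "\<And>x. norm (g x) \<le> B * norm (f x)"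
  shows "square_integrable g"
proof (rule square_integrableI_bound)
  show "integrable lborel (\<lambda>x. B\<^sup>2 * (norm (f x))\<^sup>2)"
    using assms by (auto simp: square_integrable_def)
  show "(norm (g x))\<^sup>2 \<le> B\<^sup>2 * (norm (f x))\<^sup>2" for x
    using power_mono[OF assms(3)[of x] norm_ge_zero, of 2] by (simp add: power_mult_distrib)
qed fact

lemma square_integrable_linear:
  assumes "bounded_linear A" "square_integrable f"
  shows "square_integrable (\<lambda>x. A (f x))"
proof -
  obtain B where "\<And>v. norm (A v) \<le> norm v * B"
    using bounded_linear.bounded[OF assms(1)] by blast
  moreover have "A \<in> borel_measurable borel"
    by (intro borel_measurable_continuous_onI linear_continuous_on assms(1))
  ultimately show ?thesis
    using assms(2)
    by (intro square_integrable_bounded[OF assms(2), of _ B])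
      (auto simp: square_integrable_def mult.commute intro: measurable_compose)
qed

lemma square_integrable_scaleR:
  "square_integrable f \<Longrightarrow> square_integrable (\<lambda>x. c *\<^sub>R f x)"
  by (rule square_integrable_linear[OF bounded_linear_scaleR_right])

lemma square_integrable_inner:
  assumes "square_integrable f" "square_integrable g"
  shows "integrable lborel (\<lambda>x. f x \<bullet> g x)"
proof (rule Bochner_Integration.integrable_bound)
  show "integrable lborel (\<lambda>x. (norm (f x))\<^sup>2 + (norm (g x))\<^sup>2)"
    using assms by (auto simp: square_integrable_def)
  show "(\<lambda>x. f x \<bullet> g x) \<in> borel_measurable lborel"
    using assms by (auto simp: square_integrable_def)
  have "\<bar>f x \<bullet> g x\<bar> \<le> (norm (f x))\<^sup>2 + (norm (g x))\<^sup>2" for x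
  proof -
    have "\<bar>f x \<bullet> g x\<bar> \<le> norm (f x) * norm (g x)"
      by (rule Cauchy_Schwarz_ineq2)
    also have "\<dots> \<le> (norm (f x))\<^sup>2 + (norm (g x))\<^sup>2"
      using sum_squares_bound[of "norm (f x)" "norm (g x)"]
        mult_nonneg_nonneg[OF norm_ge_zero[of "f x"] norm_ge_zero[of "g x"]] by linarith
    finally show ?thesis .
  qed
  then show "AE x in lborel. norm (f x \<bullet> g x) \<le> norm ((norm (f x))\<^sup>2 + (norm (g x))\<^sup>2)"
    by auto
qed

lemma bounded_linear_vector_scalar_mult: "bounded_linear (\<lambda>v :: complex^2. c *s v)"
  by (intro linear_conv_bounded_linear[THEN iffD1] linearI)
    (auto simp: vec_eq_iff algebra_simps)

lemma bounded_linear_matrix_vector_mult: "bounded_linear (\<lambda>v :: complex^2. (A :: complex^2^2) *v v)"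
  by (intro linear_conv_bounded_linear[THEN iffD1] linearI)
    (simp_all add: vec_eq_iff matrix_vector_mult_def distrib_left sum.distrib scaleR_sum_right)

lemma part_equivp_L2_eq: "part_equivp L2_eq"
proof (rule part_equivpI)
  show "\<exists>f. L2_eq f f"
    using square_integrable_zero by (auto simp: L2_eq_def)
  show "symp L2_eq"
    by (auto simp: symp_def L2_eq_def)
  show "transp L2_eq"
    by (auto simp: transp_def L2_eq_def)
qed

quotient_type L2 = "real \<Rightarrow> complex^2" / partial: L2_eq
  by (rule part_equivp_L2_eq)

text \<open>The inner product is the real part of the complex one; it induces the usual norm.\<close>

instantiation L2 :: real_inner
begin

lift_definition zero_L2 :: L2 is "\<lambda>x. 0"
  by (simp add: L2_eq_def square_integrable_zero)

lift_definition plus_L2 :: "L2 \<Rightarrow> L2 \<Rightarrow> L2" is "\<lambda>f g x. f x + g x"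
  by (auto simp: L2_eq_def square_integrable_add)

lift_definition scaleR_L2 :: "real \<Rightarrow> L2 \<Rightarrow> L2" is "\<lambda>c f x. c *\<^sub>R f x"
  by (auto simp: L2_eq_def square_integrable_scaleR)

lift_definition uminus_L2 :: "L2 \<Rightarrow> L2" is "\<lambda>f x. - f x"
  using square_integrable_scaleR[of _ "- 1"] by (auto simp: L2_eq_def)

lift_definition minus_L2 :: "L2 \<Rightarrow> L2 \<Rightarrow> L2" is "\<lambda>f g x. f x - g x"
  using square_integrable_add[OF _ square_integrable_scaleR[of _ "- 1"]] by (auto simp: L2_eq_def)

lift_definition inner_L2 :: "L2 \<Rightarrow> L2 \<Rightarrow> real" is "\<lambda>f g. LINT x|lborel. f x \<bullet> g x"
  by (rule integral_cong_AE) (auto simp: L2_eq_def square_integrable_def)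

lift_definition norm_L2 :: "L2 \<Rightarrow> real" is "\<lambda>f. sqrt (LINT x|lborel. (norm (f x))\<^sup>2)"
  by (intro arg_cong[where f = sqrt] integral_cong_AE) (auto simp: L2_eq_def square_integrable_def)

definition "sgn f = scaleR (inverse (norm f)) f" for f :: L2

definition "dist f g = norm (f - g)" for f g :: L2

definition "(uniformity :: (L2 \<times> L2) filter) = (INF e\<in>{0<..}. principal {(x, y). dist x y < e})"

definition "open U \<longleftrightarrow> (\<forall>x\<in>U. eventually (\<lambda>(x', y). x' = x \<longrightarrow> y \<in> U) uniformity)" for U :: "L2 set"

instance
proof
  fix f g h :: L2 and a b :: real
  show "f + g + h = f + (g + h)"
    by transfer (auto simp: L2_eq_def add.assoc intro!: square_integrable_add)
  show "f + g = g + f"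
    by transfer (auto simp: L2_eq_def add.commute intro!: square_integrable_add)
  show "0 + f = f"
    by transfer (auto simp: L2_eq_def)
  show "- f + f = 0"
    by transfer (auto simp: L2_eq_def square_integrable_zero)
  show "f - g = f + - g"
    by transfer
      (use square_integrable_add[OF _ square_integrable_scaleR[of _ "- 1"]] in \<open>auto simp: L2_eq_def\<close>)
  show "a *\<^sub>R (f + g) = a *\<^sub>R f + a *\<^sub>R g"
    by transfer (auto simp: L2_eq_def scaleR_add_right intro!: square_integrable_add square_integrable_scaleR)
  show "(a + b) *\<^sub>R f = a *\<^sub>R f + b *\<^sub>R f"
    by transfer (auto simp: L2_eq_def scaleR_add_left intro!: square_integrable_add square_integrable_scaleR)
  show "a *\<^sub>R b *\<^sub>R f = (a * b) *\<^sub>R f"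
    by transfer (auto simp: L2_eq_def intro!: square_integrable_scaleR)
  show "1 *\<^sub>R f = f"
    by transfer (auto simp: L2_eq_def)
  show "sgn f = inverse (norm f) *\<^sub>R f"
    by (rule sgn_L2_def)
  show "dist f g = norm (f - g)"
    by (rule dist_L2_def)
  show "(uniformity :: (L2 \<times> L2) filter) = (INF e\<in>{0<..}. principal {(x, y). dist x y < e})"
    by (rule uniformity_L2_def)
  show "open U \<longleftrightarrow> (\<forall>x\<in>U. eventually (\<lambda>(x', y). x' = x \<longrightarrow> y \<in> U) uniformity)" for U :: "L2 set"
    by (rule open_L2_def)
  show "inner f g = inner g f"
    by transfer (simp add: inner_commute)
  show "inner (f + g) h = inner f h + inner g h"
    by transfer (auto simp: L2_eq_def inner_add_left square_integrable_inner)
  show "inner (a *\<^sub>R f) g = a * inner f g"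
    by transfer simp
  show "0 \<le> inner f f"
    by transfer (simp add: integral_nonneg_AE)
  show "inner f f = 0 \<longleftrightarrow> f = 0"
  proof transfer
    fix f assume "L2_eq f f"
    then have "square_integrable f" by (simp add: L2_eq_def)
    then have "(LINT x|lborel. f x \<bullet> f x) = 0 \<longleftrightarrow> (AE x in lborel. f x \<bullet> f x = 0)"
      by (intro integral_nonneg_eq_0_iff_AE square_integrable_inner) auto
    with \<open>square_integrable f\<close> show "(LINT x|lborel. f x \<bullet> f x) = 0 \<longleftrightarrow> L2_eq f (\<lambda>x. 0)"
      by (simp add: L2_eq_def square_integrable_zero)
  qed
  show "norm f = sqrt (inner f f)"
    by transfer (simp add: power2_norm_eq_inner)
qed

end

lift_definition scaleC_L2 :: "complex \<Rightarrow> L2 \<Rightarrow> L2" is "\<lambda>c f x. c *s f x"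
  by (auto simp: L2_eq_def intro!: square_integrable_linear[OF bounded_linear_vector_scalar_mult])


section \<open>Weak derivatives and the Sobolev space of order one\<close>

definition test_function :: "(real \<Rightarrow> real) \<Rightarrow> bool" where
  "test_function \<phi> \<longleftrightarrow>
     (\<forall>n. (deriv ^^ n) \<phi> differentiable_on UNIV) \<and> compact (closure {x. \<phi> x \<noteq> 0})"

lemma test_function_measurable:
  assumes "test_function \<phi>"
  shows "\<phi> \<in> borel_measurable borel" "deriv \<phi> \<in> borel_measurable borel"
proof -
  have "(deriv ^^ n) \<phi> differentiable_on UNIV" for n
    using assms by (simp add: test_function_def)
  from this[of 0] this[of 1] show "\<phi> \<in> borel_measurable borel" "deriv \<phi> \<in> borel_measurable borel"
    by (auto intro!: borel_measurable_continuous_onI differentiable_imp_continuous_on)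
qed

text \<open>Real-valued test functions suffice, since they span the complex-valued ones over the
  complex numbers.\<close>

lift_definition has_weak_deriv :: "L2 \<Rightarrow> L2 \<Rightarrow> bool" is
  "\<lambda>f g. \<forall>\<phi>. test_function \<phi> \<longrightarrow>
     (LINT x|lborel. deriv \<phi> x *\<^sub>R f x) = - (LINT x|lborel. \<phi> x *\<^sub>R g x)"
proof -
  fix f f' g g' :: "real \<Rightarrow> complex^2"
  assume *: "L2_eq f f'" "L2_eq g g'"
  have "(LINT x|lborel. deriv \<phi> x *\<^sub>R f x) = (LINT x|lborel. deriv \<phi> x *\<^sub>R f' x)"
       "(LINT x|lborel. \<phi> x *\<^sub>R g x) = (LINT x|lborel. \<phi> x *\<^sub>R g' x)"
    if "test_function \<phi>" for \<phi>
    using * test_function_measurable[OF that]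
    by (auto intro!: integral_cong_AE simp: L2_eq_def square_integrable_def)
  then show "(\<forall>\<phi>. test_function \<phi> \<longrightarrow>
      (LINT x|lborel. deriv \<phi> x *\<^sub>R f x) = - (LINT x|lborel. \<phi> x *\<^sub>R g x)) \<longleftrightarrow>
    (\<forall>\<phi>. test_function \<phi> \<longrightarrow>
      (LINT x|lborel. deriv \<phi> x *\<^sub>R f' x) = - (LINT x|lborel. \<phi> x *\<^sub>R g' x))"
    by auto
qed

definition H1 :: "L2 set" where
  "H1 = {f. \<exists>g. has_weak_deriv f g}"

definition weak_deriv :: "L2 \<Rightarrow> L2" where
  "weak_deriv f = (THE g. has_weak_deriv f g)"


section \<open>The operator\<close>

text \<open>The second argument stands for the derivative of the first: the matrix with entries
  \<open>m\<close>, \<open>- \<partial>\<^sub>x\<close>, \<open>\<partial>\<^sub>x\<close>, \<open>- m\<close> is split into its zeroth-order and first-order parts.\<close>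

lift_definition dirac_expr :: "real \<Rightarrow> L2 \<Rightarrow> L2 \<Rightarrow> L2" is
  "\<lambda>m f f' x.
     vector [vector [of_real m, 0], vector [0, - of_real m]] *v f x
     + vector [vector [0, - 1], vector [1, 0]] *v f' x
     + (\<i> * of_real (sgn x)) *s f x"
proof -
  fix m and f f\<^sub>1 f' f\<^sub>1' :: "real \<Rightarrow> complex^2"
  assume *: "L2_eq f f\<^sub>1" "L2_eq f' f\<^sub>1'"
  have sgn: "square_integrable (\<lambda>x. (\<i> * of_real (sgn x)) *s h x)" if "square_integrable h" for h
  proof (rule square_integrable_bounded[OF that, where B = 1])
    have "h \<in> borel_measurable lborel"
      using that by (simp add: square_integrable_def)
    moreover have "(\<lambda>v :: complex^2. \<i> *s v) \<in> borel_measurable borel"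
      by (intro borel_measurable_continuous_onI linear_continuous_on bounded_linear_vector_scalar_mult)
    ultimately have "(\<lambda>x. sgn x *\<^sub>R (\<i> *s h x)) \<in> borel_measurable lborel"
      by (intro borel_measurable_scaleR) (auto intro: measurable_compose)
    also have "(\<lambda>x. sgn x *\<^sub>R (\<i> *s h x)) = (\<lambda>x. (\<i> * of_real (sgn x)) *s h x)"
      by (simp add: fun_eq_iff vec_eq_iff) (simp add: scaleR_conv_of_real)
    finally show "(\<lambda>x. (\<i> * of_real (sgn x)) *s h x) \<in> borel_measurable lborel" .
    show "norm ((\<i> * of_real (sgn x)) *s h x) \<le> 1 * norm (h x)" for x
      by (simp add: norm_vec_def norm_mult L2_set_def sgn_if sum_nonneg)
  qed
  show "L2_eq
    (\<lambda>x. vector [vector [of_real m, 0], vector [0, - of_real m]] *v f x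
      + vector [vector [0, - 1], vector [1, 0]] *v f' x + (\<i> * of_real (sgn x)) *s f x)
    (\<lambda>x. vector [vector [of_real m, 0], vector [0, - of_real m]] *v f\<^sub>1 x
      + vector [vector [0, - 1], vector [1, 0]] *v f\<^sub>1' x + (\<i> * of_real (sgn x)) *s f\<^sub>1 x)"
    using * unfolding L2_eq_def
    by (auto intro!: square_integrable_add sgn
          square_integrable_linear[OF bounded_linear_matrix_vector_mult])
qed

text \<open>The operator has domain \<^const>\<open>H1\<close>; outside it the value is meaningless.\<close>

definition dirac_op :: "real \<Rightarrow> L2 \<Rightarrow> L2" where
  "dirac_op m f = dirac_expr m f (weak_deriv f)"


section \<open>Resolvents\<close>

text \<open>For complex-linear \<open>T\<close> the inverse below is automatically complex-linear, so
  \<^const>\<open>bounded_linear\<close> amounts to its boundedness.\<close>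

definition resolvent :: "L2 set \<Rightarrow> (L2 \<Rightarrow> L2) \<Rightarrow> complex \<Rightarrow> L2 \<Rightarrow> L2" where
  "resolvent D T z = inv_into D (\<lambda>f. T f - scaleC_L2 z f)"

definition resolvent_set :: "L2 set \<Rightarrow> (L2 \<Rightarrow> L2) \<Rightarrow> complex set" where
  "resolvent_set D T =
     {z. bij_betw (\<lambda>f. T f - scaleC_L2 z f) D UNIV \<and> bounded_linear (resolvent D T z)}"

end

theory Submission
  imports Defs
begin

text \<open>In the coordinates \<open>u = f\<^sub>1 + i f\<^sub>2\<close>, \<open>v = f\<^sub>1 - i f\<^sub>2\<close>, an isometry up to the factor \<open>\<surd>2\<close>, the equation
\<open>(L\<^sub>m - z) f = G\<close> is the system \<open>u' = i m v - i w u - i G\<^sub>u\<close>, \<open>v' = - i m u + i w v + i G\<^sub>v\<close> with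
\<open>w = z - i sgn x\<close>. Its coefficients are constant on each half-line, where it is diagonalised by a root \<open>\<rho>\<close>
(right) or \<open>\<sigma>\<close> (left) of \<open>m r\<^sup>2 - 2 w r + m = 0\<close>, that is \<open>r + 1 / r = 2 w / m\<close>. As \<open>w\<close> is not real,
exactly one of the two reciprocal roots lies in the open unit disc. Going away from the origin, \<open>v - r u\<close> is the growing
and \<open>u - r v\<close> the decaying component, and their exponential rates have real part at least \<open>1 - |Im z|\<close>.
For a square-integrable solution \<open>G\<close> determines the growing components (\<open>diagonal_to_uv\<close>, \<open>L2_fun_fwd\<close>), and
continuity at the origin leaves two linear equations for \<open>(u 0, v 0)\<close> with determinant \<open>\<plusminus> (\<rho> - \<sigma>)\<close>. It does not
vanish, so \<open>z\<close> is in the resolvent set, but it is small, of size \<open>m / |Re z|\<^sup>2\<close>, and this makes the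
resolvent large.

More precisely (\<open>inhomogeneous_solution\<close>), the resolvent maps \<open>G\<close> to \<open>c \<Phi> + E\<close>. Here \<open>\<Phi>\<close> is
\<open>(1, \<rho>)\<close> or \<open>(1, \<sigma>)\<close> times the decaying exponential, \<open>c = i \<Lambda> G / (\<rho> - \<sigma>)\<close>, and the norm of the
remainder \<open>E\<close> is, for large \<open>|Re z|\<close>, at most a constant times \<open>\<parallel>G\<parallel> / (1 - |Im z|)\<close>. The functional \<open>\<Lambda>\<close> is the bilinear pairing with the
same function \<open>\<Phi>\<close> with its two components exchanged. By the Cauchy--Schwarz inequality, with equality for the conjugate
of the swapped \<open>\<Phi>\<close>, the norm of the rank-one part is therefore exactly \<open>\<parallel>\<Phi>\<parallel>\<^sup>2 / |\<rho> - \<sigma>|\<close>, with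
\<open>\<parallel>\<Phi>\<parallel>\<close> the norm of the pair \<open>(u, v)\<close> (\<open>onorm_res_near\<close>).

Both factors have closed forms (\<open>\<Phi>_sq_eq\<close>, \<open>rho_minus_sigma\<close>):
\<open>\<parallel>\<Phi>\<parallel>\<^sup>2 = (1 - |\<rho>|\<^sup>2) / (2 (1 - Im z)) + (1 - |\<sigma>|\<^sup>2) / (2 (1 + Im z))\<close> and
\<open>|\<rho> - \<sigma>| |1 - \<rho> \<sigma>| |z - i| |z + i| = m |1 + \<rho>\<^sup>2| |1 + \<sigma>\<^sup>2|\<close>. As \<open>|\<rho>|\<close> and \<open>|\<sigma>|\<close> are at most
\<open>m / |Re z|\<close> and enter only to second order, the quotient is \<open>|Re z|\<^sup>2 / (m (1 - |Im z|\<^sup>2))\<close> up to a relative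
error \<open>O(|Re z|\<^sup>-\<^sup>2)\<close>, uniformly in \<open>Im z\<close>. In the original components the ratio of the two entries of
\<open>\<Phi>\<close> is near \<open>- i\<close> and would produce errors of first order that cancel only in the quotient. The remainder \<open>E\<close> is
of the same relative order because \<open>1 / (1 - |Im z|) \<le> 2 / (1 - |Im z|\<^sup>2)\<close>.

The passage between weak derivatives and these ordinary differential equations rests on \<open>weak_derivative_imp_primitive\<close>: a
square-integrable function with a square-integrable weak derivative agrees almost everywhere with a primitive of the latter.\<close>

section \<open>Test functions and the lemma of du Bois-Reymond\<close>

text \<open>The functions \<open>p (1 / x) exp (- 1 / x)\<close> on the positive axis, extended by zero. Admitting all polynomials \<open>p\<close> makes
the family closed under differentiation, so that smoothness needs no induction over explicit derivatives.\<close>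

definition flat_exp :: "real poly \<Rightarrow> real \<Rightarrow> real" where
  "flat_exp p x = (if 0 < x then poly p (1 / x) * exp (- (1 / x)) else 0)"

lemma flat_exp_div_tendsto_0: "((\<lambda>x. flat_exp p x / x) \<longlongrightarrow> 0) (at 0)"
proof -
  have pow: "((\<lambda>t::real. t ^ k / exp t) \<longlongrightarrow> 0) at_top" for k
    by (rule tendsto_power_div_exp_0)
  have "((\<lambda>t::real. \<Sum>i\<le>degree (pCons 0 p). coeff (pCons 0 p) i * (t ^ i / exp t)) \<longlongrightarrow>
      (\<Sum>i\<le>degree (pCons 0 p). coeff (pCons 0 p) i * 0)) at_top"
    by (intro tendsto_sum tendsto_mult tendsto_const pow)
  then have "((\<lambda>t::real. poly (pCons 0 p) t * exp (- t)) \<longlongrightarrow> 0) at_top"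
    by (simp add: poly_altdef sum_distrib_right exp_minus divide_inverse mult.assoc)
  then have "((\<lambda>x::real. poly (pCons 0 p) (inverse x) * exp (- inverse x)) \<longlongrightarrow> 0) (at_right 0)"
    by (rule filterlim_compose[OF _ filterlim_inverse_at_top_right])
  moreover have "eventually (\<lambda>x::real. poly (pCons 0 p) (inverse x) * exp (- inverse x) = flat_exp p x / x) (at_right 0)"
    by (auto simp: eventually_at_filter flat_exp_def field_simps)
  ultimately have "((\<lambda>x. flat_exp p x / x) \<longlongrightarrow> 0) (at_right 0)"
    by (rule Lim_transform_eventually)
  moreover have "((\<lambda>x. flat_exp p x / x) \<longlongrightarrow> 0) (at_left 0)"
    by (rule tendsto_eventually) (auto simp: eventually_at_filter flat_exp_def)
  ultimately show ?thesis
    by (simp add: filterlim_at_split)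
qed

lemma DERIV_flat_exp:
  "(flat_exp p has_real_derivative flat_exp ([:0, 0, 1:] * (p - pderiv p)) x) (at x)"
proof (cases "x = 0")
  case True
  then show ?thesis
    using flat_exp_div_tendsto_0[of p] by (simp add: has_field_derivative_iff flat_exp_def)
next
  case False
  show ?thesis
  proof (cases "0 < x")
    case True
    have "((\<lambda>y. poly p (1 / y) * exp (- (1 / y))) has_real_derivative
        flat_exp ([:0, 0, 1:] * (p - pderiv p)) x) (at x)"
      using True
      by (auto intro!: derivative_eq_intros poly_DERIV[THEN DERIV_chain2]
            simp: flat_exp_def field_simps power2_eq_square)
    then show ?thesis
      by (rule DERIV_cong_ev[OF refl _ refl, THEN iffD1, rotated])
        (use True in \<open>auto simp: flat_exp_def eventually_nhds intro!: exI[of _ "{0<..}"]\<close>)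
  next
    case neg: False
    have "((\<lambda>y. 0) has_real_derivative flat_exp ([:0, 0, 1:] * (p - pderiv p)) x) (at x)"
      using neg by (simp add: flat_exp_def)
    then show ?thesis
      by (rule DERIV_cong_ev[OF refl _ refl, THEN iffD1, rotated])
        (use neg False in \<open>auto simp: flat_exp_def eventually_nhds intro!: exI[of _ "{..<0}"]\<close>)
  qed
qed

text \<open>A class of differentiable functions that is closed under taking derivatives consists of smooth functions. Sums and products
are included so that bump functions and their linear combinations belong to it.\<close>

inductive smooth_alg :: "(real \<Rightarrow> real) \<Rightarrow> bool" where
  flat: "smooth_alg (\<lambda>x. flat_exp p (a * x + b))"
| const: "smooth_alg (\<lambda>x. c)"
| add: "smooth_alg f \<Longrightarrow> smooth_alg g \<Longrightarrow> smooth_alg (\<lambda>x. f x + g x)"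
| mult: "smooth_alg f \<Longrightarrow> smooth_alg g \<Longrightarrow> smooth_alg (\<lambda>x. f x * g x)"

lemma smooth_alg_DERIV:
  assumes "smooth_alg f"
  shows "\<exists>f'. smooth_alg f' \<and> (\<forall>x. (f has_real_derivative f' x) (at x))"
  using assms
proof induction
  case (flat p a b)
  let ?q = "[:0, 0, 1:] * (p - pderiv p)"
  have "((\<lambda>x. flat_exp p (a * x + b)) has_real_derivative flat_exp ?q (a * x + b) * a) (at x)" for x
    by (rule DERIV_chain2[OF DERIV_flat_exp]) (auto intro!: derivative_eq_intros)
  moreover have "smooth_alg (\<lambda>x. flat_exp ?q (a * x + b) * a)"
    by (intro smooth_alg.intros)
  ultimately show ?case by blast
next
  case (const c)
  then show ?case by (intro exI[of _ "\<lambda>x. 0"]) (auto intro: smooth_alg.const)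
next
  case (add f g)
  then obtain f' g' where "smooth_alg f'" "smooth_alg g'"
    "\<And>x. (f has_real_derivative f' x) (at x)" "\<And>x. (g has_real_derivative g' x) (at x)" by blast
  then show ?case
    by (intro exI[of _ "\<lambda>x. f' x + g' x"]) (auto intro: smooth_alg.intros derivative_intros)
next
  case (mult f g)
  then obtain f' g' where "smooth_alg f'" "smooth_alg g'"
    "\<And>x. (f has_real_derivative f' x) (at x)" "\<And>x. (g has_real_derivative g' x) (at x)" by blast
  with mult show ?case
    by (intro exI[of _ "\<lambda>x. f x * g' x + f' x * g x"])
      (auto intro!: smooth_alg.intros derivative_eq_intros)
qed

lemma smooth_alg_funpow_deriv: "smooth_alg f \<Longrightarrow> smooth_alg ((deriv ^^ n) f)"
proof (induction n)
  case (Suc n)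
  then obtain f' where f': "smooth_alg f'" "\<And>x. ((deriv ^^ n) f has_real_derivative f' x) (at x)"
    using smooth_alg_DERIV by blast
  then have "deriv ((deriv ^^ n) f) = f'"
    by (auto intro: DERIV_imp_deriv)
  with f' show ?case by simp
qed simp

lemma smooth_alg_differentiable: "smooth_alg f \<Longrightarrow> f differentiable_on UNIV"
proof -
  assume "smooth_alg f"
  then obtain f' where "\<And>x. (f has_real_derivative f' x) (at x)"
    using smooth_alg_DERIV by blast
  then show ?thesis
    unfolding differentiable_on_def real_differentiable_def
    using has_field_derivative_at_within by blast
qed

lemma smooth_alg_continuous: "smooth_alg f \<Longrightarrow> continuous_on S f"
  by (meson continuous_on_subset differentiable_imp_continuous_on smooth_alg_differentiable subset_UNIV)

lemma compact_closure_support: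
  fixes f :: "real \<Rightarrow> real"
  assumes "\<And>x. x \<notin> {a..b} \<Longrightarrow> f x = 0"
  shows "compact (closure {x. f x \<noteq> 0})"
proof -
  have "{x. f x \<noteq> 0} \<subseteq> {a..b}" using assms by blast
  then show ?thesis
    by (meson bounded_closed_interval bounded_subset compact_closure)
qed

lemma test_functionI:
  assumes "smooth_alg f" "\<And>x. x \<notin> {a..b} \<Longrightarrow> f x = 0"
  shows "test_function f"
  unfolding test_function_def
  using assms
  by (intro conjI allI smooth_alg_differentiable smooth_alg_funpow_deriv compact_closure_support)

text \<open>A smooth, compactly supported function is the derivative of a test function as soon as its integral vanishes: any
antiderivative is constant on either side of the support, and the two constants agree.\<close>

lemma test_function_primitive:
  assumes f: "smooth_alg f" and supp: "\<And>x. x \<notin> {a..b} \<Longrightarrow> f x = 0" and "a \<le> b"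
    and int: "(LBINT x. f x) = 0"
  obtains \<phi> where "test_function \<phi>" "deriv \<phi> = f"
proof -
  have "isCont f x" for x
    using smooth_alg_continuous[OF f, of UNIV] by (simp add: continuous_on_eq_continuous_at)
  then obtain F where F: "(F has_vector_derivative f x) (at x)" for x
    using einterval_antiderivative[of "-\<infinity>" \<infinity> f] by auto
  have F': "(F has_real_derivative f x) (at x within S)" for x S
    using F[of x] by (simp add: has_real_derivative_iff_has_vector_derivative has_vector_derivative_at_within)
  define \<phi> where "\<phi> x = F x - F a" for x
  have D: "(\<phi> has_real_derivative f x) (at x)" for x
    unfolding \<phi>_def by (auto intro!: derivative_eq_intros F')
  have deriv: "deriv \<phi> = f"
    using D by (auto intro: DERIV_imp_deriv)
  have zero: "f y = 0" if "y \<notin> {a<..<b}" for y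
  proof (rule ccontr)
    assume "f y \<noteq> 0"
    then have "y \<in> {a..b}" using supp by blast
    have "eventually (\<lambda>x. f x \<noteq> 0) (nhds y)"
      using \<open>isCont f y\<close> \<open>f y \<noteq> 0\<close> by (auto simp: isCont_def tendsto_at_iff_tendsto_nhds dest: tendsto_imp_eventually_ne)
    then obtain e where e: "0 < e" "\<And>x. dist x y < e \<Longrightarrow> f x \<noteq> 0"
      unfolding eventually_nhds_metric by blast
    then have "f (y - e / 2) \<noteq> 0" "f (y + e / 2) \<noteq> 0" by (auto simp: dist_real_def)
    then have "y - e / 2 \<in> {a..b}" "y + e / 2 \<in> {a..b}" using supp by blast+
    with that e(1) show False by auto
  qed
  \<comment> \<open>\<open>F\<close> is constant on every interval that does not meet the support of \<open>f\<close>\<close>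
  have const: "F x = F y" if "y \<le> a \<or> b \<le> x" "x \<le> y" for x y
  proof -
    have "\<exists>c. \<forall>t\<in>{x..y}. F t = c"
    proof (rule has_field_derivative_zero_constant)
      show "(F has_real_derivative 0) (at t within {x..y})" if "t \<in> {x..y}" for t
      proof -
        have "t \<notin> {a<..<b}" using that \<open>y \<le> a \<or> b \<le> x\<close> by auto
        then show ?thesis using F'[of t "{x..y}"] zero[of t] by simp
      qed
    qed simp
    then show ?thesis using \<open>x \<le> y\<close> by auto
  qed
  have b: "F b = F a"
  proof -
    have "(LBINT x. f x) = (LBINT x. f x * indicator {a..b} x)"
      using supp by (intro Bochner_Integration.integral_cong) (auto split: split_indicator)
    also have "\<dots> = F b - F a"
      by (rule integral_FTC_Icc_real[OF \<open>a \<le> b\<close> F']) (use \<open>\<And>x. isCont f x\<close> in auto)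
    finally show ?thesis using int by simp
  qed
  have left: "\<phi> x = 0" if "x < a" for x
  proof -
    have "F x = F a" by (rule const) (use that in auto)
    then show ?thesis by (simp add: \<phi>_def)
  qed
  have right: "\<phi> x = 0" if "b < x" for x
  proof -
    have "F b = F x" by (rule const) (use that in auto)
    then show ?thesis using b by (simp add: \<phi>_def)
  qed
  have "(deriv ^^ n) \<phi> differentiable_on UNIV" for n
  proof (cases n)
    case 0
    then show ?thesis
      using D by (auto simp: differentiable_on_def real_differentiable_def intro!: differentiable_at_withinI)
  next
    case (Suc k)
    then show ?thesis
      using smooth_alg_differentiable[OF smooth_alg_funpow_deriv[OF f, of k]]
      by (simp add: funpow_Suc_right deriv del: funpow.simps)
  qed
  moreover have "compact (closure {x. \<phi> x \<noteq> 0})"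
    by (rule compact_closure_support[of a b]) (use left right in force)
  ultimately have "test_function \<phi>" by (simp add: test_function_def)
  with deriv that show thesis by blast
qed

text \<open>As \<open>n\<close> grows both factors tend to \<open>1\<close> at the points of the open interval, and they never exceed \<open>1\<close>. Thus the bumps
approximate the indicator function boundedly.\<close>

definition bump :: "real \<Rightarrow> real \<Rightarrow> nat \<Rightarrow> real \<Rightarrow> real" where
  "bump a b n x = flat_exp 1 (real (Suc n) * (x - a)) * flat_exp 1 (real (Suc n) * (b - x))"

lemma smooth_alg_bump: "smooth_alg (bump a b n)"
proof -
  have "bump a b n = (\<lambda>x. flat_exp 1 (real (Suc n) * x + - (real (Suc n) * a)) *
      flat_exp 1 (- real (Suc n) * x + real (Suc n) * b))"
    by (auto simp: bump_def algebra_simps)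
  then show ?thesis by (simp only:) (intro smooth_alg.intros)
qed

lemma continuous_on_bump: "continuous_on S (bump a b n)"
  by (intro smooth_alg_continuous smooth_alg_bump)

lemma bump_zero: "x \<notin> {a<..<b} \<Longrightarrow> bump a b n x = 0"
  by (auto simp: bump_def flat_exp_def zero_less_mult_iff)

lemma bump_nonneg: "0 \<le> bump a b n x"
  by (simp add: bump_def flat_exp_def)

lemma bump_le_1: "bump a b n x \<le> 1"
  unfolding bump_def by (rule mult_le_one) (simp_all add: flat_exp_def)

lemma bump_pos: "x \<in> {a<..<b} \<Longrightarrow> 0 < bump a b n x"
  by (simp add: bump_def flat_exp_def)

lemma bump_tendsto_indicator: "(\<lambda>n. bump a b n x) \<longlonglongrightarrow> indicator {a<..<b} x"
proof (cases "x \<in> {a<..<b}")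
  case True
  have *: "(\<lambda>n. flat_exp 1 (real (Suc n) * t)) \<longlonglongrightarrow> 1" if "0 < t" for t
  proof -
    have "(\<lambda>n. exp (- (inverse t * inverse (real (Suc n))))) \<longlonglongrightarrow> exp (- (inverse t * 0))"
      by (intro tendsto_intros LIMSEQ_inverse_real_of_nat)
    then show ?thesis using that by (simp add: flat_exp_def divide_inverse mult.commute)
  qed
  show ?thesis
    using tendsto_mult[OF *[of "x - a"] *[of "b - x"]] True by (simp add: bump_def)
next
  case False
  then show ?thesis by (simp add: bump_zero)
qed

lemma test_function_bump: "test_function (bump a b n)"
  by (rule test_functionI[OF smooth_alg_bump, of a b]) (auto intro: bump_zero)

text \<open>The open intervals form an intersection-stable generator of the Borel sets. After truncation to a bounded interval the
vanishing of the integrals spreads from the generator to all Borel sets.\<close>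

lemma AE_zero_if_interval_integrals_zero:
  fixes v :: "real \<Rightarrow> 'a::{second_countable_topology,banach}"
  assumes loc: "\<And>a b. set_integrable lborel {a<..<b} v"
    and zero: "\<And>a b. (LBINT x:{a<..<b}. v x) = 0"
  shows "AE x in lborel. v x = 0"
proof -
  have gen: "sets (borel :: real measure) = sigma_sets UNIV (range (\<lambda>(a, b). {a<..<b}))"
    by (subst borel_eq_box) (simp add: box_real split_beta')
  have Int_stable_intervals: "Int_stable (range (\<lambda>(a, b). {a<..<b::real}))"
    by (auto simp: Int_stable_def)
  have subset_Pow_UNIV: "range (\<lambda>(a, b). {a<..<b::real}) \<subseteq> Pow UNIV"
    by simp
  have *: "AE x in lborel. indicator {-N<..<N} x *\<^sub>R v x = 0" for N :: real
  proof -
    let ?w = "\<lambda>x. indicator {-N<..<N} x *\<^sub>R v x"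
    have w: "integrable lborel ?w"
      using loc[of "-N" N] by (simp add: set_integrable_def)
    have "(LBINT x:A. ?w x) = 0" if "A \<in> sets borel" for A
    proof -
      have "A \<in> sigma_sets UNIV (range (\<lambda>(a, b). {a<..<b::real}))"
        using that by (simp add: gen)
      with Int_stable_intervals subset_Pow_UNIV show ?thesis
      proof (induction rule: sigma_sets_induct_disjoint)
        case (basic A)
        then obtain a b where "A = {a<..<b}" by auto
        then have "(LBINT x:A. ?w x) = (LBINT x:{max a (-N)<..<min b N}. v x)"
          unfolding set_lebesgue_integral_def
          by (intro Bochner_Integration.integral_cong) (auto split: split_indicator)
        then show ?case using zero by simp
      next
        case empty
        then show ?case by (simp add: set_lebesgue_integral_def)
      next
        case (compl A)
        have A: "A \<in> sets borel"
          using compl(1) by (simp add: gen)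
        have "(LBINT x:UNIV - A. ?w x) = (LBINT x. ?w x) - (LBINT x:A. ?w x)"
          unfolding set_lebesgue_integral_def
          using A by (subst Bochner_Integration.integral_diff[symmetric, OF w integrable_mult_indicator[OF _ w]])
            (auto intro!: Bochner_Integration.integral_cong split: split_indicator)
        also have "(LBINT x. ?w x) = 0"
          using zero[of "-N" N] by (simp add: set_lebesgue_integral_def)
        finally show ?case using compl by simp
      next
        case (union A)
        have A: "A i \<in> sets borel" for i
          using union(2) by (auto simp: gen)
        have "(LBINT x:(\<Union>i. A i). ?w x) = (\<Sum>i. (LBINT x:A i. ?w x))"
          using union(1) A w
          by (intro lebesgue_integral_countable_add)
            (auto simp: disjoint_family_on_def set_integrable_def simp del: scaleR_scaleR
              intro!: integrable_mult_indicator)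
        then show ?case using union by simp
      qed
    qed
    then show ?thesis
      by (intro sigma_finite_measure.density_zero[OF lborel.sigma_finite_measure_axioms w]) auto
  qed
  have "AE x in lborel. \<forall>n::nat. indicator {-real n<..<real n} x *\<^sub>R v x = 0"
    unfolding AE_all_countable using * by blast
  then show ?thesis
  proof eventually_elim
    case (elim x)
    obtain n :: nat where "\<bar>x\<bar> < real n" using reals_Archimedean2 by blast
    with elim[rule_format, of n] show ?case by (auto simp: abs_less_iff indicator_def split: if_splits)
  qed
qed

lemma AE_zero_if_bump_integrals_zero:
  fixes v :: "real \<Rightarrow> 'a::{second_countable_topology,banach}"
  assumes loc: "\<And>a b. set_integrable lborel {a<..<b} v"
    and zero: "\<And>a b n. (LBINT x. bump a b n x *\<^sub>R v x) = 0"
  shows "AE x in lborel. v x = 0"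
proof (rule AE_zero_if_interval_integrals_zero[OF loc])
  fix a b :: real
  have bm[measurable]: "bump a b n \<in> borel_measurable borel" for n
    by (intro borel_measurable_continuous_onI continuous_on_bump)
  have vm: "(\<lambda>x. indicator {a<..<b} x *\<^sub>R v x) \<in> borel_measurable lborel"
    using loc[of a b] by (auto simp: set_integrable_def)
  have eq: "bump a b n x *\<^sub>R v x = bump a b n x *\<^sub>R (indicator {a<..<b} x *\<^sub>R v x)" for n x
    by (cases "x \<in> {a<..<b}") (auto simp: bump_zero)
  have "(\<lambda>n. LINT x|lborel. bump a b n x *\<^sub>R v x) \<longlonglongrightarrow> (LBINT x. indicator {a<..<b} x *\<^sub>R v x)"
  proof (rule integral_dominated_convergence)
    show "integrable lborel (\<lambda>x. norm (indicator {a<..<b} x *\<^sub>R v x))"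
      using loc[of a b] by (intro integrable_norm) (simp add: set_integrable_def)
    show "AE x in lborel. (\<lambda>n. bump a b n x *\<^sub>R v x) \<longlonglongrightarrow> indicator {a<..<b} x *\<^sub>R v x"
      by (auto intro!: tendsto_scaleR bump_tendsto_indicator)
    show "AE x in lborel. norm (bump a b n x *\<^sub>R v x) \<le> norm (indicator {a<..<b} x *\<^sub>R v x)" for n
      by (auto simp: eq[of n] bump_nonneg intro!: mult_left_le_one_le bump_le_1 simp del: scaleR_scaleR)
    show "(\<lambda>x. bump a b n x *\<^sub>R v x) \<in> borel_measurable lborel" for n
      unfolding eq[of n] by (rule borel_measurable_scaleR[OF _ vm]) simp
    show "(\<lambda>x. indicator {a<..<b} x *\<^sub>R v x) \<in> borel_measurable lborel" by fact
  qed
  then show "(LBINT x:{a<..<b}. v x) = 0"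
    by (simp add: zero set_lebesgue_integral_def LIMSEQ_const_iff)
qed

lemma integrable_continuous_scaleR:
  fixes u :: "real \<Rightarrow> 'a::{second_countable_topology,banach}"
  assumes "continuous_on UNIV \<psi>" "\<And>x. x \<notin> {a<..<b} \<Longrightarrow> \<psi> x = 0" and loc: "set_integrable lborel {a<..<b} u"
  shows "integrable lborel (\<lambda>x. \<psi> x *\<^sub>R u x)"
proof -
  have [measurable]: "\<psi> \<in> borel_measurable borel"
    by (rule borel_measurable_continuous_onI[OF assms(1)])
  have vm: "(\<lambda>x. indicator {a<..<b} x *\<^sub>R u x) \<in> borel_measurable lborel"
    using loc by (auto simp: set_integrable_def)
  have "bounded (\<psi> ` {a..b})"
    by (intro compact_imp_bounded compact_continuous_image continuous_on_subset[OF assms(1)]) auto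
  then obtain B where B: "\<bar>\<psi> x\<bar> \<le> B" if "x \<in> {a..b}" for x
    unfolding bounded_iff by (metis image_eqI real_norm_def)
  have eq: "\<psi> x *\<^sub>R u x = \<psi> x *\<^sub>R (indicator {a<..<b} x *\<^sub>R u x)" for x
    by (cases "x \<in> {a<..<b}") (auto simp: assms)
  have "integrable lborel (\<lambda>x. \<psi> x *\<^sub>R (indicator {a<..<b} x *\<^sub>R u x))"
  proof (rule Bochner_Integration.integrable_bound)
    show "integrable lborel (\<lambda>x. B *\<^sub>R (indicator {a<..<b} x *\<^sub>R u x))"
      using loc by (intro integrable_scaleR_right) (simp add: set_integrable_def)
    show "AE x in lborel. norm (\<psi> x *\<^sub>R (indicator {a<..<b} x *\<^sub>R u x)) \<le> norm (B *\<^sub>R (indicator {a<..<b} x *\<^sub>R u x))"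
    proof (intro AE_I2)
      fix x show "norm (\<psi> x *\<^sub>R (indicator {a<..<b} x *\<^sub>R u x)) \<le> norm (B *\<^sub>R (indicator {a<..<b} x *\<^sub>R u x))"
        using B[of x] by (cases "x \<in> {a<..<b}") (auto intro!: mult_right_mono)
    qed
    show "(\<lambda>x. \<psi> x *\<^sub>R (indicator {a<..<b} x *\<^sub>R u x)) \<in> borel_measurable lborel"
      by (rule borel_measurable_scaleR[OF _ vm]) simp
  qed
  then show ?thesis by (simp only: eq[symmetric])
qed

text \<open>Subtracting from a bump its integral times a fixed normalised bump leaves a function with vanishing integral, hence the
derivative of a test function. So \<open>u\<close> minus its mean against the normalised bump is orthogonal to every bump.\<close>

lemma du_Bois_Reymond:
  fixes u :: "real \<Rightarrow> 'a::{second_countable_topology,banach}"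
  assumes loc: "\<And>a b. set_integrable lborel {a<..<b} u"
    and zero: "\<And>\<phi>. test_function \<phi> \<Longrightarrow> (LBINT x. deriv \<phi> x *\<^sub>R u x) = 0"
  obtains c where "AE x in lborel. u x = c"
proof -
  define \<eta> where "\<eta> = bump 0 1 0"
  have loc1: "set_integrable lborel {a<..<b} (\<lambda>x. 1 :: real)" for a b :: real
    unfolding set_integrable_def by (cases "a \<le> b") (auto intro!: integrable_real_indicator)
  have i\<eta>: "integrable lborel \<eta>"
    using integrable_continuous_scaleR[OF continuous_on_bump[of _ 0 1 0] bump_zero loc1] by (simp add: \<eta>_def)
  define I where "I = (LBINT x. \<eta> x)"
  have "I \<noteq> 0"
  proof
    assume "I = 0"
    then have "AE x in lborel. \<eta> x = 0"
      using integral_nonneg_eq_0_iff_AE[OF i\<eta>] by (simp add: I_def \<eta>_def bump_nonneg)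
    then have "AE x in lborel. x \<notin> {0<..<1::real}"
    proof eventually_elim
      case (elim x)
      with bump_pos[of x 0 1 0] show ?case by (auto simp: \<eta>_def)
    qed
    then have "emeasure lborel {0<..<1::real} = 0"
      by (subst (asm) AE_iff_measurable[of "{0<..<1}"]) auto
    then show False by simp
  qed
  define c where "c = (1 / I) *\<^sub>R (LBINT x. \<eta> x *\<^sub>R u x)"
  have "AE x in lborel. u x - c = 0"
  proof (rule AE_zero_if_bump_integrals_zero)
    show "set_integrable lborel {a<..<b} (\<lambda>x. u x - c)" for a b
      using loc[of a b] loc1[of a b]
      by (simp add: set_integrable_def scaleR_diff_right integrable_scaleR_left)
    fix a b n
    define s where "s = (LBINT x. bump a b n x) / I"
    have ib: "integrable lborel (bump a b n)"
      using integrable_continuous_scaleR[OF continuous_on_bump[of _ a b n] bump_zero loc1] by simp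
    let ?k = "\<lambda>x. bump a b n x + (- s) * \<eta> x"
    have "smooth_alg ?k"
      unfolding \<eta>_def by (intro smooth_alg.add smooth_alg.mult smooth_alg.const smooth_alg_bump)
    moreover have "?k x = 0" if "x \<notin> {min a 0..max 1 b}" for x
    proof -
      have "x \<notin> {a<..<b}" "x \<notin> {0<..<1}" using that by auto
      then have "bump a b n x = 0" "\<eta> x = 0"
        unfolding \<eta>_def by (blast intro: bump_zero)+
      then show ?thesis by simp
    qed
    moreover have "min a 0 \<le> max 1 b" by simp
    moreover have "(LBINT x. ?k x) = 0"
      using ib i\<eta> \<open>I \<noteq> 0\<close> by (simp add: s_def flip: I_def)
    ultimately obtain \<phi> where "test_function \<phi>" "deriv \<phi> = ?k"
      by (rule test_function_primitive)
    with zero[of \<phi>] have "(LBINT x. ?k x *\<^sub>R u x) = 0" by simp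
    moreover have ibu: "integrable lborel (\<lambda>x. bump a b n x *\<^sub>R u x)"
      by (rule integrable_continuous_scaleR[OF continuous_on_bump bump_zero loc])
    moreover have i\<eta>u: "integrable lborel (\<lambda>x. \<eta> x *\<^sub>R u x)"
      unfolding \<eta>_def by (rule integrable_continuous_scaleR[OF continuous_on_bump bump_zero loc])
    moreover have "(\<lambda>x. ?k x *\<^sub>R u x) = (\<lambda>x. bump a b n x *\<^sub>R u x - s *\<^sub>R (\<eta> x *\<^sub>R u x))"
      by (simp add: fun_eq_iff algebra_simps)
    ultimately have "(LBINT x. bump a b n x *\<^sub>R u x - s *\<^sub>R (\<eta> x *\<^sub>R u x)) = 0"
      by simp
    then have "(LBINT x. bump a b n x *\<^sub>R u x) - (LBINT x. s *\<^sub>R (\<eta> x *\<^sub>R u x)) = 0"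
      using ibu i\<eta>u by (subst (asm) Bochner_Integration.integral_diff) (auto simp del: scaleR_scaleR)
    then have "(LBINT x. bump a b n x *\<^sub>R u x) = s *\<^sub>R (LBINT x. \<eta> x *\<^sub>R u x)"
      by (simp del: scaleR_scaleR)
    then show "(LBINT x. bump a b n x *\<^sub>R (u x - c)) = 0"
      using ib ibu \<open>I \<noteq> 0\<close> by (simp add: scaleR_diff_right s_def c_def)
  qed
  then have "AE x in lborel. u x = c" by simp
  then show thesis by (rule that)
qed

section \<open>Absolutely continuous functions and weak derivatives\<close>

lemma is_interval_Icc_subset:
  fixes S :: "real set"
  shows "is_interval S \<Longrightarrow> a \<in> S \<Longrightarrow> b \<in> S \<Longrightarrow> {a..b} \<subseteq> S"
  by (meson atLeastAtMost_iff is_interval_1 subsetI)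

text \<open>Absolute continuity with a prescribed density, required only for interval endpoints in \<open>S\<close>; in this section and below \<open>S\<close>
is the real line, a closed half-line or a compact interval.\<close>

definition primitive_on :: "real set \<Rightarrow> (real \<Rightarrow> complex) \<Rightarrow> (real \<Rightarrow> complex) \<Rightarrow> bool" where
  "primitive_on S F g \<longleftrightarrow> (\<forall>a\<in>S. \<forall>b\<in>S. a \<le> b \<longrightarrow>
     set_integrable lborel {a..b} g \<and> F b - F a = (LBINT t:{a..b}. g t))"

lemma primitive_onD:
  assumes "primitive_on S F g" "a \<in> S" "b \<in> S" "a \<le> b"
  shows "set_integrable lborel {a..b} g" "F b - F a = (LBINT t:{a..b}. g t)"
  using assms by (auto simp: primitive_on_def)

lemma primitive_on_subset: "primitive_on S F g \<Longrightarrow> T \<subseteq> S \<Longrightarrow> primitive_on T F g"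
  unfolding primitive_on_def by blast

lemma primitive_on_cong_AE:
  assumes "primitive_on S F g" "g \<in> borel_measurable lborel" "h \<in> borel_measurable lborel"
    and "AE x in lborel. x \<in> S \<longrightarrow> g x = h x" "is_interval S"
  shows "primitive_on S F h"
  unfolding primitive_on_def
proof (intro ballI impI)
  fix a b assume ab: "a \<in> S" "b \<in> S" "a \<le> b"
  have "{a..b} \<subseteq> S"
    by (rule is_interval_Icc_subset[OF assms(5) ab(1,2)])
  then have ae: "AE x\<in>{a..b} in lborel. g x = h x"
    using assms(4) by (auto elim!: eventually_mono)
  have "{a..b} \<in> sets lborel" by simp
  note cong = set_integrable_cong_AE[OF assms(2,3) ae this]
    set_lebesgue_integral_cong_AE[OF this assms(2,3) ae]
  show "set_integrable lborel {a..b} h \<and> F b - F a = (LBINT t:{a..b}. h t)"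
    using primitive_onD[OF assms(1) ab] unfolding cong by blast
qed

lemma primitive_on_linear:
  assumes "primitive_on S F g" "primitive_on S G h"
  shows "primitive_on S (\<lambda>x. c * F x + d * G x) (\<lambda>x. c * g x + d * h x)"
  unfolding primitive_on_def
proof (intro ballI impI)
  fix a b assume ab: "a \<in> S" "b \<in> S" "a \<le> b"
  note F = primitive_onD[OF assms(1) ab] and G = primitive_onD[OF assms(2) ab]
  have int: "set_integrable lborel {a..b} (\<lambda>x. c * g x)" "set_integrable lborel {a..b} (\<lambda>x. d * h x)"
    using F(1) G(1) by auto
  have "c * F b + d * G b - (c * F a + d * G a) = c * (F b - F a) + d * (G b - G a)"
    by (simp add: algebra_simps)
  then show "set_integrable lborel {a..b} (\<lambda>x. c * g x + d * h x) \<and>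
      c * F b + d * G b - (c * F a + d * G a) = (LBINT t:{a..b}. c * g t + d * h t)"
    using set_integral_add[OF int] by (simp add: F(2) G(2))
qed

lemma primitive_on_add_const: "primitive_on S F g \<Longrightarrow> primitive_on S (\<lambda>x. F x + c) g"
  by (simp add: primitive_on_def)

lemma set_integrable_continuous:
  fixes f :: "real \<Rightarrow> 'a::{second_countable_topology,banach}"
  shows "continuous_on {a..b} f \<Longrightarrow> set_integrable lborel {a..b} f"
  unfolding set_integrable_def by (intro borel_integrable_compact) auto

lemma primitive_on_C1:
  assumes "\<And>x. (F has_vector_derivative g x) (at x)" "continuous_on UNIV g"
  shows "primitive_on S F g"
  unfolding primitive_on_def
proof (intro ballI impI)
  fix a b :: real assume "a \<le> b"
  have c: "continuous_on {a..b} g" using assms(2) continuous_on_subset by blast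
  have "(LBINT t:{a..b}. g t) = F b - F a"
    unfolding set_lebesgue_integral_def
    by (rule integral_FTC_Icc[OF \<open>a \<le> b\<close> _ c])
      (use assms(1) has_vector_derivative_at_within in blast)
  with set_integrable_continuous[OF c]
  show "set_integrable lborel {a..b} g \<and> F b - F a = (LBINT t:{a..b}. g t)" by simp
qed

text \<open>The product rule for an absolutely continuous and a continuously differentiable factor. As \<open>F\<close> need not be differentiable,
it is obtained by Fubini's theorem for \<open>\<phi>' x g t\<close> on the triangle \<open>a \<le> t \<le> x \<le> b\<close>.\<close>

lemma primitive_product_Icc:
  fixes \<phi> \<phi>' F g :: "real \<Rightarrow> complex"
  assumes F: "primitive_on {a..b} F g" and "a \<le> b"
    and \<phi>: "\<And>x. (\<phi> has_vector_derivative \<phi>' x) (at x)" and c\<phi>': "continuous_on UNIV \<phi>'"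
  shows "set_integrable lborel {a..b} (\<lambda>x. \<phi>' x * F x)"
    "set_integrable lborel {a..b} (\<lambda>x. \<phi> x * g x)"
    "\<phi> b * F b - \<phi> a * F a = (LBINT x:{a..b}. \<phi>' x * F x + \<phi> x * g x)"
proof -
  define T where "T = {a..b}"
  have [measurable]: "T \<in> sets borel" by (simp add: T_def)
  have g_int: "set_integrable lborel T g"
    using primitive_onD(1)[OF F, of a b] \<open>a \<le> b\<close> by (simp add: T_def)
  define g1 where "g1 t = indicator T t *\<^sub>R g t" for t
  have g1: "integrable lborel g1"
    using g_int by (simp add: g1_def[abs_def] set_integrable_def)
  have g1m[measurable]: "g1 \<in> borel_measurable borel" using g1 by auto
  define p where "p x = indicator T x *\<^sub>R \<phi>' x" for x
  have c\<phi>'T: "continuous_on {u..v} \<phi>'" for u v using c\<phi>' continuous_on_subset by blast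
  have p: "integrable lborel p"
    using set_integrable_continuous[OF c\<phi>'T, of a b] by (simp add: p_def[abs_def] set_integrable_def T_def)
  have pm[measurable]: "p \<in> borel_measurable borel" using p by auto
  define h where "h = (\<lambda>(x, t). indicator {q. snd q \<le> fst q} (x, t) *\<^sub>R (p x * g1 t))"
  have tri[measurable]: "{q::real\<times>real. snd q \<le> fst q} \<in> sets (borel \<Otimes>\<^sub>M borel)"
    by (subst borel_prod) (intro borel_closed closed_Collect_le continuous_intros)
  have hm[measurable]: "h \<in> borel_measurable (lborel \<Otimes>\<^sub>M lborel)"
    unfolding h_def by measurable
  have prod_int: "integrable (lborel \<Otimes>\<^sub>M lborel) (\<lambda>(x, t). p x * g1 t)"
  proof (rule lborel_pair.Fubini_integrable)
    show "integrable lborel (\<lambda>x. \<integral>y. norm (case (x, y) of (x, t) \<Rightarrow> p x * g1 t) \<partial>lborel)"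
      using p g1 by (simp add: norm_mult)
    show "AE x in lborel. integrable lborel (\<lambda>y. case (x, y) of (x, t) \<Rightarrow> p x * g1 t)"
      using g1 by simp
  qed measurable
  have h_int: "integrable (lborel \<Otimes>\<^sub>M lborel) h"
    by (rule Bochner_Integration.integrable_bound[OF prod_int hm])
      (auto simp: h_def indicator_def)
  have h_int': "integrable (lborel \<Otimes>\<^sub>M lborel) (case_prod (\<lambda>x t. h (x, t)))"
    using h_int by simp
  have inner_t: "(LBINT t. h (x, t)) = indicator T x *\<^sub>R (\<phi>' x * (F x - F a))" for x
  proof (cases "x \<in> T")
    case True
    have "(LBINT t. h (x, t)) = (LBINT t. \<phi>' x * (indicator {a..x} t *\<^sub>R g t))"
      using True by (intro Bochner_Integration.integral_cong)
        (auto simp: h_def p_def g1_def T_def indicator_def)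
    also have "\<dots> = \<phi>' x * (LBINT t:{a..x}. g t)"
      unfolding set_lebesgue_integral_def by (rule integral_mult_right_zero)
    also have "(LBINT t:{a..x}. g t) = F x - F a"
      using primitive_onD(2)[OF F, of a x] True by (simp add: T_def)
    finally show ?thesis using True by simp
  qed (simp add: h_def p_def)
  have inner_x: "(LBINT x. h (x, t)) = (\<phi> b - \<phi> t) * g1 t" for t
  proof (cases "t \<in> T")
    case True
    have "(LBINT x. h (x, t)) = (LBINT x. (indicator {t..b} x *\<^sub>R \<phi>' x) * g1 t)"
      using True by (intro Bochner_Integration.integral_cong)
        (auto simp: h_def p_def g1_def T_def indicator_def)
    also have "\<dots> = (LBINT x. indicator {t..b} x *\<^sub>R \<phi>' x) * g1 t"
      by (rule integral_mult_left_zero)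
    also have "(LBINT x. indicator {t..b} x *\<^sub>R \<phi>' x) = \<phi> b - \<phi> t"
      by (rule integral_FTC_Icc[OF _ has_vector_derivative_at_within[OF \<phi>] c\<phi>'T])
        (use True T_def in auto)
    finally show ?thesis .
  qed (simp add: h_def g1_def)
  have I1: "integrable lborel (\<lambda>x. indicator T x *\<^sub>R (\<phi>' x * (F x - F a)))"
    using lborel_pair.integrable_fst[OF h_int'] by (simp add: inner_t)
  have I2: "integrable lborel (\<lambda>t. (\<phi> b - \<phi> t) * g1 t)"
    using lborel_pair.integrable_snd[OF h_int'] by (simp add: inner_x)
  have E: "(LBINT x. indicator T x *\<^sub>R (\<phi>' x * (F x - F a))) = (LBINT t. (\<phi> b - \<phi> t) * g1 t)"
    using lborel_pair.integral_fst[OF h_int'] lborel_pair.integral_snd[OF h_int']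
    by (simp add: inner_t inner_x)
  have J1: "integrable lborel (\<lambda>x. indicator T x *\<^sub>R (\<phi>' x * F x))"
  proof -
    have "(\<lambda>x. indicator T x *\<^sub>R (\<phi>' x * F x)) = (\<lambda>x. indicator T x *\<^sub>R (\<phi>' x * (F x - F a)) + p x * F a)"
      by (simp add: fun_eq_iff p_def algebra_simps)
    then show ?thesis using I1 p by simp
  qed
  have J2: "integrable lborel (\<lambda>x. indicator T x *\<^sub>R (\<phi> x * g x))"
  proof -
    have "(\<lambda>x. indicator T x *\<^sub>R (\<phi> x * g x)) = (\<lambda>x. \<phi> b * g1 x - (\<phi> b - \<phi> x) * g1 x)"
      by (simp add: fun_eq_iff g1_def algebra_simps)
    then show ?thesis using I2 g1 by simp
  qed
  show "set_integrable lborel {a..b} (\<lambda>x. \<phi>' x * F x)" "set_integrable lborel {a..b} (\<lambda>x. \<phi> x * g x)"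
    using J1 J2 by (simp_all add: set_integrable_def T_def)
  have "(LBINT x. indicator T x *\<^sub>R (\<phi>' x * F x)) =
      (LBINT x. indicator T x *\<^sub>R (\<phi>' x * (F x - F a)) + p x * F a)"
    by (intro Bochner_Integration.integral_cong) (simp_all add: p_def algebra_simps)
  also have "\<dots> = (LBINT t. (\<phi> b - \<phi> t) * g1 t) + (LBINT x. p x) * F a"
    using I1 p E by simp
  also have "(LBINT x. p x) = \<phi> b - \<phi> a"
    unfolding p_def T_def
    by (rule integral_FTC_Icc[OF \<open>a \<le> b\<close> has_vector_derivative_at_within[OF \<phi>] c\<phi>'T])
  also have "(LBINT t. (\<phi> b - \<phi> t) * g1 t) =
      (LBINT t. \<phi> b * g1 t - indicator T t *\<^sub>R (\<phi> t * g t))"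
    by (intro Bochner_Integration.integral_cong) (simp_all add: g1_def algebra_simps)
  also have "\<dots> = \<phi> b * (LBINT t. g1 t) - (LBINT t. indicator T t *\<^sub>R (\<phi> t * g t))"
    using g1 J2 by simp
  also have "(LBINT t. g1 t) = F b - F a"
    using primitive_onD(2)[OF F, of a b] \<open>a \<le> b\<close>
    by (simp add: g1_def[abs_def] T_def set_lebesgue_integral_def)
  finally show "\<phi> b * F b - \<phi> a * F a = (LBINT x:{a..b}. \<phi>' x * F x + \<phi> x * g x)"
    using J1 J2 by (simp add: set_lebesgue_integral_def scaleR_add_right T_def algebra_simps)
qed

lemma primitive_on_product:
  assumes F: "primitive_on S F g" and S: "is_interval S"
    and \<phi>: "\<And>x. (\<phi> has_vector_derivative \<phi>' x) (at x)" and c\<phi>': "continuous_on UNIV \<phi>'"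
  shows "primitive_on S (\<lambda>x. \<phi> x * F x) (\<lambda>x. \<phi>' x * F x + \<phi> x * g x)"
  unfolding primitive_on_def
proof (intro ballI impI)
  fix a b assume ab: "a \<in> S" "b \<in> S" "a \<le> b"
  have "{a..b} \<subseteq> S"
    by (rule is_interval_Icc_subset[OF S ab(1,2)])
  then have "primitive_on {a..b} F g"
    using F primitive_on_subset by blast
  from primitive_product_Icc[OF this ab(3) \<phi> c\<phi>']
  show "set_integrable lborel {a..b} (\<lambda>x. \<phi>' x * F x + \<phi> x * g x) \<and>
      \<phi> b * F b - \<phi> a * F a = (LBINT x:{a..b}. \<phi>' x * F x + \<phi> x * g x)"
    by (auto intro: set_integral_add)
qed

text \<open>The product rule with \<open>\<phi> x = x\<close> contains the integrability of \<open>F\<close> itself.\<close>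

lemma primitive_on_set_integrable:
  assumes "primitive_on S F g" "is_interval S" "a \<in> S" "b \<in> S"
  shows "set_integrable lborel {a..b} F"
proof (cases "a \<le> b")
  case True
  have "{a..b} \<subseteq> S"
    by (rule is_interval_Icc_subset[OF assms(2-4)])
  then have "primitive_on {a..b} F g"
    using assms primitive_on_subset by blast
  then show ?thesis
    using primitive_product_Icc(1)[OF _ True, of F g of_real "\<lambda>_. 1"]
      has_vector_derivative_of_real[OF DERIV_ident] by auto
qed simp

lemma borel_measurable_if_locally_integrable:
  fixes f :: "real \<Rightarrow> 'a::{second_countable_topology,banach}"
  assumes "\<And>n::nat. set_integrable lborel {-real n..real n} f"
  shows "f \<in> borel_measurable lborel"
proof (rule borel_measurable_LIMSEQ_metric)
  show "(\<lambda>x. indicator {-real n..real n} x *\<^sub>R f x) \<in> borel_measurable lborel" for n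
    using assms[of n] by (simp add: set_integrable_def borel_measurable_integrable)
  fix x :: real
  have "eventually (\<lambda>n. indicator {-real n..real n} x *\<^sub>R f x = f x) sequentially"
    using eventually_ge_at_top[of "nat \<lceil>\<bar>x\<bar>\<rceil>"]
  proof eventually_elim
    case (elim n)
    then have "\<bar>x\<bar> \<le> real n" by linarith
    then show ?case by (auto simp: indicator_def)
  qed
  then show "(\<lambda>n. indicator {-real n..real n} x *\<^sub>R f x) \<longlonglongrightarrow> f x"
    by (rule tendsto_eventually)
qed

lemma primitive_on_UNIV_measurable:
  "primitive_on UNIV F g \<Longrightarrow> F \<in> borel_measurable lborel"
  by (intro borel_measurable_if_locally_integrable primitive_on_set_integrable[of UNIV]) auto

lemma set_integral_Icc_split:
  fixes g :: "real \<Rightarrow> 'a::{second_countable_topology,banach}"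
  assumes "a \<le> c" "c \<le> b" "set_integrable lborel {a..c} g" "set_integrable lborel {c..b} g"
  shows "set_integrable lborel {a..b} g"
    "(LBINT t:{a..b}. g t) = (LBINT t:{a..c}. g t) + (LBINT t:{c..b}. g t)"
proof -
  have U: "{a..b} = {a..c} \<union> {c..b}" using assms(1,2) by auto
  show "set_integrable lborel {a..b} g"
    unfolding U by (intro set_integrable_Un assms) auto
  have "AE t in lborel. t \<noteq> c" by (rule AE_lborel_singleton)
  then have "AE t in lborel. \<not> (t \<in> {a..c} \<and> t \<in> {c..b})"
    by eventually_elim auto
  then show "(LBINT t:{a..b}. g t) = (LBINT t:{a..c}. g t) + (LBINT t:{c..b}. g t)"
    unfolding U by (intro set_integral_Un_AE assms) auto
qed

lemma primitive_on_UNIV_if_halves: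
  assumes "primitive_on {0..} F g" "primitive_on {..0} F g"
  shows "primitive_on UNIV F g"
  unfolding primitive_on_def
proof (intro ballI impI)
  fix a b :: real assume "a \<le> b"
  consider "0 \<le> a" | "b \<le> 0" | "a \<le> 0" "0 \<le> b" by linarith
  then show "set_integrable lborel {a..b} g \<and> F b - F a = (LBINT t:{a..b}. g t)"
  proof cases
    case 1 with \<open>a \<le> b\<close> assms(1) show ?thesis by (auto simp: primitive_on_def)
  next
    case 2 with \<open>a \<le> b\<close> assms(2) show ?thesis by (auto simp: primitive_on_def)
  next
    case 3
    note r = primitive_onD[OF assms(1), of 0 b] and l = primitive_onD[OF assms(2), of a 0]
    show ?thesis
      using 3 r l set_integral_Icc_split[of a 0 b g] by (auto simp: algebra_simps)
  qed
qed

lemma primitive_exists: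
  assumes loc: "\<And>a b. set_integrable lborel {a..b} g"
  obtains F where "primitive_on UNIV F g"
proof -
  define F where "F x = (if 0 \<le> x then (LBINT t:{0..x}. g t) else - (LBINT t:{x..0}. g t))" for x
  have "F 0 = 0"
    using set_integral_Icc_split(2)[of 0 0 0 g] loc[of 0 0] by (simp add: F_def)
  have "primitive_on UNIV F g"
  proof (rule primitive_on_UNIV_if_halves)
    show "primitive_on {0..} F g"
      unfolding primitive_on_def
    proof (intro ballI impI conjI loc)
      fix a b :: real assume "a \<in> {0..}" "b \<in> {0..}" "a \<le> b"
      then show "F b - F a = (LBINT t:{a..b}. g t)"
        using set_integral_Icc_split(2)[of 0 a b g, OF _ _ loc loc] by (simp add: F_def)
    qed
    have F: "F x = - (LBINT t:{x..0}. g t)" if "x \<le> 0" for x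
      using that \<open>F 0 = 0\<close> by (cases "x = 0") (auto simp: F_def)
    show "primitive_on {..0} F g"
      unfolding primitive_on_def
    proof (intro ballI impI conjI loc)
      fix a b :: real assume "a \<in> {..0}" "b \<in> {..0}" "a \<le> b"
      then show "F b - F a = (LBINT t:{a..b}. g t)"
        using set_integral_Icc_split(2)[of a b 0 g, OF _ _ loc loc] by (simp add: F)
    qed
  qed
  then show thesis by (rule that)
qed

lemma test_function_support:
  assumes "test_function \<phi>"
  obtains N where "0 < N" "\<And>x. x \<notin> {-N<..<N} \<Longrightarrow> \<phi> x = 0" "\<And>x. x \<notin> {-N<..<N} \<Longrightarrow> deriv \<phi> x = 0"
proof -
  have "bounded (closure {x. \<phi> x \<noteq> 0})"
    using assms by (simp add: test_function_def compact_imp_bounded)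
  then have "bounded {x. \<phi> x \<noteq> 0}"
    by (rule bounded_subset[OF _ closure_subset])
  then obtain B where B: "\<And>x. \<phi> x \<noteq> 0 \<Longrightarrow> \<bar>x\<bar> \<le> B"
    unfolding bounded_iff by auto
  define N where "N = \<bar>B\<bar> + 1"
  have z: "\<phi> x = 0" if "B < \<bar>x\<bar>" for x
    using B[of x] that by force
  have "deriv \<phi> x = 0" if "x \<notin> {-N<..<N}" for x
  proof -
    have "((\<lambda>x. 0) has_real_derivative 0) (at x)" by simp
    moreover have "eventually (\<lambda>y. \<phi> y = 0) (nhds x)"
    proof -
      have "open {y. B < \<bar>y\<bar>}" by (intro open_Collect_less continuous_intros)
      moreover have "x \<in> {y. B < \<bar>y\<bar>}" using that by (auto simp: N_def)
      ultimately show ?thesis using z unfolding eventually_nhds by blast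
    qed
    ultimately have "(\<phi> has_real_derivative 0) (at x)"
      using DERIV_cong_ev[of x x \<phi> "\<lambda>_. 0" 0 0] by simp
    then show ?thesis by (rule DERIV_imp_deriv)
  qed
  moreover have "\<phi> x = 0" if "x \<notin> {-N<..<N}" for x
    using that by (intro z) (auto simp: N_def)
  ultimately show thesis by (intro that[of N]) (auto simp: N_def)
qed

lemma test_function_DERIV:
  assumes "test_function \<phi>"
  shows "(\<phi> has_real_derivative deriv \<phi> x) (at x)" "continuous_on UNIV (deriv \<phi>)" "continuous_on UNIV \<phi>"
proof -
  have d: "(deriv ^^ n) \<phi> differentiable_on UNIV" for n
    using assms by (simp add: test_function_def)
  have "\<phi> differentiable at x"
    using d[of 0] by (simp add: differentiable_on_def)
  then show "(\<phi> has_real_derivative deriv \<phi> x) (at x)"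
    using DERIV_deriv_iff_real_differentiable by blast
  show "continuous_on UNIV (deriv \<phi>)"
    using d[of 1] differentiable_imp_continuous_on by simp
  show "continuous_on UNIV \<phi>"
    using d[of 0] differentiable_imp_continuous_on by simp
qed

lemma integration_by_parts_test_function:
  assumes F: "primitive_on UNIV F g" and "test_function \<phi>"
  shows "integrable lborel (\<lambda>x. deriv \<phi> x *\<^sub>R F x)" "integrable lborel (\<lambda>x. \<phi> x *\<^sub>R g x)"
    "(LBINT x. deriv \<phi> x *\<^sub>R F x) = - (LBINT x. \<phi> x *\<^sub>R g x)"
proof -
  obtain N where N: "0 < N" "\<And>x. x \<notin> {-N<..<N} \<Longrightarrow> \<phi> x = 0" "\<And>x. x \<notin> {-N<..<N} \<Longrightarrow> deriv \<phi> x = 0"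
    using test_function_support[OF assms(2)] by blast
  have F': "primitive_on {-N..N} F g" using primitive_on_subset[OF F] by blast
  have d: "((\<lambda>x. complex_of_real (\<phi> x)) has_vector_derivative complex_of_real (deriv \<phi> x)) (at x)" for x
    using test_function_DERIV(1)[OF assms(2)]
    by (intro has_vector_derivative_of_real) (simp add: has_real_derivative_iff_has_vector_derivative)
  have c: "continuous_on UNIV (\<lambda>x. complex_of_real (deriv \<phi> x))"
    by (intro continuous_intros test_function_DERIV assms)
  have "-N \<le> N" using N(1) by simp
  note P = primitive_product_Icc[OF F' \<open>-N \<le> N\<close> d c]
  have e1: "(\<lambda>x. indicator {-N..N} x *\<^sub>R (complex_of_real (deriv \<phi> x) * F x)) = (\<lambda>x. deriv \<phi> x *\<^sub>R F x)"
  proof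
    fix x show "indicator {-N..N} x *\<^sub>R (complex_of_real (deriv \<phi> x) * F x) = deriv \<phi> x *\<^sub>R F x"
      using N(3)[of x] by (cases "x \<in> {-N..N}") (auto simp: scaleR_conv_of_real)
  qed
  have e2: "(\<lambda>x. indicator {-N..N} x *\<^sub>R (complex_of_real (\<phi> x) * g x)) = (\<lambda>x. \<phi> x *\<^sub>R g x)"
  proof
    fix x show "indicator {-N..N} x *\<^sub>R (complex_of_real (\<phi> x) * g x) = \<phi> x *\<^sub>R g x"
      using N(2)[of x] by (cases "x \<in> {-N..N}") (auto simp: scaleR_conv_of_real)
  qed
  show i: "integrable lborel (\<lambda>x. deriv \<phi> x *\<^sub>R F x)" "integrable lborel (\<lambda>x. \<phi> x *\<^sub>R g x)"
    using P(1,2) unfolding set_integrable_def e1 e2 by auto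
  have "(LBINT x:{-N..N}. of_real (deriv \<phi> x) * F x + of_real (\<phi> x) * g x) = 0"
    using P(3) N(2)[of N] N(2)[of "-N"] by simp
  also have "(LBINT x:{-N..N}. of_real (deriv \<phi> x) * F x + of_real (\<phi> x) * g x) =
      (LBINT x:{-N..N}. of_real (deriv \<phi> x) * F x) + (LBINT x:{-N..N}. of_real (\<phi> x) * g x)"
    by (intro set_integral_add P)
  also have "\<dots> = (LBINT x. deriv \<phi> x *\<^sub>R F x) + (LBINT x. \<phi> x *\<^sub>R g x)"
    unfolding set_lebesgue_integral_def e1 e2 by simp
  finally show "(LBINT x. deriv \<phi> x *\<^sub>R F x) = - (LBINT x. \<phi> x *\<^sub>R g x)"
    by (simp add: eq_neg_iff_add_eq_0)
qed

text \<open>If \<open>G\<close> is a primitive of the weak derivative \<open>g\<close>, then \<open>f - G\<close> has weak derivative zero and is constant by the lemma of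
du Bois-Reymond.\<close>

lemma weak_derivative_imp_primitive:
  fixes f g :: "real \<Rightarrow> complex"
  assumes f: "\<And>a b. set_integrable lborel {a..b} f" and g: "\<And>a b. set_integrable lborel {a..b} g"
    and weak: "\<And>\<phi>. test_function \<phi> \<Longrightarrow>
      (LBINT x. deriv \<phi> x *\<^sub>R f x) = - (LBINT x. \<phi> x *\<^sub>R g x)"
  obtains F where "primitive_on UNIV F g" "AE x in lborel. f x = F x"
proof -
  obtain G where G: "primitive_on UNIV G g" using primitive_exists[OF g] by blast
  have G_int: "set_integrable lborel {a..b} G" for a b
    by (rule primitive_on_set_integrable[OF G]) auto
  have loc: "set_integrable lborel {a<..<b} (\<lambda>x. f x - G x)" for a b
    using set_integral_diff(1)[OF f[of a b] G_int[of a b]]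
    by (rule set_integrable_subset) auto
  have "(LBINT x. deriv \<phi> x *\<^sub>R (f x - G x)) = 0" if tf: "test_function \<phi>" for \<phi>
  proof -
    obtain N where N: "0 < N" "\<And>x. x \<notin> {-N<..<N} \<Longrightarrow> deriv \<phi> x = 0"
      by (rule test_function_support[OF tf]) blast
    have "integrable lborel (\<lambda>x. deriv \<phi> x *\<^sub>R f x)"
      by (rule integrable_continuous_scaleR[OF test_function_DERIV(2)[OF tf] N(2)])
        (auto intro: set_integrable_subset[OF f[of "-N" N]])
    then show ?thesis
      using integration_by_parts_test_function[OF G tf] weak[OF tf]
      by (simp add: scaleR_diff_right)
  qed
  then obtain c where c: "AE x in lborel. f x - G x = c"
    using du_Bois_Reymond[OF loc] by blast
  have "primitive_on UNIV (\<lambda>x. G x + c) g" by (rule primitive_on_add_const[OF G])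
  moreover have "AE x in lborel. f x = G x + c" using c by eventually_elim (simp add: algebra_simps)
  ultimately show thesis by (rule that)
qed

section \<open>Square-integrable scalar functions and exponential convolutions\<close>

definition L2_fun :: "(real \<Rightarrow> complex) \<Rightarrow> bool" where
  "L2_fun h \<longleftrightarrow> h \<in> borel_measurable lborel \<and> integrable lborel (\<lambda>x. (cmod (h x))\<^sup>2)"

definition L2_sq :: "(real \<Rightarrow> complex) \<Rightarrow> real" where
  "L2_sq h = (LBINT x. (cmod (h x))\<^sup>2)"

lemma L2_sq_nonneg: "0 \<le> L2_sq h"
  by (simp add: L2_sq_def)

lemma L2_fun_bound:
  assumes "g \<in> borel_measurable lborel" "integrable lborel k" "\<And>x. (cmod (g x))\<^sup>2 \<le> k x"
  shows "L2_fun g" "L2_sq g \<le> (LBINT x. k x)"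
proof -
  have "integrable lborel (\<lambda>x. (cmod (g x))\<^sup>2)"
    by (rule Bochner_Integration.integrable_bound[OF assms(2)])
      (use assms(1,3) order_trans[OF assms(3) abs_ge_self] in auto)
  then show "L2_fun g" "L2_sq g \<le> (LBINT x. k x)"
    using assms by (auto simp: L2_fun_def L2_sq_def intro!: integral_mono)
qed

lemma cmod_add_sq_le: "(cmod (a + b))\<^sup>2 \<le> 2 * (cmod a)\<^sup>2 + 2 * (cmod b)\<^sup>2"
proof -
  have "(cmod (a + b))\<^sup>2 \<le> (cmod a + cmod b)\<^sup>2"
    by (simp add: norm_triangle_ineq power_mono)
  also have "\<dots> \<le> 2 * (cmod a)\<^sup>2 + 2 * (cmod b)\<^sup>2"
    using zero_le_power2[of "cmod a - cmod b"] by (simp add: power2_eq_square algebra_simps)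
  finally show ?thesis .
qed

lemma L2_fun_linear:
  assumes "L2_fun f" "L2_fun g"
  shows "L2_fun (\<lambda>x. a * f x + b * g x)"
    "L2_sq (\<lambda>x. a * f x + b * g x) \<le> 2 * (cmod a)\<^sup>2 * L2_sq f + 2 * (cmod b)\<^sup>2 * L2_sq g"
proof -
  let ?k = "\<lambda>x. 2 * (cmod a)\<^sup>2 * (cmod (f x))\<^sup>2 + 2 * (cmod b)\<^sup>2 * (cmod (g x))\<^sup>2"
  have m: "(\<lambda>x. a * f x + b * g x) \<in> borel_measurable lborel"
    using assms by (auto simp: L2_fun_def)
  have i: "integrable lborel ?k" using assms by (auto simp: L2_fun_def)
  have b: "(cmod (a * f x + b * g x))\<^sup>2 \<le> ?k x" for x
    using cmod_add_sq_le[of "a * f x" "b * g x"] by (simp add: norm_mult power_mult_distrib)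
  show "L2_fun (\<lambda>x. a * f x + b * g x)"
    by (rule L2_fun_bound(1)[OF m i b])
  show "L2_sq (\<lambda>x. a * f x + b * g x) \<le> 2 * (cmod a)\<^sup>2 * L2_sq f + 2 * (cmod b)\<^sup>2 * L2_sq g"
    using L2_fun_bound(2)[OF m i b] assms by (simp add: L2_fun_def L2_sq_def)
qed

lemma L2_fun_cmult:
  assumes "L2_fun f"
  shows "L2_fun (\<lambda>x. a * f x)" "L2_sq (\<lambda>x. a * f x) = (cmod a)\<^sup>2 * L2_sq f"
  using assms by (auto simp: L2_fun_def L2_sq_def norm_mult power_mult_distrib)

lemma L2_fun_if:
  assumes "L2_fun f" "L2_fun g" "A \<in> sets borel"
  shows "L2_fun (\<lambda>x. if x \<in> A then f x else g x)"
    "L2_sq (\<lambda>x. if x \<in> A then f x else g x) \<le> L2_sq f + L2_sq g"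
proof -
  let ?k = "\<lambda>x. (cmod (f x))\<^sup>2 + (cmod (g x))\<^sup>2"
  have m: "(\<lambda>x. if x \<in> A then f x else g x) \<in> borel_measurable lborel"
    using assms by (auto simp: L2_fun_def intro!: measurable_If_set)
  have i: "integrable lborel ?k" using assms by (auto simp: L2_fun_def)
  have b: "(cmod (if x \<in> A then f x else g x))\<^sup>2 \<le> ?k x" for x by simp
  show "L2_fun (\<lambda>x. if x \<in> A then f x else g x)"
    by (rule L2_fun_bound(1)[OF m i b])
  show "L2_sq (\<lambda>x. if x \<in> A then f x else g x) \<le> L2_sq f + L2_sq g"
    using L2_fun_bound(2)[OF m i b] assms by (simp add: L2_fun_def L2_sq_def)
qed

lemma L2_fun_zero: "L2_fun (\<lambda>x. 0)" "L2_sq (\<lambda>x. 0) = 0"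
  by (simp_all add: L2_fun_def L2_sq_def)

lemma L2_fun_reflect:
  assumes "L2_fun h"
  shows "L2_fun (\<lambda>x. h (- x))" "L2_sq (\<lambda>x. h (- x)) = L2_sq h"
  using assms lborel_integrable_real_affine[of "\<lambda>x. (cmod (h x))\<^sup>2" "-1" 0]
    lborel_integral_real_affine[of "-1" "\<lambda>x. (cmod (h x))\<^sup>2" 0]
  by (auto simp: L2_fun_def L2_sq_def)

lemma nn_integral_L2:
  assumes "L2_fun h"
  shows "(\<integral>\<^sup>+x. (ennreal (cmod (h x)))\<^sup>2 \<partial>lborel) = ennreal (L2_sq h)"
  using assms unfolding L2_sq_def L2_fun_def
  by (subst nn_integral_eq_integral[symmetric]) (auto simp: ennreal_power)

lemma L2_fun_nn_integralI:
  assumes "h \<in> borel_measurable lborel" "(\<integral>\<^sup>+x. (ennreal (cmod (h x)))\<^sup>2 \<partial>lborel) \<le> ennreal B" "0 \<le> B"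
  shows "L2_fun h" "L2_sq h \<le> B"
proof -
  have "integrable lborel (\<lambda>x. (cmod (h x))\<^sup>2)"
    using assms le_less_trans[OF assms(2) ennreal_less_top]
    by (intro integrableI_nonneg) (auto simp: ennreal_power)
  then show "L2_fun h" using assms by (simp add: L2_fun_def)
  with assms show "L2_sq h \<le> B" using nn_integral_L2[of h] by simp
qed

lemma square_integrable_imp_locally_integrable:
  fixes h :: "real \<Rightarrow> 'a::{second_countable_topology,banach}"
  assumes "h \<in> borel_measurable lborel" "integrable lborel (\<lambda>x. (norm (h x))\<^sup>2)"
  shows "set_integrable lborel {a..b} h"
  unfolding set_integrable_def
proof (rule Bochner_Integration.integrable_bound)
  show "integrable lborel (\<lambda>x. indicator {a..b} x + (norm (h x))\<^sup>2)"
    by (intro Bochner_Integration.integrable_add integrable_real_indicator)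
      (use assms in \<open>auto simp: emeasure_lborel_Icc_eq\<close>)
  show "(\<lambda>x. indicator {a..b} x *\<^sub>R h x) \<in> borel_measurable lborel"
    using assms(1) by simp
  have "t \<le> 1 + t\<^sup>2" for t :: real
    using zero_le_power2[of "t - 1/2"] by (simp add: power2_eq_square algebra_simps)
  then show "AE x in lborel. norm (indicator {a..b} x *\<^sub>R h x) \<le> norm (indicator {a..b} x + (norm (h x))\<^sup>2)"
    by (auto simp: indicator_def)
qed

lemma L2_fun_locally_integrable: "L2_fun h \<Longrightarrow> set_integrable lborel {a..b} h"
  by (simp add: L2_fun_def square_integrable_imp_locally_integrable)

lemma L2_fun_product:
  assumes f: "L2_fun f" and g: "L2_fun g"
  shows "integrable lborel (\<lambda>x. f x * g x)"
    "(cmod (LBINT x. f x * g x))\<^sup>2 \<le> L2_sq f * L2_sq g"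
proof -
  have [measurable]: "f \<in> borel_measurable borel" "g \<in> borel_measurable borel"
    using assms by (auto simp: L2_fun_def)
  have N: "(\<integral>\<^sup>+x. ennreal (cmod (f x * g x)) \<partial>lborel)\<^sup>2 \<le> ennreal (L2_sq f * L2_sq g)"
    using Cauchy_Schwarz_nn_integral[of "\<lambda>x. ennreal (cmod (f x))" lborel "\<lambda>x. ennreal (cmod (g x))"]
    by (simp add: norm_mult ennreal_mult nn_integral_L2 f g L2_sq_nonneg)
  then have "(\<integral>\<^sup>+x. ennreal (cmod (f x * g x)) \<partial>lborel)\<^sup>2 < \<infinity>"
    using le_less_trans[OF N ennreal_less_top] by simp
  then have "(\<integral>\<^sup>+x. ennreal (cmod (f x * g x)) \<partial>lborel) < \<infinity>"
    by (metis ennreal_top_eq_mult_iff infinity_ennreal_def less_top power2_eq_square top_neq_ennreal zero_neq_one ennreal_zero_neq_top top.not_eq_extremum ennreal_top_mult mult_eq_0_iff)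
  then show I: "integrable lborel (\<lambda>x. f x * g x)"
    by (intro integrableI_bounded) auto
  have "ennreal (cmod (LBINT x. f x * g x)) \<le> (\<integral>\<^sup>+x. ennreal (cmod (f x * g x)) \<partial>lborel)"
    by (rule integral_norm_bound_ennreal[OF I])
  then have "(ennreal (cmod (LBINT x. f x * g x)))\<^sup>2 \<le> (\<integral>\<^sup>+x. ennreal (cmod (f x * g x)) \<partial>lborel)\<^sup>2"
    by (rule power_mono) simp
  from order_trans[OF this N]
  show "(cmod (LBINT x. f x * g x))\<^sup>2 \<le> L2_sq f * L2_sq g"
    by (simp add: ennreal_power L2_sq_nonneg)
qed

lemma nn_integral_exp_decay:
  assumes "0 < l"
  shows "(\<integral>\<^sup>+x. ennreal (exp (- l * (x - t)) * indicator {t..} x) \<partial>lborel) = ennreal (1 / l)"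
    "(\<integral>\<^sup>+t. ennreal (exp (- l * (x - t)) * indicator {..x} t) \<partial>lborel) = ennreal (1 / l)"
proof -
  have E: "(\<integral>\<^sup>+x. ennreal (exp (- l * (x - t)) * indicator {t..} x) \<partial>lborel) = ennreal (1 / l)" for t
  proof -
    have "(\<integral>\<^sup>+x. ennreal (exp (- l * (x - t))) * indicator {t..} x \<partial>lborel) = ennreal (0 - (- exp (- l * (t - t)) / l))"
    proof (rule nn_integral_FTC_atLeast[where F = "\<lambda>x. - exp (- l * (x - t)) / l"])
      show "DERIV (\<lambda>x. - exp (- l * (x - t)) / l) x :> exp (- l * (x - t))" for x
        using assms by (auto intro!: derivative_eq_intros)
      have "LIM x at_top. - l * (x - t) :> at_bot"
        using assms by (intro filterlim_tendsto_neg_mult_at_bot[OF tendsto_const])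
          (auto intro!: filterlim_tendsto_add_at_top[of "\<lambda>_. - t" "- t" _ "\<lambda>x. x", simplified]
            simp: filterlim_ident add.commute)
      then have "((\<lambda>x. exp (- l * (x - t))) \<longlongrightarrow> 0) at_top"
        by (rule filterlim_compose[OF exp_at_bot])
      from tendsto_divide[OF tendsto_minus[OF this] tendsto_const, of l]
      show "((\<lambda>x. - exp (- l * (x - t)) / l) \<longlongrightarrow> 0) at_top" using assms by simp
    qed auto
    then show ?thesis by (simp add: ennreal_mult' ennreal_indicator)
  qed
  show "(\<integral>\<^sup>+x. ennreal (exp (- l * (x - t)) * indicator {t..} x) \<partial>lborel) = ennreal (1 / l)" by (rule E)
  have "(\<integral>\<^sup>+t. ennreal (exp (- l * (x - t)) * indicator {..x} t) \<partial>lborel) =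
      (\<integral>\<^sup>+t. ennreal (exp (- l * (x - (0 + -1 * t))) * indicator {..x} (0 + -1 * t)) \<partial>lborel)"
    by (subst nn_integral_real_affine[where c = "-1" and t = 0]) auto
  also have "\<dots> = (\<integral>\<^sup>+t. ennreal (exp (- l * (t - (- x))) * indicator {-x..} t) \<partial>lborel)"
    by (intro nn_integral_cong arg_cong[where f = ennreal] arg_cong2[where f = "(*)"])
      (auto simp: indicator_def)
  also have "\<dots> = ennreal (1 / l)" by (rule E)
  finally show "(\<integral>\<^sup>+t. ennreal (exp (- l * (x - t)) * indicator {..x} t) \<partial>lborel) = ennreal (1 / l)" .
qed

text \<open>The kernel of the solution operator \<open>fwd\<close>; as functions of one variable, \<open>decay\<close> also gives the decaying
exponentials on the two half-lines.\<close>

definition decay :: "complex \<Rightarrow> real \<Rightarrow> real \<Rightarrow> complex" where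
  "decay \<kappa> x t = (if t \<le> x then exp (- \<kappa> * of_real (x - t)) else 0)"

lemma decay_measurable [measurable]: "decay \<kappa> x \<in> borel_measurable borel" "(\<lambda>x. decay \<kappa> x t) \<in> borel_measurable borel"
  unfolding decay_def by measurable

lemma norm_decay: "cmod (decay \<kappa> x t) = exp (- Re \<kappa> * (x - t)) * indicator {..x} t"
  by (simp add: decay_def norm_exp_eq_Re)

lemma L2_fun_decay:
  assumes "0 < Re \<kappa>"
  shows "L2_fun (decay \<kappa> x)" "L2_sq (decay \<kappa> x) = 1 / (2 * Re \<kappa>)"
proof -
  have "(\<integral>\<^sup>+t. (ennreal (cmod (decay \<kappa> x t)))\<^sup>2 \<partial>lborel) =
      (\<integral>\<^sup>+t. ennreal (exp (- (2 * Re \<kappa>) * (x - t)) * indicator {..x} t) \<partial>lborel)"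
  proof (intro nn_integral_cong)
    fix t
    have "(cmod (decay \<kappa> x t))\<^sup>2 = exp (- (2 * Re \<kappa>) * (x - t)) * indicator {..x} t"
      by (simp add: norm_decay power_mult_distrib indicator_def algebra_simps flip: exp_double)
    then show "(ennreal (cmod (decay \<kappa> x t)))\<^sup>2 = ennreal (exp (- (2 * Re \<kappa>) * (x - t)) * indicator {..x} t)"
      by (simp add: ennreal_power)
  qed
  also have "\<dots> = ennreal (1 / (2 * Re \<kappa>))"
    by (rule nn_integral_exp_decay) (use assms in simp)
  finally have I: "(\<integral>\<^sup>+t. (ennreal (cmod (decay \<kappa> x t)))\<^sup>2 \<partial>lborel) = ennreal (1 / (2 * Re \<kappa>))" .
  show L: "L2_fun (decay \<kappa> x)"
    by (rule L2_fun_nn_integralI[of _ "1 / (2 * Re \<kappa>)"]) (use assms I in auto)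
  show "L2_sq (decay \<kappa> x) = 1 / (2 * Re \<kappa>)"
    using I assms nn_integral_L2[OF L] by (simp add: L2_sq_nonneg)
qed

text \<open>The square-integrable solution of \<open>y' = - \<kappa> y + h\<close> on the whole line, for \<open>Re \<kappa> > 0\<close>.\<close>

definition fwd :: "complex \<Rightarrow> (real \<Rightarrow> complex) \<Rightarrow> real \<Rightarrow> complex" where
  "fwd \<kappa> h x = (LBINT t. decay \<kappa> x t * h t)"

lemma fwd_pointwise_bound:
  assumes "0 < Re \<kappa>" "L2_fun h"
  shows "(cmod (fwd \<kappa> h x))\<^sup>2 \<le> L2_sq h / (2 * Re \<kappa>)"
  using L2_fun_product(2)[OF L2_fun_decay(1)[OF assms(1)] assms(2)]
  by (simp add: fwd_def L2_fun_decay[OF assms(1)])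

text \<open>After multiplication with \<open>exp (\<kappa> x)\<close> the convolution becomes an ordinary integral from minus infinity to \<open>x\<close>, which has the
density \<open>exp (\<kappa> t) h t\<close>; the product rule undoes the multiplication.\<close>

lemma primitive_fwd:
  assumes "0 < Re \<kappa>" "L2_fun h"
  shows "primitive_on UNIV (fwd \<kappa> h) (\<lambda>x. - \<kappa> * fwd \<kappa> h x + h x)"
proof -
  define H where "H x = exp (\<kappa> * of_real x) * fwd \<kappa> h x" for x
  have "exp (\<kappa> * of_real x) * (decay \<kappa> x t * h t) = indicator {..x} t *\<^sub>R (exp (\<kappa> * of_real t) * h t)" for x t
  proof (cases "t \<le> x")
    case True
    have "exp (\<kappa> * of_real x) * exp (- \<kappa> * of_real (x - t)) = exp (\<kappa> * of_real t)"
      by (simp add: algebra_simps flip: exp_add)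
    then have "exp (\<kappa> * of_real x) * (exp (- \<kappa> * of_real (x - t)) * h t) = exp (\<kappa> * of_real t) * h t"
      by (simp only: mult.assoc[symmetric])
    with True show ?thesis by (simp add: decay_def)
  qed (simp add: decay_def)
  note eq = this
  have int: "set_integrable lborel {..x} (\<lambda>t. exp (\<kappa> * of_real t) * h t)" for x
    unfolding set_integrable_def eq[symmetric]
    using L2_fun_product(1)[OF L2_fun_decay(1)[OF assms(1)] assms(2), of x] by simp
  have H: "H x = (LBINT t:{..x}. exp (\<kappa> * of_real t) * h t)" for x
    unfolding H_def fwd_def set_lebesgue_integral_def by (simp add: eq flip: integral_mult_right_zero)
  have "primitive_on UNIV H (\<lambda>t. exp (\<kappa> * of_real t) * h t)"
    unfolding primitive_on_def
  proof (intro ballI impI conjI)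
    fix a b :: real assume "a \<le> b"
    show i: "set_integrable lborel {a..b} (\<lambda>t. exp (\<kappa> * of_real t) * h t)"
      by (rule set_integrable_subset[OF int[of b]]) auto
    have U: "{..b} = {..a} \<union> {a..b}" using \<open>a \<le> b\<close> by auto
    have "AE t in lborel. t \<noteq> a" by (rule AE_lborel_singleton)
    then have "AE t in lborel. \<not> (t \<in> {..a} \<and> t \<in> {a..b})" by eventually_elim auto
    then show "H b - H a = (LBINT t:{a..b}. exp (\<kappa> * of_real t) * h t)"
      unfolding H U by (subst set_integral_Un_AE) (use int i in auto)
  qed
  moreover have "((\<lambda>x. exp (- \<kappa> * of_real x)) has_vector_derivative - \<kappa> * exp (- \<kappa> * of_real x)) (at x)" for x
    by (rule has_vector_derivative_real_field) (auto intro!: derivative_eq_intros)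
  moreover have "continuous_on UNIV (\<lambda>x. - \<kappa> * exp (- \<kappa> * complex_of_real x))"
    by (intro continuous_intros)
  ultimately have "primitive_on UNIV (\<lambda>x. exp (- \<kappa> * of_real x) * H x)
      (\<lambda>x. - \<kappa> * exp (- \<kappa> * of_real x) * H x + exp (- \<kappa> * of_real x) * (exp (\<kappa> * of_real x) * h x))"
    by (intro primitive_on_product) auto
  moreover have "exp (- \<kappa> * of_real x) * H x = fwd \<kappa> h x" for x
    by (simp add: H_def exp_minus)
  moreover have "exp (- \<kappa> * of_real x) * (exp (\<kappa> * of_real x) * h x) = h x" for x
    by (simp add: exp_minus)
  ultimately show ?thesis by (simp only: mult.assoc)
qed

text \<open>Schur's test: the kernel has \<open>L\<^sup>1\<close> norm \<open>1 / Re \<kappa>\<close> in either variable, and the Cauchy--Schwarz inequality is applied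
after splitting the kernel into two square roots.\<close>

lemma L2_fun_fwd:
  assumes "0 < Re \<kappa>" "L2_fun h"
  shows "L2_fun (fwd \<kappa> h)" "L2_sq (fwd \<kappa> h) \<le> L2_sq h / (Re \<kappa>)\<^sup>2"
proof -
  define l where "l = Re \<kappa>"
  have l: "0 < l" using assms by (simp add: l_def)
  have [measurable]: "h \<in> borel_measurable borel" using assms by (simp add: L2_fun_def)
  have m: "fwd \<kappa> h \<in> borel_measurable lborel"
    by (rule primitive_on_UNIV_measurable[OF primitive_fwd[OF assms]])
  define K where "K x t = ennreal (exp (- l * (x - t)) * indicator {..x} t)" for x t :: real
  have K_meas: "(\<lambda>(x, t). K x t * (ennreal (cmod (h t)))\<^sup>2) \<in> borel_measurable (lborel \<Otimes>\<^sub>M lborel)"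
  proof -
    have tri[measurable]: "{q::real\<times>real. snd q \<le> fst q} \<in> sets (borel \<Otimes>\<^sub>M borel)"
      by (subst borel_prod) (intro borel_closed closed_Collect_le continuous_intros)
    have "(\<lambda>(x, t). K x t * (ennreal (cmod (h t)))\<^sup>2) = (\<lambda>(x, t). ennreal (exp (- l * (x - t)) *
        indicator {q. snd q \<le> fst q} (x, t)) * (ennreal (cmod (h t)))\<^sup>2)"
      by (auto simp: K_def indicator_def)
    also have "\<dots> \<in> borel_measurable (lborel \<Otimes>\<^sub>M lborel)" by measurable
    finally show ?thesis .
  qed
  have K_measx[measurable]: "K x \<in> borel_measurable borel" for x
    unfolding K_def by measurable
  have pw: "(ennreal (cmod (fwd \<kappa> h x)))\<^sup>2 \<le> ennreal (1 / l) * (\<integral>\<^sup>+t. K x t * (ennreal (cmod (h t)))\<^sup>2 \<partial>lborel)" for x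
  proof -
    define s where "s t = ennreal (sqrt (exp (- l * (x - t)) * indicator {..x} t))" for t
    have s2: "(s t)\<^sup>2 = K x t" for t
      by (simp add: s_def K_def ennreal_power)
    have [measurable]: "s \<in> borel_measurable borel" unfolding s_def by measurable
    have "ennreal (cmod (fwd \<kappa> h x)) \<le> (\<integral>\<^sup>+t. ennreal (cmod (decay \<kappa> x t * h t)) \<partial>lborel)"
      unfolding fwd_def
      by (rule integral_norm_bound_ennreal[OF L2_fun_product(1)[OF L2_fun_decay(1)[OF assms(1)] assms(2)]])
    also have "\<dots> = (\<integral>\<^sup>+t. s t * (s t * ennreal (cmod (h t))) \<partial>lborel)"
      by (intro nn_integral_cong)
        (simp add: norm_mult norm_decay ennreal_mult' l_def K_def mult.assoc[symmetric]
           s2[unfolded power2_eq_square])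
    finally have "(ennreal (cmod (fwd \<kappa> h x)))\<^sup>2 \<le> (\<integral>\<^sup>+t. s t * (s t * ennreal (cmod (h t))) \<partial>lborel)\<^sup>2"
      by (rule power_mono) simp
    also have "\<dots> \<le> (\<integral>\<^sup>+t. (s t)\<^sup>2 \<partial>lborel) * (\<integral>\<^sup>+t. (s t * ennreal (cmod (h t)))\<^sup>2 \<partial>lborel)"
      by (rule Cauchy_Schwarz_nn_integral) measurable
    also have "(\<integral>\<^sup>+t. (s t)\<^sup>2 \<partial>lborel) = ennreal (1 / l)"
      unfolding s2 K_def by (rule nn_integral_exp_decay(2)[OF l])
    finally show ?thesis by (simp add: power_mult_distrib s2)
  qed
  have "(\<integral>\<^sup>+x. (ennreal (cmod (fwd \<kappa> h x)))\<^sup>2 \<partial>lborel) \<le>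
      (\<integral>\<^sup>+x. ennreal (1 / l) * (\<integral>\<^sup>+t. K x t * (ennreal (cmod (h t)))\<^sup>2 \<partial>lborel) \<partial>lborel)"
    by (intro nn_integral_mono pw)
  also have "\<dots> = ennreal (1 / l) * (\<integral>\<^sup>+x. (\<integral>\<^sup>+t. K x t * (ennreal (cmod (h t)))\<^sup>2 \<partial>lborel) \<partial>lborel)"
    by (rule nn_integral_cmult[OF lborel.borel_measurable_nn_integral[OF K_meas]])
  also have "(\<integral>\<^sup>+x. (\<integral>\<^sup>+t. K x t * (ennreal (cmod (h t)))\<^sup>2 \<partial>lborel) \<partial>lborel) =
      (\<integral>\<^sup>+t. (\<integral>\<^sup>+x. K x t * (ennreal (cmod (h t)))\<^sup>2 \<partial>lborel) \<partial>lborel)"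
    by (rule lborel_pair.Fubini'[OF K_meas, symmetric])
  also have "\<dots> = (\<integral>\<^sup>+t. ennreal (1 / l) * (ennreal (cmod (h t)))\<^sup>2 \<partial>lborel)"
  proof (intro nn_integral_cong)
    fix t
    have "(\<integral>\<^sup>+x. K x t * (ennreal (cmod (h t)))\<^sup>2 \<partial>lborel) = (\<integral>\<^sup>+x. K x t \<partial>lborel) * (ennreal (cmod (h t)))\<^sup>2"
      unfolding K_def by (intro nn_integral_multc) (simp add: indicator_def)
    also have "(\<integral>\<^sup>+x. K x t \<partial>lborel) = (\<integral>\<^sup>+x. ennreal (exp (- l * (x - t)) * indicator {t..} x) \<partial>lborel)"
      unfolding K_def by (intro nn_integral_cong) (auto simp: indicator_def)
    also have "\<dots> = ennreal (1 / l)" by (rule nn_integral_exp_decay(1)[OF l])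
    finally show "(\<integral>\<^sup>+x. K x t * (ennreal (cmod (h t)))\<^sup>2 \<partial>lborel) = ennreal (1 / l) * (ennreal (cmod (h t)))\<^sup>2" .
  qed
  also have "\<dots> = ennreal (1 / l) * ennreal (L2_sq h)"
    by (subst nn_integral_cmult) (simp_all add: nn_integral_L2[OF assms(2)])
  finally have B: "(\<integral>\<^sup>+x. (ennreal (cmod (fwd \<kappa> h x)))\<^sup>2 \<partial>lborel) \<le> ennreal (L2_sq h / l\<^sup>2)"
    using l by (simp add: ennreal_mult'[symmetric] L2_sq_nonneg power2_eq_square)
  have "0 \<le> L2_sq h / l\<^sup>2" by (simp add: L2_sq_nonneg)
  from L2_fun_nn_integralI[OF m B this]
  show "L2_fun (fwd \<kappa> h)" "L2_sq (fwd \<kappa> h) \<le> L2_sq h / (Re \<kappa>)\<^sup>2"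
    by (simp_all add: l_def)
qed

lemma primitive_on_reflect:
  assumes "primitive_on UNIV F g"
  shows "primitive_on UNIV (\<lambda>x. F (- x)) (\<lambda>x. - g (- x))"
  unfolding primitive_on_def
proof (intro ballI impI)
  fix a b :: real assume "a \<le> b"
  then have i: "integrable lborel (\<lambda>t. indicator {-b..-a} t *\<^sub>R g t)"
    and e: "F (- a) - F (- b) = (LBINT t. indicator {-b..-a} t *\<^sub>R g t)"
    using primitive_onD[OF assms, of "-b" "-a"] by (auto simp: set_integrable_def set_lebesgue_integral_def)
  have ind: "indicator {-b..-a} (- t) = (indicator {a..b} t :: real)" for t
    by (auto simp: indicator_def)
  have "integrable lborel (\<lambda>t. indicator {a..b} t *\<^sub>R g (- t))"
    using lborel_integrable_real_affine[OF i, of "-1" 0] by (simp add: ind)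
  moreover have "F (- a) - F (- b) = (LBINT t. indicator {a..b} t *\<^sub>R g (- t))"
    unfolding e by (subst lborel_integral_real_affine[where c = "-1" and t = 0]) (simp_all add: ind)
  ultimately show "set_integrable lborel {a..b} (\<lambda>x. - g (- x)) \<and>
      F (- b) - F (- a) = (LBINT t:{a..b}. - g (- t))"
    using minus_diff_eq[of "F (- a)" "F (- b)"]
    by (simp add: set_integrable_def set_lebesgue_integral_def)
qed

text \<open>The mirror image of \<open>fwd\<close>, which solves \<open>y' = \<kappa> y - h\<close>.\<close>

definition bwd :: "complex \<Rightarrow> (real \<Rightarrow> complex) \<Rightarrow> real \<Rightarrow> complex" where
  "bwd \<kappa> h x = fwd \<kappa> (\<lambda>t. h (- t)) (- x)"

lemma bwd_pointwise_bound:
  assumes "0 < Re \<kappa>" "L2_fun h"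
  shows "(cmod (bwd \<kappa> h x))\<^sup>2 \<le> L2_sq h / (2 * Re \<kappa>)"
  using fwd_pointwise_bound[OF assms(1) L2_fun_reflect(1)[OF assms(2)], of "- x"]
  by (simp add: bwd_def L2_fun_reflect[OF assms(2)])

lemma primitive_bwd:
  assumes "0 < Re \<kappa>" "L2_fun h"
  shows "primitive_on UNIV (bwd \<kappa> h) (\<lambda>x. \<kappa> * bwd \<kappa> h x - h x)"
  using primitive_on_reflect[OF primitive_fwd[OF assms(1) L2_fun_reflect(1)[OF assms(2)]]]
  by (simp add: bwd_def[abs_def])

lemma L2_fun_bwd:
  assumes "0 < Re \<kappa>" "L2_fun h"
  shows "L2_fun (bwd \<kappa> h)" "L2_sq (bwd \<kappa> h) \<le> L2_sq h / (Re \<kappa>)\<^sup>2"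
  using L2_fun_fwd[OF assms(1) L2_fun_reflect(1)[OF assms(2)]]
    L2_fun_reflect[of "fwd \<kappa> (\<lambda>t. h (- t))"]
  by (auto simp: bwd_def[abs_def] L2_fun_reflect[OF assms(2)])

section \<open>Rotated coordinates on the Hilbert space\<close>

text \<open>The inverse of \<open>f \<mapsto> (f\<^sub>1 + i f\<^sub>2, f\<^sub>1 - i f\<^sub>2)\<close>. In these coordinates the mass term is the only coupling, and it
is small compared with \<open>z\<close> when \<open>z\<close> is large.\<close>

definition of_uv :: "complex \<Rightarrow> complex \<Rightarrow> complex^2" where
  "of_uv a b = vector [(a + b) / 2, (a - b) / (2 * \<i>)]"

lemma of_uv_nth [simp]: "of_uv a b $ 1 = (a + b) / 2" "of_uv a b $ 2 = (a - b) / (2 * \<i>)"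
  by (simp_all add: of_uv_def vector_2)

lemma of_uv_coords: "of_uv (w $ 1 + \<i> * w $ 2) (w $ 1 - \<i> * w $ 2) = w"
  by (simp add: vec_eq_iff forall_2)

lemma coords_of_uv:
  "of_uv a b $ 1 + \<i> * of_uv a b $ 2 = a" "of_uv a b $ 1 - \<i> * of_uv a b $ 2 = b"
  by (simp_all add: field_simps)

lemma of_uv_arith:
  "of_uv a b + of_uv c d = of_uv (a + c) (b + d)"
  "of_uv a b - of_uv c d = of_uv (a - c) (b - d)"
  "k *s of_uv a b = of_uv (k * a) (k * b)"
  "r *\<^sub>R of_uv a b = of_uv (r *\<^sub>R a) (r *\<^sub>R b)"
     apply (simp_all add: vec_eq_iff forall_2)
     apply (simp_all add: scaleR_conv_of_real field_simps)
  done

lemma norm_sq_vec2: "(norm (w :: complex^2))\<^sup>2 = (cmod (w $ 1))\<^sup>2 + (cmod (w $ 2))\<^sup>2"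
  by (simp add: norm_vec_def L2_set_def sum_2)

lemma norm_of_uv: "(norm (of_uv a b))\<^sup>2 = ((cmod a)\<^sup>2 + (cmod b)\<^sup>2) / 2"
  unfolding norm_sq_vec2 of_uv_nth norm_divide norm_mult
  by (simp add: cmod_power2 power_divide) (simp add: power2_eq_square field_simps)

lemma measurable_vec2:
  assumes "f \<in> borel_measurable M" "g \<in> borel_measurable M"
  shows "(\<lambda>x. of_uv (f x) (g x)) \<in> borel_measurable M"
proof -
  have "(\<lambda>x. of_uv (f x) (g x)) = (\<lambda>x. ((f x + g x) / 2) *s axis 1 1 + ((f x - g x) / (2 * \<i>)) *s axis 2 1)"
    by (auto simp: vec_eq_iff forall_2 axis_def)
  moreover have "bounded_linear (\<lambda>c. c *s (axis i 1 :: complex^2))" for i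
    by (intro linear_conv_bounded_linear[THEN iffD1] linearI) (simp_all add: vec_eq_iff algebra_simps)
  then have "(\<lambda>c. c *s (axis i 1 :: complex^2)) \<in> borel_measurable borel" for i
    by (intro borel_measurable_continuous_onI linear_continuous_on)
  ultimately show ?thesis
    using assms by (auto intro!: borel_measurable_add intro: measurable_compose)
qed

lemma square_integrable_of_uv:
  assumes "L2_fun u" "L2_fun v"
  shows "square_integrable (\<lambda>x. of_uv (u x) (v x))"
  using assms measurable_vec2[of u lborel v]
  by (auto simp: square_integrable_def L2_fun_def norm_of_uv)

lemma L2_fun_coords:
  assumes "square_integrable f"
  shows "L2_fun (\<lambda>x. f x $ 1 + \<i> * f x $ 2)" "L2_fun (\<lambda>x. f x $ 1 - \<i> * f x $ 2)"
proof -
  have c: "(\<lambda>w :: complex^2. w $ i) \<in> borel_measurable borel" for i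
    by (intro borel_measurable_continuous_onI linear_continuous_on bounded_linear_vec_nth)
  have "f \<in> borel_measurable borel" using assms by (simp add: square_integrable_def)
  then have m: "(\<lambda>x. f x $ i) \<in> borel_measurable borel" for i
    by (rule measurable_compose[OF _ c])
  have n: "2 * (norm w)\<^sup>2 = (cmod (w $ 1 + \<i> * w $ 2))\<^sup>2 + (cmod (w $ 1 - \<i> * w $ 2))\<^sup>2" for w :: "complex^2"
    using norm_of_uv[of "w $ 1 + \<i> * w $ 2" "w $ 1 - \<i> * w $ 2"] unfolding of_uv_coords by (simp only:) simp
  have b: "(cmod (w $ 1 + \<i> * w $ 2))\<^sup>2 \<le> 2 * (norm w)\<^sup>2" "(cmod (w $ 1 - \<i> * w $ 2))\<^sup>2 \<le> 2 * (norm w)\<^sup>2"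
    for w :: "complex^2"
    unfolding n by simp_all
  have i: "integrable lborel (\<lambda>x. 2 * (norm (f x))\<^sup>2)"
    using assms by (simp add: square_integrable_def)
  show "L2_fun (\<lambda>x. f x $ 1 + \<i> * f x $ 2)" "L2_fun (\<lambda>x. f x $ 1 - \<i> * f x $ 2)"
    by (rule L2_fun_bound(1)[OF _ i]; use m b in simp)+
qed

text \<open>All computations with elements of the Hilbert space are done on such a pair of scalar representatives, and every element arises
from one (\<open>L2_cases_uv\<close>).\<close>

definition L2_uv :: "(real \<Rightarrow> complex) \<Rightarrow> (real \<Rightarrow> complex) \<Rightarrow> L2" where
  "L2_uv u v = abs_L2 (\<lambda>x. of_uv (u x) (v x))"

lemma L2_eq_of_uv: "L2_fun u \<Longrightarrow> L2_fun v \<Longrightarrow> L2_eq (\<lambda>x. of_uv (u x) (v x)) (\<lambda>x. of_uv (u x) (v x))"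
  by (simp add: L2_eq_def square_integrable_of_uv)

lemma L2_cases_uv:
  obtains u v where "L2_fun u" "L2_fun v" "G = L2_uv u v"
proof -
  define f where "f = rep_L2 G"
  have "L2_eq f f" unfolding f_def by (rule Quotient_rep_reflp[OF Quotient_L2])
  then have "square_integrable f" by (simp add: L2_eq_def)
  moreover have "G = abs_L2 f" unfolding f_def by (simp add: Quotient_abs_rep[OF Quotient_L2])
  ultimately show thesis
    by (intro that[of "\<lambda>x. f x $ 1 + \<i> * f x $ 2" "\<lambda>x. f x $ 1 - \<i> * f x $ 2"])
      (auto simp: L2_fun_coords L2_uv_def of_uv_coords)
qed

lemma L2_uv_eq_iff:
  assumes "L2_fun u" "L2_fun v" "L2_fun u'" "L2_fun v'"
  shows "L2_uv u v = L2_uv u' v' \<longleftrightarrow> (AE x in lborel. u x = u' x \<and> v x = v' x)"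
proof -
  have "L2_uv u v = L2_uv u' v' \<longleftrightarrow> L2_eq (\<lambda>x. of_uv (u x) (v x)) (\<lambda>x. of_uv (u' x) (v' x))"
    unfolding L2_uv_def
    using Quotient_rel[OF Quotient_L2, of "\<lambda>x. of_uv (u x) (v x)" "\<lambda>x. of_uv (u' x) (v' x)"]
      L2_eq_of_uv[OF assms(1,2)] L2_eq_of_uv[OF assms(3,4)] by blast
  also have "\<dots> \<longleftrightarrow> (AE x in lborel. of_uv (u x) (v x) = of_uv (u' x) (v' x))"
    using assms by (simp add: L2_eq_def square_integrable_of_uv)
  also have "\<dots> \<longleftrightarrow> (AE x in lborel. u x = u' x \<and> v x = v' x)"
  proof -
    have "of_uv a b = of_uv a' b' \<longleftrightarrow> a = a' \<and> b = b'" for a b a' b'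
      by (metis coords_of_uv)
    then show ?thesis by simp
  qed
  finally show ?thesis .
qed

lemma L2_uv_add: "L2_fun u \<Longrightarrow> L2_fun v \<Longrightarrow> L2_fun u' \<Longrightarrow> L2_fun v' \<Longrightarrow>
    L2_uv u v + L2_uv u' v' = L2_uv (\<lambda>x. u x + u' x) (\<lambda>x. v x + v' x)"
  unfolding L2_uv_def
  by (subst plus_L2.abs_eq) (simp_all add: L2_eq_of_uv of_uv_arith)

lemma L2_uv_minus: "L2_fun u \<Longrightarrow> L2_fun v \<Longrightarrow> L2_fun u' \<Longrightarrow> L2_fun v' \<Longrightarrow>
    L2_uv u v - L2_uv u' v' = L2_uv (\<lambda>x. u x - u' x) (\<lambda>x. v x - v' x)"
  unfolding L2_uv_def
  by (subst minus_L2.abs_eq) (simp_all add: L2_eq_of_uv of_uv_arith)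

lemma L2_uv_scaleC: "L2_fun u \<Longrightarrow> L2_fun v \<Longrightarrow> scaleC_L2 c (L2_uv u v) = L2_uv (\<lambda>x. c * u x) (\<lambda>x. c * v x)"
  unfolding L2_uv_def
  by (subst scaleC_L2.abs_eq) (simp_all add: L2_eq_of_uv of_uv_arith)

lemma L2_uv_scaleR: "L2_fun u \<Longrightarrow> L2_fun v \<Longrightarrow> c *\<^sub>R L2_uv u v = L2_uv (\<lambda>x. c *\<^sub>R u x) (\<lambda>x. c *\<^sub>R v x)"
  unfolding L2_uv_def
  by (subst scaleR_L2.abs_eq) (simp_all add: L2_eq_of_uv of_uv_arith)

lemma norm_L2_uv:
  assumes "L2_fun u" "L2_fun v"
  shows "(norm (L2_uv u v))\<^sup>2 = (L2_sq u + L2_sq v) / 2"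
proof -
  have "norm (L2_uv u v) = sqrt (LBINT x. (norm (of_uv (u x) (v x)))\<^sup>2)"
    unfolding L2_uv_def by (rule norm_L2.abs_eq[OF L2_eq_of_uv[OF assms]])
  then show ?thesis
    using assms by (simp add: norm_of_uv L2_fun_def L2_sq_def)
qed

text \<open>The rotation turns the off-diagonal derivative matrix into the diagonal one with entries \<open>\<plusminus> i\<close>, and the diagonal mass matrix
into the exchange of the two components.\<close>

lemma L2_uv_dirac_expr:
  assumes "L2_fun u" "L2_fun v" "L2_fun u'" "L2_fun v'"
  shows "dirac_expr m (L2_uv u v) (L2_uv u' v') =
    L2_uv (\<lambda>x. of_real m * v x + \<i> * u' x + \<i> * of_real (sgn x) * u x)
      (\<lambda>x. of_real m * u x - \<i> * v' x + \<i> * of_real (sgn x) * v x)"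
  unfolding L2_uv_def
  by (subst dirac_expr.abs_eq)
    (auto intro!: L2_eq_of_uv assms arg_cong[of _ _ abs_L2]
      simp: fun_eq_iff vec_eq_iff forall_2 matrix_vector_mult_def sum_2 vector_2 field_simps)

lemma integrable_test_scaleR_L2:
  fixes f :: "real \<Rightarrow> complex^2"
  assumes "test_function \<phi>" "square_integrable f"
  shows "integrable lborel (\<lambda>x. \<phi> x *\<^sub>R f x)" "integrable lborel (\<lambda>x. deriv \<phi> x *\<^sub>R f x)"
proof -
  obtain N where N: "0 < N" "\<And>x. x \<notin> {-N<..<N} \<Longrightarrow> \<phi> x = 0" "\<And>x. x \<notin> {-N<..<N} \<Longrightarrow> deriv \<phi> x = 0"
    using test_function_support[OF assms(1)] by blast
  have "set_integrable lborel {-N<..<N} f"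
    by (rule set_integrable_subset[OF square_integrable_imp_locally_integrable[of f "-N" N]])
      (use assms(2) in \<open>auto simp: square_integrable_def\<close>)
  then show "integrable lborel (\<lambda>x. \<phi> x *\<^sub>R f x)" "integrable lborel (\<lambda>x. deriv \<phi> x *\<^sub>R f x)"
    using integrable_continuous_scaleR test_function_DERIV[OF assms(1)] N by blast+
qed

lemma has_weak_deriv_uv_iff:
  assumes "L2_fun u" "L2_fun v" "L2_fun u'" "L2_fun v'"
  shows "has_weak_deriv (L2_uv u v) (L2_uv u' v') \<longleftrightarrow> (\<forall>\<phi>. test_function \<phi> \<longrightarrow>
    (LBINT x. deriv \<phi> x *\<^sub>R u x) = - (LBINT x. \<phi> x *\<^sub>R u' x) \<and>
    (LBINT x. deriv \<phi> x *\<^sub>R v x) = - (LBINT x. \<phi> x *\<^sub>R v' x))"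
proof -
  have int: "integrable lborel (\<lambda>x. \<phi> x *\<^sub>R of_uv (u' x) (v' x))"
    "integrable lborel (\<lambda>x. deriv \<phi> x *\<^sub>R of_uv (u x) (v x))" if "test_function \<phi>" for \<phi>
    using integrable_test_scaleR_L2[OF that] square_integrable_of_uv assms by auto
  have coord: "(LBINT x. \<psi> x *\<^sub>R p x) = X $ 1 + \<i> * X $ 2" "(LBINT x. \<psi> x *\<^sub>R q x) = X $ 1 - \<i> * X $ 2"
    if X: "X = (LBINT x. \<psi> x *\<^sub>R of_uv (p x) (q x))"
      and i: "integrable lborel (\<lambda>x. \<psi> x *\<^sub>R of_uv (p x) (q x))" for \<psi> p q X
  proof -
    have b: "bounded_linear (\<lambda>w :: complex^2. w $ 1 + \<i> * w $ 2)" "bounded_linear (\<lambda>w :: complex^2. w $ 1 - \<i> * w $ 2)"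
      by (intro bounded_linear_add bounded_linear_sub bounded_linear_vec_nth
          bounded_linear_compose[OF bounded_linear_mult_right])+
    have e: "(\<psi> x *\<^sub>R of_uv (p x) (q x)) $ 1 + \<i> * (\<psi> x *\<^sub>R of_uv (p x) (q x)) $ 2 = \<psi> x *\<^sub>R p x"
      "(\<psi> x *\<^sub>R of_uv (p x) (q x)) $ 1 - \<i> * (\<psi> x *\<^sub>R of_uv (p x) (q x)) $ 2 = \<psi> x *\<^sub>R q x" for x
      by (simp_all only: of_uv_arith coords_of_uv)
    show "(LBINT x. \<psi> x *\<^sub>R p x) = X $ 1 + \<i> * X $ 2" "(LBINT x. \<psi> x *\<^sub>R q x) = X $ 1 - \<i> * X $ 2"
      using integral_bounded_linear[OF b(1) i] integral_bounded_linear[OF b(2) i]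
      unfolding e X by simp_all
  qed
  \<comment> \<open>an identity between vectors holds iff it holds in the rotated coordinates\<close>
  have eq: "X = - Y \<longleftrightarrow> X $ 1 + \<i> * X $ 2 = - (Y $ 1 + \<i> * Y $ 2) \<and> X $ 1 - \<i> * X $ 2 = - (Y $ 1 - \<i> * Y $ 2)"
    for X Y :: "complex^2"
  proof
    assume "X $ 1 + \<i> * X $ 2 = - (Y $ 1 + \<i> * Y $ 2) \<and> X $ 1 - \<i> * X $ 2 = - (Y $ 1 - \<i> * Y $ 2)"
    then have "of_uv (X $ 1 + \<i> * X $ 2) (X $ 1 - \<i> * X $ 2) =
        of_uv ((- Y) $ 1 + \<i> * (- Y) $ 2) ((- Y) $ 1 - \<i> * (- Y) $ 2)"
      by simp
    then show "X = - Y" by (simp only: of_uv_coords)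
  qed simp
  have "has_weak_deriv (L2_uv u v) (L2_uv u' v') \<longleftrightarrow> (\<forall>\<phi>. test_function \<phi> \<longrightarrow>
      (LBINT x. deriv \<phi> x *\<^sub>R of_uv (u x) (v x)) = - (LBINT x. \<phi> x *\<^sub>R of_uv (u' x) (v' x)))"
    unfolding L2_uv_def by (rule has_weak_deriv.abs_eq) (intro L2_eq_of_uv assms)+
  also have "\<dots> \<longleftrightarrow> (\<forall>\<phi>. test_function \<phi> \<longrightarrow>
    (LBINT x. deriv \<phi> x *\<^sub>R u x) = - (LBINT x. \<phi> x *\<^sub>R u' x) \<and>
    (LBINT x. deriv \<phi> x *\<^sub>R v x) = - (LBINT x. \<phi> x *\<^sub>R v' x))"
    using eq coord[OF refl int(1)] coord[OF refl int(2)] by (intro all_cong1 imp_cong refl) simp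
  finally show ?thesis .
qed

lemma has_weak_deriv_uvI:
  assumes "L2_fun u" "L2_fun v" "L2_fun u'" "L2_fun v'"
    and "primitive_on UNIV u u'" "primitive_on UNIV v v'"
  shows "has_weak_deriv (L2_uv u v) (L2_uv u' v')"
  using assms integration_by_parts_test_function(3)
  by (auto simp: has_weak_deriv_uv_iff)

lemma has_weak_deriv_uvE:
  assumes L: "L2_fun u" "L2_fun v" "L2_fun u'" "L2_fun v'"
    and "has_weak_deriv (L2_uv u v) (L2_uv u' v')"
  obtains U V where "L2_fun U" "L2_fun V" "L2_uv u v = L2_uv U V" "primitive_on UNIV U u'" "primitive_on UNIV V v'"
proof -
  note loc = L2_fun_locally_integrable
  have w: "(LBINT x. deriv \<phi> x *\<^sub>R u x) = - (LBINT x. \<phi> x *\<^sub>R u' x)"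
    "(LBINT x. deriv \<phi> x *\<^sub>R v x) = - (LBINT x. \<phi> x *\<^sub>R v' x)" if "test_function \<phi>" for \<phi>
    using assms that by (auto simp: has_weak_deriv_uv_iff)
  obtain U where U: "primitive_on UNIV U u'" "AE x in lborel. u x = U x"
    using weak_derivative_imp_primitive[OF loc[OF L(1)] loc[OF L(3)] w(1)] by blast
  obtain V where V: "primitive_on UNIV V v'" "AE x in lborel. v x = V x"
    using weak_derivative_imp_primitive[OF loc[OF L(2)] loc[OF L(4)] w(2)] by blast
  have cong: "L2_fun F" if "L2_fun f" "AE x in lborel. f x = F x" "F \<in> borel_measurable lborel" for f F
  proof -
    have "integrable lborel (\<lambda>x. (cmod (f x))\<^sup>2) \<longleftrightarrow> integrable lborel (\<lambda>x. (cmod (F x))\<^sup>2)"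
      using that by (intro integrable_cong_AE) (auto simp: L2_fun_def)
    with that show ?thesis by (simp add: L2_fun_def)
  qed
  have LU: "L2_fun U" by (rule cong[OF L(1) U(2) primitive_on_UNIV_measurable[OF U(1)]])
  have LV: "L2_fun V" by (rule cong[OF L(2) V(2) primitive_on_UNIV_measurable[OF V(1)]])
  have "L2_uv u v = L2_uv U V"
    using U(2) V(2) L LU LV by (simp add: L2_uv_eq_iff)
  then show thesis by (rule that[OF LU LV _ U(1) V(1)])
qed


text \<open>Bumps are test functions, and a locally integrable function that is orthogonal to all of them vanishes.\<close>

lemma weak_deriv_uv_unique:
  assumes L: "L2_fun u" "L2_fun v" "L2_fun u'" "L2_fun v'" "L2_fun u''" "L2_fun v''"
    and "has_weak_deriv (L2_uv u v) (L2_uv u' v')" "has_weak_deriv (L2_uv u v) (L2_uv u'' v'')"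
  shows "L2_uv u' v' = L2_uv u'' v''"
proof -
  have *: "AE x in lborel. p x = q x"
    if p: "L2_fun p" and q: "L2_fun q"
      and e: "\<And>\<phi>. test_function \<phi> \<Longrightarrow> (LBINT x. \<phi> x *\<^sub>R p x) = (LBINT x. \<phi> x *\<^sub>R q x)" for p q
  proof -
    have loc: "set_integrable lborel {a<..<b} h" if "L2_fun h" for a b h
      by (rule set_integrable_subset[OF L2_fun_locally_integrable[OF that, of a b]]) auto
    have i: "integrable lborel (\<lambda>x. bump a b n x *\<^sub>R h x)" if "L2_fun h" for a b n h
      by (rule integrable_continuous_scaleR[OF continuous_on_bump bump_zero loc[OF that]])
    have "AE x in lborel. p x - q x = 0"
    proof (rule AE_zero_if_bump_integrals_zero)
      show "set_integrable lborel {a<..<b} (\<lambda>x. p x - q x)" for a b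
        by (rule set_integral_diff(1)[OF loc[OF p] loc[OF q]])
      show "(LBINT x. bump a b n x *\<^sub>R (p x - q x)) = 0" for a b n
        using e[OF test_function_bump, of a b n] i[OF p, of a b n] i[OF q, of a b n]
        by (simp add: scaleR_diff_right)
    qed
    then show ?thesis by simp
  qed
  have "AE x in lborel. u' x = u'' x"
    by (rule *[OF L(3,5)]) (use assms(7,8) L in \<open>simp add: has_weak_deriv_uv_iff\<close>)
  moreover have "AE x in lborel. v' x = v'' x"
    by (rule *[OF L(4,6)]) (use assms(7,8) L in \<open>simp add: has_weak_deriv_uv_iff\<close>)
  ultimately show ?thesis using L by (simp add: L2_uv_eq_iff)
qed

lemma weak_deriv_uv:
  assumes "L2_fun u" "L2_fun v" "L2_fun u'" "L2_fun v'" "has_weak_deriv (L2_uv u v) (L2_uv u' v')"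
  shows "weak_deriv (L2_uv u v) = L2_uv u' v'"
  unfolding weak_deriv_def
proof (rule the_equality)
  fix g assume "has_weak_deriv (L2_uv u v) g"
  moreover obtain p q where "L2_fun p" "L2_fun q" "g = L2_uv p q" by (rule L2_cases_uv)
  ultimately show "g = L2_uv u' v'" using weak_deriv_uv_unique assms by blast
qed fact

section \<open>Homogeneous first-order systems\<close>

lemma primitive_on_cong:
  assumes "primitive_on S F g" "is_interval S" "\<And>x. x \<in> S \<Longrightarrow> F x = G x" "\<And>x. x \<in> S \<Longrightarrow> g x = h x"
  shows "primitive_on S G h"
  unfolding primitive_on_def
proof (intro ballI impI)
  fix a b assume ab: "a \<in> S" "b \<in> S" "a \<le> b"
  have eq: "(\<lambda>x. indicator {a..b} x *\<^sub>R g x) = (\<lambda>x. indicator {a..b} x *\<^sub>R h x)"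
    using assms(4) is_interval_Icc_subset[OF assms(2) ab(1,2)] by (auto simp: fun_eq_iff indicator_def)
  show "set_integrable lborel {a..b} h \<and> G b - G a = (LBINT t:{a..b}. h t)"
    using primitive_onD[OF assms(1) ab] assms(3)[OF ab(1)] assms(3)[OF ab(2)]
    unfolding set_integrable_def set_lebesgue_integral_def eq by simp
qed

text \<open>The origin is a null set for the equation, and continuity there is encoded in the fact that both closed half-lines contain it.\<close>

lemma primitive_sgn_iff:
  assumes m: "\<And>s. g s \<in> borel_measurable borel"
  shows "primitive_on UNIV F (\<lambda>x. g (sgn x) x) \<longleftrightarrow> primitive_on {0..} F (g 1) \<and> primitive_on {..0} F (g (- 1))"
proof -
  have eq: "(\<lambda>x. g (sgn x) x) = (\<lambda>x. if x \<in> {0<..} then g 1 x else if x \<in> {0} then g 0 x else g (- 1) x)"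
    by (auto simp: fun_eq_iff sgn_if)
  have gm: "(\<lambda>x. g (sgn x) x) \<in> borel_measurable lborel"
    unfolding eq using m by (intro measurable_If_set) auto
  have m': "g s \<in> borel_measurable lborel" for s using m by simp
  have ae: "AE x in lborel. x \<noteq> (0::real)" by (rule AE_lborel_singleton)
  then have ae1: "AE x in lborel. x \<in> {0..} \<longrightarrow> g (sgn x) x = g 1 x"
    and ae2: "AE x in lborel. x \<in> {..0} \<longrightarrow> g (sgn x) x = g (- 1) x"
    by (eventually_elim, simp add: sgn_if)+
  have ae': "AE x in lborel. x \<in> {0..} \<longrightarrow> g 1 x = g (sgn x) x" "AE x in lborel. x \<in> {..0} \<longrightarrow> g (- 1) x = g (sgn x) x"
    by (rule eventually_mono[OF ae1], simp) (rule eventually_mono[OF ae2], simp)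
  note I = is_interval_ci[of 0] is_interval_ic[of 0]
  have "primitive_on {0..} F (g 1) \<longleftrightarrow> primitive_on {0..} F (\<lambda>x. g (sgn x) x)"
    "primitive_on {..0} F (g (- 1)) \<longleftrightarrow> primitive_on {..0} F (\<lambda>x. g (sgn x) x)"
    using primitive_on_cong_AE[OF _ gm m' ae1 I(1)] primitive_on_cong_AE[OF _ gm m' ae2 I(2)]
      primitive_on_cong_AE[OF _ m' gm ae'(1) I(1)] primitive_on_cong_AE[OF _ m' gm ae'(2) I(2)] by blast+
  then show ?thesis
    using primitive_on_UNIV_if_halves primitive_on_subset[OF _ subset_UNIV] by blast
qed

lemma primitive_exp:
  "primitive_on S (\<lambda>x. c * exp (k * of_real x)) (\<lambda>x. k * (c * exp (k * of_real x)))"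
proof (rule primitive_on_C1)
  show "((\<lambda>x. c * exp (k * of_real x)) has_vector_derivative k * (c * exp (k * of_real x))) (at x)" for x
    by (rule has_vector_derivative_real_field) (auto intro!: derivative_eq_intros)
  show "continuous_on UNIV (\<lambda>x. k * (c * exp (k * complex_of_real x)))"
    by (intro continuous_intros)
qed

text \<open>The product of \<open>F\<close> with \<open>exp (- k x)\<close> has density zero.\<close>

lemma primitive_eq_exp:
  assumes "primitive_on S F (\<lambda>x. k * F x)" "is_interval S" "0 \<in> S" "x \<in> S"
  shows "F x = F 0 * exp (k * of_real x)"
proof -
  have d: "((\<lambda>x. exp (- k * of_real x)) has_vector_derivative - k * exp (- k * of_real x)) (at x)" for x
    by (rule has_vector_derivative_real_field) (auto intro!: derivative_eq_intros)
  have "continuous_on UNIV (\<lambda>x. - k * exp (- k * complex_of_real x))"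
    by (intro continuous_intros)
  from primitive_on_product[OF assms(1,2) d this]
  have P: "primitive_on S (\<lambda>x. exp (- k * of_real x) * F x) (\<lambda>x. 0)"
    by (simp add: algebra_simps)
  have "exp (- k * of_real x) * F x = exp (- k * of_real 0) * F 0"
    using primitive_onD(2)[OF P, of 0 x] primitive_onD(2)[OF P, of x 0] assms(3,4)
    by (cases "0 \<le> x") (auto simp: set_lebesgue_integral_def)
  then show ?thesis by (simp add: exp_minus field_simps)
qed

lemma L2_fun_not_bounded_below:
  assumes "L2_fun f" "\<And>x. 0 \<le> x \<Longrightarrow> c \<le> cmod (f x)"
  shows "c \<le> 0"
proof (rule ccontr)
  assume "\<not> c \<le> 0"
  then have c: "0 < c" by simp
  have "real n * c\<^sup>2 \<le> L2_sq f" for n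
  proof -
    have "(LBINT x. c\<^sup>2 * indicator {0..real n} x) \<le> L2_sq f"
      unfolding L2_sq_def
    proof (rule integral_mono)
      show "integrable lborel (\<lambda>x. c\<^sup>2 * indicator {0..real n} x)"
        by (intro integrable_mult_right integrable_real_indicator) (auto simp: emeasure_lborel_Icc_eq)
      show "integrable lborel (\<lambda>x. (cmod (f x))\<^sup>2)" using assms by (simp add: L2_fun_def)
      show "c\<^sup>2 * indicator {0..real n} x \<le> (cmod (f x))\<^sup>2" for x
        using assms(2)[of x] c by (auto simp: indicator_def intro!: power_mono)
    qed
    then show ?thesis by (simp add: mult.commute)
  qed
  moreover obtain n :: nat where "L2_sq f / c\<^sup>2 < real n" using reals_Archimedean2 by blast
  ultimately show False using c by (metis less_le_not_le pos_divide_less_eq zero_less_power)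
qed

text \<open>The imaginary part of the equation after multiplication with the conjugate of \<open>\<rho>\<close>. It shows that no root lies on the unit
circle unless \<open>w\<close> is real.\<close>

lemma char_root_Im:
  assumes "of_real m * \<rho>\<^sup>2 - 2 * w * \<rho> + of_real m = 0"
  shows "m * Im \<rho> * ((cmod \<rho>)\<^sup>2 - 1) = 2 * (cmod \<rho>)\<^sup>2 * Im w"
proof -
  define a b p q where "a = Re \<rho>" "b = Im \<rho>" "p = Re w" "q = Im w"
  have re: "m * (a\<^sup>2 - b\<^sup>2) - 2 * (p * a - q * b) + m = 0"
    and im: "2 * m * a * b - 2 * (p * b + q * a) = 0"
    using assms by (simp_all add: complex_eq_iff a_b_p_q_def power2_eq_square algebra_simps)
  have "m * b * (a\<^sup>2 + b\<^sup>2 - 1) - 2 * (a\<^sup>2 + b\<^sup>2) * q =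
      a * (2 * m * a * b - 2 * (p * b + q * a)) - b * (m * (a\<^sup>2 - b\<^sup>2) - 2 * (p * a - q * b) + m)"
    by (simp add: power2_eq_square algebra_simps)
  also have "\<dots> = 0" unfolding re im by simp
  finally show ?thesis by (simp add: cmod_power2 flip: a_b_p_q_def)
qed

text \<open>For \<open>|\<rho>| < 1\<close> the real part of the rate \<open>i (w - m \<rho>)\<close> has the sign of \<open>- Im w\<close> and at least the modulus of \<open>Im w\<close>. This is the
balance law for \<open>|u|\<^sup>2 - |v|\<^sup>2\<close> along the decaying exponential, in algebraic form.\<close>

lemma char_root_Re_exponent:
  assumes "of_real m * \<rho>\<^sup>2 - 2 * w * \<rho> + of_real m = 0"
  shows "Re (\<i> * (w - of_real m * \<rho>)) * (1 - (cmod \<rho>)\<^sup>2) = - Im w * (1 + (cmod \<rho>)\<^sup>2)"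
  using char_root_Im[OF assms] by (simp add: algebra_simps)

lemma div_combine:
  fixes D :: complex
  shows "D \<noteq> 0 \<Longrightarrow> D * X = A + r * B \<Longrightarrow> 1 / D * A + r / D * B = X"
  by (simp add: field_simps)

text \<open>If \<open>\<rho>\<close> solves \<open>m \<rho>\<^sup>2 - 2 w \<rho> + m = 0\<close>, then \<open>\<xi> = v - \<rho> u\<close> and \<open>\<eta> = u - \<rho> v\<close> satisfy two uncoupled equations, with rates
\<open>\<mu>\<close> and \<open>- \<mu>\<close>. Both directions are used: solutions are built from \<open>\<xi>\<close> and \<open>\<eta>\<close>, and uniqueness is read off from
them in \<open>uv_to_diagonal\<close>.\<close>

lemma diagonal_to_uv:
  fixes m :: real and w \<rho> :: complex
  defines "\<mu> \<equiv> \<i> * (w - of_real m * \<rho>)"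
  assumes root: "of_real m * \<rho>\<^sup>2 - 2 * w * \<rho> + of_real m = 0" and "1 - \<rho>\<^sup>2 \<noteq> 0"
    and \<xi>: "primitive_on S \<xi> (\<lambda>x. \<mu> * \<xi> x + \<i> * (Gv x + \<rho> * Gu x))"
    and \<eta>: "primitive_on S \<eta> (\<lambda>x. - \<mu> * \<eta> x - \<i> * (Gu x + \<rho> * Gv x))"
  defines "u \<equiv> \<lambda>x. (\<eta> x + \<rho> * \<xi> x) / (1 - \<rho>\<^sup>2)" and "v \<equiv> \<lambda>x. (\<xi> x + \<rho> * \<eta> x) / (1 - \<rho>\<^sup>2)"
  shows "primitive_on S u (\<lambda>x. \<i> * m * v x - \<i> * w * u x - \<i> * Gu x)"
    "primitive_on S v (\<lambda>x. - \<i> * m * u x + \<i> * w * v x + \<i> * Gv x)"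
proof -
  define D where "D = 1 - \<rho>\<^sup>2"
  have D: "D \<noteq> 0" using assms(3) by (simp add: D_def)
  have Du: "D * u x = \<eta> x + \<rho> * \<xi> x" and Dv: "D * v x = \<xi> x + \<rho> * \<eta> x" for x
    using D by (simp_all add: u_def v_def flip: D_def)
  have r: "2 * w * \<rho> = of_real m + of_real m * \<rho>\<^sup>2" using root by (simp add: algebra_simps)
  have "primitive_on S (\<lambda>x. 1 / D * \<eta> x + \<rho> / D * \<xi> x)
      (\<lambda>x. 1 / D * (- \<mu> * \<eta> x - \<i> * (Gu x + \<rho> * Gv x)) + \<rho> / D * (\<mu> * \<xi> x + \<i> * (Gv x + \<rho> * Gu x)))"
    by (rule primitive_on_linear[OF \<eta> \<xi>])
  moreover have "1 / D * \<eta> x + \<rho> / D * \<xi> x = u x" for x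
    by (simp add: u_def D_def add_divide_distrib)
  moreover have "1 / D * (- \<mu> * \<eta> x - \<i> * (Gu x + \<rho> * Gv x)) + \<rho> / D * (\<mu> * \<xi> x + \<i> * (Gv x + \<rho> * Gu x))
      = \<i> * m * v x - \<i> * w * u x - \<i> * Gu x" for x
  proof -
    have "D * (\<i> * m * v x - \<i> * w * u x - \<i> * Gu x) = \<i> * m * (D * v x) - \<i> * w * (D * u x) - \<i> * D * Gu x"
      by (simp add: algebra_simps)
    also have "\<dots> = (- \<mu> * \<eta> x - \<i> * (Gu x + \<rho> * Gv x)) + \<rho> * (\<mu> * \<xi> x + \<i> * (Gv x + \<rho> * Gu x))
      + \<i> * \<xi> x * (of_real m + of_real m * \<rho>\<^sup>2 - 2 * w * \<rho>)"
      unfolding Du Dv unfolding D_def \<mu>_def by (simp add: power2_eq_square algebra_simps)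
    finally show ?thesis by (intro div_combine[OF D]) (simp add: r)
  qed
  ultimately show "primitive_on S u (\<lambda>x. \<i> * m * v x - \<i> * w * u x - \<i> * Gu x)" by simp
  have "primitive_on S (\<lambda>x. 1 / D * \<xi> x + \<rho> / D * \<eta> x)
      (\<lambda>x. 1 / D * (\<mu> * \<xi> x + \<i> * (Gv x + \<rho> * Gu x)) + \<rho> / D * (- \<mu> * \<eta> x - \<i> * (Gu x + \<rho> * Gv x)))"
    by (rule primitive_on_linear[OF \<xi> \<eta>])
  moreover have "1 / D * \<xi> x + \<rho> / D * \<eta> x = v x" for x
    by (simp add: v_def D_def add_divide_distrib)
  moreover have "1 / D * (\<mu> * \<xi> x + \<i> * (Gv x + \<rho> * Gu x)) + \<rho> / D * (- \<mu> * \<eta> x - \<i> * (Gu x + \<rho> * Gv x))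
      = - \<i> * m * u x + \<i> * w * v x + \<i> * Gv x" for x
  proof -
    have "D * (- \<i> * m * u x + \<i> * w * v x + \<i> * Gv x) = - \<i> * m * (D * u x) + \<i> * w * (D * v x) + \<i> * D * Gv x"
      by (simp add: algebra_simps)
    also have "\<dots> = (\<mu> * \<xi> x + \<i> * (Gv x + \<rho> * Gu x)) + \<rho> * (- \<mu> * \<eta> x - \<i> * (Gu x + \<rho> * Gv x))
      - \<i> * \<eta> x * (of_real m + of_real m * \<rho>\<^sup>2 - 2 * w * \<rho>)"
      unfolding Du Dv unfolding D_def \<mu>_def by (simp add: power2_eq_square algebra_simps)
    finally show ?thesis by (intro div_combine[OF D]) (simp add: r)
  qed
  ultimately show "primitive_on S v (\<lambda>x. - \<i> * m * u x + \<i> * w * v x + \<i> * Gv x)" by simp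
qed

lemma uv_to_diagonal:
  fixes m :: real and w \<rho> :: complex
  defines "\<mu> \<equiv> \<i> * (w - of_real m * \<rho>)"
  assumes root: "of_real m * \<rho>\<^sup>2 - 2 * w * \<rho> + of_real m = 0"
    and u: "primitive_on S u (\<lambda>x. \<i> * m * v x - \<i> * w * u x)"
    and v: "primitive_on S v (\<lambda>x. - \<i> * m * u x + \<i> * w * v x)"
  shows "primitive_on S (\<lambda>x. v x - \<rho> * u x) (\<lambda>x. \<mu> * (v x - \<rho> * u x))"
    "primitive_on S (\<lambda>x. u x - \<rho> * v x) (\<lambda>x. - \<mu> * (u x - \<rho> * v x))"
proof -
  have r: "2 * w * \<rho> = of_real m + of_real m * \<rho>\<^sup>2" using root by (simp add: algebra_simps)
  have a: "- \<i> * m * u x + \<i> * w * v x - \<rho> * (\<i> * m * v x - \<i> * w * u x) = \<mu> * (v x - \<rho> * u x)" for x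
  proof -
    have "\<mu> * (v x - \<rho> * u x) = - \<i> * m * u x + \<i> * w * v x - \<rho> * (\<i> * m * v x - \<i> * w * u x)
      + \<i> * u x * (of_real m + of_real m * \<rho>\<^sup>2 - 2 * w * \<rho>)"
      unfolding \<mu>_def by (simp add: power2_eq_square algebra_simps)
    then show ?thesis by (simp add: r)
  qed
  have b: "\<i> * m * v x - \<i> * w * u x - \<rho> * (- \<i> * m * u x + \<i> * w * v x) = - \<mu> * (u x - \<rho> * v x)" for x
  proof -
    have "- \<mu> * (u x - \<rho> * v x) = \<i> * m * v x - \<i> * w * u x - \<rho> * (- \<i> * m * u x + \<i> * w * v x)
      - \<i> * v x * (of_real m + of_real m * \<rho>\<^sup>2 - 2 * w * \<rho>)"
      unfolding \<mu>_def by (simp add: power2_eq_square algebra_simps)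
    then show ?thesis by (simp add: r)
  qed
  show "primitive_on S (\<lambda>x. v x - \<rho> * u x) (\<lambda>x. \<mu> * (v x - \<rho> * u x))"
    using primitive_on_linear[OF v u, of 1 "- \<rho>"] a by simp
  show "primitive_on S (\<lambda>x. u x - \<rho> * v x) (\<lambda>x. - \<mu> * (u x - \<rho> * v x))"
    using primitive_on_linear[OF u v, of 1 "- \<rho>"] b by simp
qed

lemma L2_fun_three_terms:
  assumes L: "L2_fun p" "L2_fun q" "L2_fun e" and ab: "cmod a \<le> 1" "cmod b \<le> 1"
  shows "L2_fun (\<lambda>x. (a * p x + b * q x - c * e x) / D)"
    "L2_sq (\<lambda>x. (a * p x + b * q x - c * e x) / D) \<le>
      (4 * L2_sq p + 4 * L2_sq q + 2 * (cmod c)\<^sup>2 * L2_sq e) / (cmod D)\<^sup>2"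
proof -
  let ?pq = "\<lambda>x. a * p x + b * q x"
  note pq = L2_fun_linear[OF L(1,2), of a b]
  note pqe = L2_fun_linear[OF pq(1) L(3), of 1 "- c"]
  have eq: "(\<lambda>x. (a * p x + b * q x - c * e x) / D) = (\<lambda>x. 1 / D * (1 * ?pq x + - c * e x))"
    by (simp add: fun_eq_iff diff_divide_distrib add_divide_distrib)
  show "L2_fun (\<lambda>x. (a * p x + b * q x - c * e x) / D)"
    unfolding eq by (rule L2_fun_cmult(1)[OF pqe(1)])
  have "L2_sq ?pq \<le> 2 * L2_sq p + 2 * L2_sq q"
  proof -
    have "(cmod a)\<^sup>2 \<le> 1" "(cmod b)\<^sup>2 \<le> 1" using ab by (simp_all add: power_le_one)
    then have "(cmod a)\<^sup>2 * L2_sq p \<le> L2_sq p" "(cmod b)\<^sup>2 * L2_sq q \<le> L2_sq q"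
      by (simp_all add: L2_sq_nonneg mult_left_le_one_le)
    then show ?thesis using pq(2) by simp
  qed
  then have "L2_sq (\<lambda>x. 1 * ?pq x + - c * e x) \<le> 4 * L2_sq p + 4 * L2_sq q + 2 * (cmod c)\<^sup>2 * L2_sq e"
    using pqe(2) by simp
  then show "L2_sq (\<lambda>x. (a * p x + b * q x - c * e x) / D) \<le>
      (4 * L2_sq p + 4 * L2_sq q + 2 * (cmod c)\<^sup>2 * L2_sq e) / (cmod D)\<^sup>2"
    unfolding eq L2_fun_cmult(2)[OF pqe(1)]
    by (simp add: norm_divide power_divide divide_right_mono)
qed

text \<open>The coefficient \<open>w\<close> is \<open>z - i\<close> on the right and \<open>z + i\<close> on the left half-line, so \<open>\<rho>\<close> belongs to the right and \<open>\<sigma>\<close> to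
the left.\<close>

locale dirac_gap =
  fixes m :: real and z \<rho> \<sigma> :: complex
  assumes m_pos: "0 < m" and Im_z: "\<bar>Im z\<bar> < 1"
    and rho_less: "cmod \<rho> < 1" and rho_root: "of_real m * \<rho>\<^sup>2 - 2 * (z - \<i>) * \<rho> + of_real m = 0"
    and sigma_less: "cmod \<sigma> < 1" and sigma_root: "of_real m * \<sigma>\<^sup>2 - 2 * (z + \<i>) * \<sigma> + of_real m = 0"
begin

text \<open>Both \<open>\<mu>\<close> and \<open>\<kappa>\<close> are decay rates away from the origin. The minus sign in \<open>\<kappa>\<close> is there because on the left
\<open>Im w > 0\<close>, which makes the real part of \<open>i (w - m \<sigma>)\<close> negative.\<close>

definition \<mu> :: complex where "\<mu> = \<i> * ((z - \<i>) - of_real m * \<rho>)"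

definition \<kappa> :: complex where "\<kappa> = - (\<i> * ((z + \<i>) - of_real m * \<sigma>))"

lemma cmod_sq_less: "(cmod \<rho>)\<^sup>2 < 1" "(cmod \<sigma>)\<^sup>2 < 1"
  using rho_less sigma_less by (simp_all add: power_less_one_iff)

lemma Re_mu: "Re \<mu> * (1 - (cmod \<rho>)\<^sup>2) = (1 - Im z) * (1 + (cmod \<rho>)\<^sup>2)"
  using char_root_Re_exponent[OF rho_root] by (simp add: \<mu>_def)

lemma Re_kappa: "Re \<kappa> * (1 - (cmod \<sigma>)\<^sup>2) = (1 + Im z) * (1 + (cmod \<sigma>)\<^sup>2)"
  using char_root_Re_exponent[OF sigma_root] by (simp add: \<kappa>_def algebra_simps)

lemma gap_le: "1 - \<bar>Im z\<bar> \<le> Re \<mu>" "1 - \<bar>Im z\<bar> \<le> Re \<kappa>" "0 < 1 - \<bar>Im z\<bar>"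
proof -
  have *: "g \<le> X" if "X * (1 - t) = c * (1 + t)" "0 \<le> t" "t < 1" "g \<le> c" "0 < g" for X t c g :: real
  proof -
    have "g * (1 - t) \<le> g * (1 + t)" using that by simp
    also have "\<dots> \<le> c * (1 + t)" using that by simp
    finally have "g * (1 - t) \<le> X * (1 - t)" using that(1) by simp
    then show ?thesis using that(3) by simp
  qed
  show "0 < 1 - \<bar>Im z\<bar>" using Im_z by simp
  then show "1 - \<bar>Im z\<bar> \<le> Re \<mu>" "1 - \<bar>Im z\<bar> \<le> Re \<kappa>"
    using *[OF Re_mu] *[OF Re_kappa] cmod_sq_less by auto
qed

lemma Re_pos: "0 < Re \<mu>" "0 < Re \<kappa>"
  using gap_le by auto

lemma one_minus_sq_nonzero: "1 - \<rho>\<^sup>2 \<noteq> 0" "1 - \<sigma>\<^sup>2 \<noteq> 0"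
proof -
  have "cmod (\<rho>\<^sup>2) < 1" "cmod (\<sigma>\<^sup>2) < 1" using cmod_sq_less by (simp_all add: norm_power)
  then show "1 - \<rho>\<^sup>2 \<noteq> 0" "1 - \<sigma>\<^sup>2 \<noteq> 0"
    by (metis eq_iff_diff_eq_0 less_irrefl norm_one)+
qed

text \<open>A common root of the two equations would be a root of their difference \<open>4 i r\<close>, but \<open>m > 0\<close> excludes zero.\<close>

lemma rho_neq_sigma: "\<rho> \<noteq> \<sigma>"
proof
  assume eq: "\<rho> = \<sigma>"
  have "4 * \<i> * \<sigma> = (of_real m * \<sigma>\<^sup>2 - 2 * (z - \<i>) * \<sigma> + of_real m) -
      (of_real m * \<sigma>\<^sup>2 - 2 * (z + \<i>) * \<sigma> + of_real m)"
    by (simp add: algebra_simps)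
  also have "\<dots> = 0"
    using rho_root[unfolded eq] sigma_root by (simp only:) simp
  finally have "\<sigma> = 0" by simp
  then show False using sigma_root m_pos by simp
qed

text \<open>The decaying homogeneous solutions on the two half-lines, normalised to \<open>u 0 = 1\<close>. Their second components take the different
values \<open>\<rho>\<close> and \<open>\<sigma>\<close> at the origin, so \<open>\<Phi>\<close> misses the domain of the operator by the small jump \<open>\<rho> - \<sigma>\<close>.\<close>

definition \<Phi>\<^sub>u :: "real \<Rightarrow> complex" where
  "\<Phi>\<^sub>u x = (if x \<in> {0..} then decay \<mu> x 0 else decay \<kappa> 0 x)"

definition \<Phi>\<^sub>v :: "real \<Rightarrow> complex" where
  "\<Phi>\<^sub>v x = (if x \<in> {0..} then \<rho> * decay \<mu> x 0 else \<sigma> * decay \<kappa> 0 x)"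

lemma L2_fun_decay_right: "L2_fun (\<lambda>x. decay \<mu> x 0)" "L2_sq (\<lambda>x. decay \<mu> x 0) = 1 / (2 * Re \<mu>)"
proof -
  have "(\<lambda>x. decay \<mu> x 0) = (\<lambda>x. decay \<mu> 0 (- x))" by (auto simp: decay_def)
  then show "L2_fun (\<lambda>x. decay \<mu> x 0)" "L2_sq (\<lambda>x. decay \<mu> x 0) = 1 / (2 * Re \<mu>)"
    using L2_fun_reflect[OF L2_fun_decay(1)[OF Re_pos(1)]] L2_fun_decay(2)[OF Re_pos(1)] by simp_all
qed

lemmas L2_fun_decay_left = L2_fun_decay[OF Re_pos(2), of 0]

lemma L2_fun_Phi: "L2_fun \<Phi>\<^sub>u" "L2_fun \<Phi>\<^sub>v"
  unfolding \<Phi>\<^sub>u_def[abs_def] \<Phi>\<^sub>v_def[abs_def]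
  by (intro L2_fun_if L2_fun_cmult L2_fun_decay_right L2_fun_decay_left; simp)+

definition \<Phi>_sq :: real where "\<Phi>_sq = L2_sq \<Phi>\<^sub>u + L2_sq \<Phi>\<^sub>v"

text \<open>Directly, the right half-line contributes \<open>(1 + |\<rho>|\<^sup>2) / (2 Re \<mu>)\<close>; \<open>Re_mu\<close> trades \<open>Re \<mu>\<close> for the distance of
\<open>z - i\<close> to the real axis, and with it the dependence on \<open>\<rho>\<close> stays of second order.\<close>

lemma \<Phi>_sq_eq: "\<Phi>_sq = (1 - (cmod \<rho>)\<^sup>2) / (2 * (1 - Im z)) + (1 - (cmod \<sigma>)\<^sup>2) / (2 * (1 + Im z))"
proof -
  note i = L2_fun_decay_right(1)[unfolded L2_fun_def, THEN conjunct2] L2_fun_decay_left(1)[unfolded L2_fun_def, THEN conjunct2]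
  have ae: "AE x in lborel. x \<noteq> (0::real)" by (rule AE_lborel_singleton)
  have m: "\<Phi>\<^sub>u \<in> borel_measurable borel" "\<Phi>\<^sub>v \<in> borel_measurable borel"
    using L2_fun_Phi by (auto simp: L2_fun_def)
  have "L2_sq \<Phi>\<^sub>u = (LBINT x. (cmod (decay \<mu> x 0))\<^sup>2 + (cmod (decay \<kappa> 0 x))\<^sup>2)"
    unfolding L2_sq_def
    by (intro integral_cong_AE eventually_mono[OF ae]) (use m in \<open>auto simp: \<Phi>\<^sub>u_def decay_def\<close>)
  also have "\<dots> = 1 / (2 * Re \<mu>) + 1 / (2 * Re \<kappa>)"
    using i L2_fun_decay_right(2) L2_fun_decay_left(2) by (simp add: L2_sq_def)
  finally have u: "L2_sq \<Phi>\<^sub>u = 1 / (2 * Re \<mu>) + 1 / (2 * Re \<kappa>)" .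
  have "L2_sq \<Phi>\<^sub>v = (LBINT x. (cmod \<rho>)\<^sup>2 * (cmod (decay \<mu> x 0))\<^sup>2 + (cmod \<sigma>)\<^sup>2 * (cmod (decay \<kappa> 0 x))\<^sup>2)"
    unfolding L2_sq_def
    by (intro integral_cong_AE eventually_mono[OF ae])
      (use m in \<open>auto simp: \<Phi>\<^sub>v_def decay_def norm_mult power_mult_distrib\<close>)
  also have "\<dots> = (cmod \<rho>)\<^sup>2 / (2 * Re \<mu>) + (cmod \<sigma>)\<^sup>2 / (2 * Re \<kappa>)"
    using i L2_fun_decay_right(2) L2_fun_decay_left(2) by (simp add: L2_sq_def)
  finally have v: "L2_sq \<Phi>\<^sub>v = (cmod \<rho>)\<^sup>2 / (2 * Re \<mu>) + (cmod \<sigma>)\<^sup>2 / (2 * Re \<kappa>)" .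
  have *: "(1 + t) / (2 * X) = (1 - t) / (2 * c)"
    if "X * (1 - t) = c * (1 + t)" "0 < X" "0 < c" for X t c :: real
    using that by (simp add: frac_eq_eq) (simp add: mult_ac)
  have "\<Phi>_sq = (1 + (cmod \<rho>)\<^sup>2) / (2 * Re \<mu>) + (1 + (cmod \<sigma>)\<^sup>2) / (2 * Re \<kappa>)"
    by (simp add: \<Phi>_sq_def u v add_divide_distrib)
  then show ?thesis
    using *[OF Re_mu Re_pos(1)] *[OF Re_kappa Re_pos(2)] Im_z by simp
qed

lemma \<Phi>_sq_pos: "0 < \<Phi>_sq"
  unfolding \<Phi>_sq_eq using cmod_sq_less Im_z by (intro add_pos_pos divide_pos_pos) auto

text \<open>The growing components \<open>v - \<rho> u\<close> on the right and \<open>v - \<sigma> u\<close> on the left must vanish for a square-integrable solution. At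
the origin this gives \<open>v 0 = \<rho> u 0 = \<sigma> u 0\<close>, so the data at the origin are zero.\<close>

lemma homogeneous_solution_zero:
  assumes L: "L2_fun u" "L2_fun v"
    and u: "primitive_on UNIV u (\<lambda>x. \<i> * m * v x - \<i> * (z - \<i> * of_real (sgn x)) * u x)"
    and v: "primitive_on UNIV v (\<lambda>x. - \<i> * m * u x + \<i> * (z - \<i> * of_real (sgn x)) * v x)"
  shows "u x = 0" "v x = 0"
proof -
  have [measurable]: "u \<in> borel_measurable borel" "v \<in> borel_measurable borel"
    using L by (auto simp: L2_fun_def)
  have uR: "primitive_on {0..} u (\<lambda>x. \<i> * m * v x - \<i> * (z - \<i>) * u x)"
    and uL: "primitive_on {..0} u (\<lambda>x. \<i> * m * v x - \<i> * (z + \<i>) * u x)"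
    using u by (subst (asm) primitive_sgn_iff[where g = "\<lambda>s x. \<i> * m * v x - \<i> * (z - \<i> * of_real s) * u x"]; simp)+
  have vR: "primitive_on {0..} v (\<lambda>x. - \<i> * m * u x + \<i> * (z - \<i>) * v x)"
    and vL: "primitive_on {..0} v (\<lambda>x. - \<i> * m * u x + \<i> * (z + \<i>) * v x)"
    using v by (subst (asm) primitive_sgn_iff[where g = "\<lambda>s x. - \<i> * m * u x + \<i> * (z - \<i> * of_real s) * v x"]; simp)+
  note R = uv_to_diagonal[OF rho_root uR vR, folded \<mu>_def]
  note L' = uv_to_diagonal[OF sigma_root uL vL]
  have k: "\<i> * (z + \<i> - of_real m * \<sigma>) = - \<kappa>" by (simp add: \<kappa>_def)
  note L' = L'[unfolded k minus_minus]
  have xR: "v x - \<rho> * u x = (v 0 - \<rho> * u 0) * exp (\<mu> * x)" if "0 \<le> x" for x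
    by (rule primitive_eq_exp[OF R(1)]) (use that in \<open>simp_all add: is_interval_ci\<close>)
  have eR: "u x - \<rho> * v x = (u 0 - \<rho> * v 0) * exp (- \<mu> * x)" if "0 \<le> x" for x
    by (rule primitive_eq_exp[OF R(2)]) (use that in \<open>simp_all add: is_interval_ci\<close>)
  have xL: "v x - \<sigma> * u x = (v 0 - \<sigma> * u 0) * exp (- \<kappa> * x)" if "x \<le> 0" for x
    by (rule primitive_eq_exp[OF L'(1)]) (use that in \<open>simp_all add: is_interval_ic\<close>)
  have eL: "u x - \<sigma> * v x = (u 0 - \<sigma> * v 0) * exp (\<kappa> * x)" if "x \<le> 0" for x
    by (rule primitive_eq_exp[OF L'(2)]) (use that in \<open>simp_all add: is_interval_ic\<close>)
  have grow: "cmod c \<le> cmod (c * exp w)" if "0 \<le> Re w" for c w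
    using mult_left_mono[of 1 "cmod (exp w)" "cmod c"] that by (simp add: norm_mult norm_exp_eq_Re)
  \<comment> \<open>a growing component with nonzero initial value is not square-integrable\<close>
  have "cmod (v 0 - \<rho> * u 0) \<le> 0"
  proof (rule L2_fun_not_bounded_below)
    show "L2_fun (\<lambda>x. v x - \<rho> * u x)"
      using L2_fun_linear(1)[OF L(2,1), of 1 "- \<rho>"] by simp
    show "cmod (v 0 - \<rho> * u 0) \<le> cmod (v x - \<rho> * u x)" if "0 \<le> x" for x
      unfolding xR[OF that] by (rule grow) (use Re_pos(1) that in simp)
  qed
  then have a: "v 0 = \<rho> * u 0" by simp
  have "cmod (v 0 - \<sigma> * u 0) \<le> 0"
  proof (rule L2_fun_not_bounded_below)
    show "L2_fun (\<lambda>x. v (- x) - \<sigma> * u (- x))"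
      using L2_fun_reflect(1)[OF L2_fun_linear(1)[OF L(2,1), of 1 "- \<sigma>"]] by simp
    show "cmod (v 0 - \<sigma> * u 0) \<le> cmod (v (- x) - \<sigma> * u (- x))" if "0 \<le> x" for x
      by (subst xL) (use Re_pos(2) that in \<open>auto intro!: grow\<close>)
  qed
  then have b: "v 0 = \<sigma> * u 0" by simp
  have "u 0 = 0" using a b rho_neq_sigma by (metis mult_cancel_right)
  then have "v 0 = 0" using a by simp
  have solve: "p = 0 \<and> q = 0" if "q - r * p = 0" "p - r * q = 0" "1 - r\<^sup>2 \<noteq> 0" for p q r :: complex
  proof -
    have "(1 - r\<^sup>2) * p = (p - r * q) + r * (q - r * p)" by (simp add: power2_eq_square algebra_simps)
    then have "p = 0" using that by simp
    with that show ?thesis by simp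
  qed
  have "u x = 0 \<and> v x = 0"
  proof (cases "0 \<le> x")
    case True
    then show ?thesis
      using xR[of x] eR[of x] \<open>u 0 = 0\<close> \<open>v 0 = 0\<close> one_minus_sq_nonzero by (intro solve[of _ \<rho>]) auto
  next
    case False
    then show ?thesis
      using xL[of x] eL[of x] \<open>u 0 = 0\<close> \<open>v 0 = 0\<close> one_minus_sq_nonzero by (intro solve[of _ \<sigma>]) auto
  qed
  then show "u x = 0" "v x = 0" by auto
qed

end

section \<open>Solving the inhomogeneous system\<close>

context dirac_gap
begin

text \<open>The functional through which \<open>G\<close> excites the resonant function \<open>\<Phi>\<close>.\<close>

definition \<Lambda> :: "(real \<Rightarrow> complex) \<Rightarrow> (real \<Rightarrow> complex) \<Rightarrow> complex" where
  "\<Lambda> Gu Gv = (LBINT x. \<Phi>\<^sub>u x * Gv x) + (LBINT x. \<Phi>\<^sub>v x * Gu x)"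

lemma cmod_Lambda_le:
  assumes "L2_fun Gu" "L2_fun Gv"
  shows "(cmod (\<Lambda> Gu Gv))\<^sup>2 \<le> \<Phi>_sq * (L2_sq Gu + L2_sq Gv)"
proof -
  define p q r s where "p = sqrt (L2_sq \<Phi>\<^sub>u)" "q = sqrt (L2_sq Gv)" "r = sqrt (L2_sq \<Phi>\<^sub>v)" "s = sqrt (L2_sq Gu)"
  have a: "cmod (LBINT x. \<Phi>\<^sub>u x * Gv x) \<le> p * q"
    using L2_fun_product(2)[OF L2_fun_Phi(1) assms(2)]
    by (auto simp: p_q_r_s_def real_sqrt_mult[symmetric] intro: real_le_rsqrt)
  have b: "cmod (LBINT x. \<Phi>\<^sub>v x * Gu x) \<le> r * s"
    using L2_fun_product(2)[OF L2_fun_Phi(2) assms(1)]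
    by (auto simp: p_q_r_s_def real_sqrt_mult[symmetric] intro: real_le_rsqrt)
  have "cmod (\<Lambda> Gu Gv) \<le> p * q + r * s"
    unfolding \<Lambda>_def using norm_triangle_ineq a b by (meson add_mono order_trans)
  then have "(cmod (\<Lambda> Gu Gv))\<^sup>2 \<le> (p * q + r * s)\<^sup>2"
    by (rule power_mono) simp
  also have "\<dots> = (p\<^sup>2 + r\<^sup>2) * (s\<^sup>2 + q\<^sup>2) - (p * s - r * q)\<^sup>2"
    by (simp add: power2_eq_square algebra_simps)
  also have "\<dots> \<le> (p\<^sup>2 + r\<^sup>2) * (s\<^sup>2 + q\<^sup>2)" by simp
  also have "\<dots> = \<Phi>_sq * (L2_sq Gu + L2_sq Gv)"
    by (simp add: p_q_r_s_def \<Phi>_sq_def L2_sq_nonneg)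
  finally show ?thesis .
qed

lemma L2_sq_source_le:
  assumes "L2_fun f" "L2_fun g" "cmod c \<le> 1" "cmod a = 1"
  shows "L2_fun (\<lambda>x. a * (f x + c * g x))" "L2_sq (\<lambda>x. a * (f x + c * g x)) \<le> 2 * (L2_sq f + L2_sq g)"
proof -
  note l = L2_fun_linear[OF assms(1,2), of 1 c]
  show "L2_fun (\<lambda>x. a * (f x + c * g x))"
    using L2_fun_cmult(1)[OF l(1), of a] by simp
  have "(cmod c)\<^sup>2 \<le> 1" using assms(3) by (simp add: power_le_one)
  then have "(cmod c)\<^sup>2 * L2_sq g \<le> L2_sq g" by (simp add: L2_sq_nonneg mult_left_le_one_le)
  then show "L2_sq (\<lambda>x. a * (f x + c * g x)) \<le> 2 * (L2_sq f + L2_sq g)"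
    using L2_fun_cmult(2)[OF l(1), of a] l(2) assms(4) by simp
qed

text \<open>At the origin the growing components \<open>\<xi>\<close> are integrals of the source against the decaying exponentials of the respective
half-lines, and these are the two branches of \<open>\<Phi>\<close>.\<close>

lemma trace_difference:
  assumes G: "L2_fun Gu" "L2_fun Gv"
  shows "bwd \<mu> (\<lambda>x. - (\<i> * (Gv x + \<rho> * Gu x))) 0 - fwd \<kappa> (\<lambda>x. \<i> * (Gv x + \<sigma> * Gu x)) 0 = - \<i> * \<Lambda> Gu Gv"
proof -
  have [measurable]: "Gu \<in> borel_measurable borel" "Gv \<in> borel_measurable borel"
    "\<Phi>\<^sub>u \<in> borel_measurable borel" "\<Phi>\<^sub>v \<in> borel_measurable borel"
    using G L2_fun_Phi by (auto simp: L2_fun_def)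
  define hp hm where "hp x = \<i> * (Gv x + \<rho> * Gu x)" and "hm x = \<i> * (Gv x + \<sigma> * Gu x)" for x
  have L: "L2_fun hp" "L2_fun hm"
    unfolding hp_def[abs_def] hm_def[abs_def]
    using G rho_less sigma_less by (auto intro!: L2_sq_source_le)
  note ip = L2_fun_product(1)[OF L2_fun_decay_right(1) L(1)] and im = L2_fun_product(1)[OF L2_fun_decay_left(1) L(2)]
  have "bwd \<mu> (\<lambda>x. - hp x) 0 = (LBINT t. decay \<mu> 0 t * - hp (- t))"
    by (simp add: bwd_def fwd_def)
  also have "\<dots> = (LBINT t. decay \<mu> 0 (- t) * - hp t)"
    by (subst lborel_integral_real_affine[where c = "-1" and t = 0]) simp_all
  also have "\<dots> = - (LBINT t. decay \<mu> t 0 * hp t)"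
  proof -
    have "decay \<mu> 0 (- t) = decay \<mu> t 0" for t by (simp add: decay_def)
    then show ?thesis by simp
  qed
  finally have b: "bwd \<mu> (\<lambda>x. - hp x) 0 = - (LBINT t. decay \<mu> t 0 * hp t)" .
  have "bwd \<mu> (\<lambda>x. - hp x) 0 - fwd \<kappa> hm 0 = - (LBINT t. decay \<mu> t 0 * hp t + decay \<kappa> 0 t * hm t)"
    using ip im by (simp add: b fwd_def)
  also have "(LBINT t. decay \<mu> t 0 * hp t + decay \<kappa> 0 t * hm t) =
      (LBINT t. \<i> * (\<Phi>\<^sub>u t * Gv t + \<Phi>\<^sub>v t * Gu t))"
  proof (rule integral_cong_AE)
    have "AE t in lborel. t \<noteq> (0::real)" by (rule AE_lborel_singleton)
    then show "AE t in lborel. decay \<mu> t 0 * hp t + decay \<kappa> 0 t * hm t = \<i> * (\<Phi>\<^sub>u t * Gv t + \<Phi>\<^sub>v t * Gu t)"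
      by eventually_elim (auto simp: decay_def \<Phi>\<^sub>u_def \<Phi>\<^sub>v_def hp_def hm_def algebra_simps)
  qed (use ip im in \<open>auto dest: borel_measurable_integrable\<close>)
  also have "\<dots> = \<i> * \<Lambda> Gu Gv"
    using L2_fun_product(1)[OF L2_fun_Phi(1) G(2)] L2_fun_product(1)[OF L2_fun_Phi(2) G(1)]
    by (simp add: \<Lambda>_def)
  finally show ?thesis by (simp add: hp_def hm_def)
qed

text \<open>The remainder \<open>(Eu, Ev)\<close> collects all parts of the solution that stay bounded when \<open>\<rho> - \<sigma>\<close> becomes small. The number
\<open>\<delta>\<close> bounds the determinants of the changes of variables from below; it is \<open>3 / 4\<close> in the asymptotic regime, while
for a fixed \<open>z\<close> any positive bound yields the boundedness of the resolvent.\<close>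

lemma inhomogeneous_solution:
  assumes G: "L2_fun Gu" "L2_fun Gv"
    and \<delta>: "0 < \<delta>" "\<delta> \<le> cmod (1 - \<rho>\<^sup>2)" "\<delta> \<le> cmod (1 - \<sigma>\<^sup>2)"
  obtains u v c Eu Ev where "L2_fun u" "L2_fun v" "L2_fun Eu" "L2_fun Ev"
    "primitive_on UNIV u (\<lambda>x. \<i> * m * v x - \<i> * (z - \<i> * of_real (sgn x)) * u x - \<i> * Gu x)"
    "primitive_on UNIV v (\<lambda>x. - \<i> * m * u x + \<i> * (z - \<i> * of_real (sgn x)) * v x + \<i> * Gv x)"
    "\<And>x. u x = c * \<Phi>\<^sub>u x + Eu x" "\<And>x. v x = c * \<Phi>\<^sub>v x + Ev x"
    "c * (\<rho> - \<sigma>) = \<i> * \<Lambda> Gu Gv"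
    "L2_sq Eu + L2_sq Ev \<le> 68 * (L2_sq Gu + L2_sq Gv) / ((1 - \<bar>Im z\<bar>)\<^sup>2 * \<delta>\<^sup>2)"
proof -
  define S where "S = L2_sq Gu + L2_sq Gv"
  have S: "0 \<le> S" by (simp add: S_def L2_sq_nonneg)
  define g where "g = 1 - \<bar>Im z\<bar>"
  have g: "0 < g" "g \<le> Re \<mu>" "g \<le> Re \<kappa>" using gap_le by (simp_all add: g_def)
  have le1: "cmod \<rho> \<le> 1" "cmod \<sigma> \<le> 1" "cmod (\<rho>\<^sup>2) \<le> 1" "cmod (\<sigma>\<^sup>2) \<le> 1"
    using rho_less sigma_less cmod_sq_less by (simp_all add: norm_power)
  \<comment> \<open>right-hand sides of the uncoupled equations, where the decaying components get no source across the origin\<close>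
  define hp hm kp km where "hp x = - (\<i> * (Gv x + \<rho> * Gu x))" and "hm x = \<i> * (Gv x + \<sigma> * Gu x)"
    and "kp x = (if x \<in> {0<..} then - \<i> * (Gu x + \<rho> * Gv x) else 0)"
    and "km x = (if x \<in> {..<0} then \<i> * (Gu x + \<sigma> * Gv x) else 0)" for x
  have src: "L2_fun (\<lambda>x. a * (f x + c * h x)) \<and> L2_sq (\<lambda>x. a * (f x + c * h x)) \<le> 2 * S"
    if "cmod c \<le> 1" "cmod a = 1" "f = Gu \<and> h = Gv \<or> f = Gv \<and> h = Gu" for a c f h
    using that L2_sq_source_le[OF G, of c a] L2_sq_source_le[OF G(2,1), of c a] by (auto simp: S_def)
  have hp: "L2_fun hp" "L2_sq hp \<le> 2 * S"
    using src[of \<rho> "- \<i>" Gv Gu] le1 by (auto simp: hp_def[abs_def])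
  have hm: "L2_fun hm" "L2_sq hm \<le> 2 * S"
    using src[of \<sigma> \<i> Gv Gu] le1 by (auto simp: hm_def[abs_def])
  have kp: "L2_fun kp" "L2_sq kp \<le> 2 * S"
    using src[of \<rho> "- \<i>" Gu Gv] le1 L2_fun_if[OF _ L2_fun_zero(1), of "\<lambda>x. - \<i> * (Gu x + \<rho> * Gv x)" "{0<..}"]
    by (auto simp: kp_def[abs_def] L2_fun_zero)
  have km: "L2_fun km" "L2_sq km \<le> 2 * S"
    using src[of \<sigma> \<i> Gu Gv] le1 L2_fun_if[OF _ L2_fun_zero(1), of "\<lambda>x. \<i> * (Gu x + \<sigma> * Gv x)" "{..<0}"]
    by (auto simp: km_def[abs_def] L2_fun_zero)
  define \<xi>p \<xi>m \<alpha>p \<alpha>m where "\<xi>p = bwd \<mu> hp" "\<xi>m = fwd \<kappa> hm" "\<alpha>p = fwd \<mu> kp" "\<alpha>m = bwd \<kappa> km"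
  note defs = \<xi>p_\<xi>m_\<alpha>p_\<alpha>m_def
  have scale: "X \<le> 2 * S / g\<^sup>2" if "X \<le> Y / t\<^sup>2" "Y \<le> 2 * S" "g \<le> t" for X Y t
  proof -
    have "X \<le> 2 * S / t\<^sup>2" using that(1,2) by (smt (verit) divide_right_mono zero_le_power2)
    also have "\<dots> \<le> 2 * S / g\<^sup>2"
      using that(3) g S by (intro divide_left_mono power_mono) auto
    finally show ?thesis .
  qed
  have L: "L2_fun \<xi>p" "L2_fun \<xi>m" "L2_fun \<alpha>p" "L2_fun \<alpha>m"
    unfolding defs by (intro L2_fun_bwd L2_fun_fwd Re_pos hp hm kp km)+
  have B: "L2_sq \<xi>p \<le> 2 * S / g\<^sup>2" "L2_sq \<xi>m \<le> 2 * S / g\<^sup>2" "L2_sq \<alpha>p \<le> 2 * S / g\<^sup>2" "L2_sq \<alpha>m \<le> 2 * S / g\<^sup>2"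
    unfolding defs
    by (rule scale[OF L2_fun_bwd(2)[OF Re_pos(1) hp(1)] hp(2) g(2)] scale[OF L2_fun_fwd(2)[OF Re_pos(2) hm(1)] hm(2) g(3)]
        scale[OF L2_fun_fwd(2)[OF Re_pos(1) kp(1)] kp(2) g(2)] scale[OF L2_fun_bwd(2)[OF Re_pos(2) km(1)] km(2) g(3)])+
  have scale': "X \<le> S / g" if "X \<le> Y / (2 * t)" "Y \<le> 2 * S" "g \<le> t" for X Y t
  proof -
    have "X \<le> 2 * S / (2 * t)" using that g by (smt (verit) divide_right_mono)
    also have "\<dots> \<le> S / g"
      using that(3) g S by (simp add: divide_left_mono)
    finally show ?thesis .
  qed
  have T: "(cmod (\<xi>p 0))\<^sup>2 \<le> S / g" "(cmod (\<xi>m 0))\<^sup>2 \<le> S / g"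
    unfolding defs
    by (rule scale'[OF bwd_pointwise_bound[OF Re_pos(1) hp(1)] hp(2) g(2)] scale'[OF fwd_pointwise_bound[OF Re_pos(2) hm(1)] hm(2) g(3)])+
  have "\<alpha>p 0 = 0"
  proof -
    have "decay \<mu> 0 t * kp t = 0" for t by (simp add: decay_def kp_def)
    then have "(\<lambda>t. decay \<mu> 0 t * kp t) = (\<lambda>t. 0)" by (rule ext)
    then show ?thesis by (simp only: defs fwd_def) simp
  qed
  have "\<alpha>m 0 = 0"
  proof -
    have "decay \<kappa> 0 t * km (- t) = 0" for t by (simp add: decay_def km_def)
    then have "(\<lambda>t. decay \<kappa> 0 t * km (- t)) = (\<lambda>t. 0)" by (rule ext)
    then show ?thesis by (simp only: defs fwd_def bwd_def) simp
  qed
  \<comment> \<open>\<open>c\<close> and \<open>d\<close> are the common values of \<open>u\<close> and \<open>v\<close> at the origin, determined by the two growing components\<close>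
  define c where "c = (\<xi>p 0 - \<xi>m 0) / (\<sigma> - \<rho>)"
  have c: "c * (\<sigma> - \<rho>) = \<xi>p 0 - \<xi>m 0" using rho_neq_sigma by (simp add: c_def)
  define d where "d = \<xi>p 0 + \<rho> * c"
  have d: "d = \<xi>m 0 + \<sigma> * c" using c by (simp add: d_def algebra_simps)
  define \<eta>p \<eta>m where "\<eta>p x = \<alpha>p x + (c - \<rho> * d) * exp (- \<mu> * of_real x)"
    and "\<eta>m x = \<alpha>m x + (c - \<sigma> * d) * exp (\<kappa> * of_real x)" for x
  define up vp um vm where "up x = (\<eta>p x + \<rho> * \<xi>p x) / (1 - \<rho>\<^sup>2)" and "vp x = (\<xi>p x + \<rho> * \<eta>p x) / (1 - \<rho>\<^sup>2)"
    and "um x = (\<eta>m x + \<sigma> * \<xi>m x) / (1 - \<sigma>\<^sup>2)" and "vm x = (\<xi>m x + \<sigma> * \<eta>m x) / (1 - \<sigma>\<^sup>2)" for x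
  have at0: "up 0 = c" "vp 0 = d" "um 0 = c" "vm 0 = d"
  proof -
    have *: "((c - r * d) + r * (d - r * c)) / (1 - r\<^sup>2) = c \<and> ((d - r * c) + r * (c - r * d)) / (1 - r\<^sup>2) = d"
      if "1 - r\<^sup>2 \<noteq> 0" for r
      using that by (simp add: divide_eq_eq) (simp add: power2_eq_square algebra_simps)
    have "\<xi>p 0 = d - \<rho> * c" by (simp add: d_def)
    moreover have "\<xi>m 0 = d - \<sigma> * c" by (simp add: d)
    ultimately show "up 0 = c" "vp 0 = d" "um 0 = c" "vm 0 = d"
      using *[OF one_minus_sq_nonzero(1)] *[OF one_minus_sq_nonzero(2)] \<open>\<alpha>p 0 = 0\<close> \<open>\<alpha>m 0 = 0\<close>
      by (simp_all add: up_def vp_def um_def vm_def \<eta>p_def \<eta>m_def)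
  qed
  have [measurable]: "Gu \<in> borel_measurable borel" "Gv \<in> borel_measurable borel"
    using G by (auto simp: L2_fun_def)
  have ae: "AE x in lborel. x \<noteq> (0::real)" by (rule AE_lborel_singleton)
  have Lm[measurable]: "\<xi>p \<in> borel_measurable borel" "\<xi>m \<in> borel_measurable borel"
    "\<alpha>p \<in> borel_measurable borel" "\<alpha>m \<in> borel_measurable borel" "kp \<in> borel_measurable borel" "km \<in> borel_measurable borel"
    using L kp km by (auto simp: L2_fun_def)
  have [measurable]: "\<eta>p \<in> borel_measurable borel" "\<eta>m \<in> borel_measurable borel"
    unfolding \<eta>p_def[abs_def] \<eta>m_def[abs_def] by measurable
  have x1: "primitive_on {0..} \<xi>p (\<lambda>x. \<mu> * \<xi>p x + \<i> * (Gv x + \<rho> * Gu x))"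
    using primitive_on_subset[OF primitive_bwd[OF Re_pos(1) hp(1)], of "{0..}"]
    by (simp add: defs hp_def)
  have x2: "primitive_on {..0} \<xi>m (\<lambda>x. - \<kappa> * \<xi>m x + \<i> * (Gv x + \<sigma> * Gu x))"
    using primitive_on_subset[OF primitive_fwd[OF Re_pos(2) hm(1)], of "{..0}"]
    by (simp add: defs hm_def)
  have y1: "primitive_on {0..} \<eta>p (\<lambda>x. - \<mu> * \<eta>p x - \<i> * (Gu x + \<rho> * Gv x))"
  proof -
    have "primitive_on {0..} \<eta>p (\<lambda>x. - \<mu> * \<eta>p x + kp x)"
      using primitive_on_linear[OF primitive_on_subset[OF primitive_fwd[OF Re_pos(1) kp(1)], of "{0..}"]
          primitive_exp[of "{0..}" "c - \<rho> * d" "- \<mu>"], of 1 1]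
      by (simp add: \<eta>p_def[abs_def] defs algebra_simps)
    then show ?thesis
      by (rule primitive_on_cong_AE)
        (auto intro!: eventually_mono[OF ae] simp: is_interval_ci kp_def)
  qed
  have y2: "primitive_on {..0} \<eta>m (\<lambda>x. \<kappa> * \<eta>m x - \<i> * (Gu x + \<sigma> * Gv x))"
  proof -
    have "primitive_on {..0} \<eta>m (\<lambda>x. \<kappa> * \<eta>m x - km x)"
      using primitive_on_linear[OF primitive_on_subset[OF primitive_bwd[OF Re_pos(2) km(1)], of "{..0}"]
          primitive_exp[of "{..0}" "c - \<sigma> * d" "\<kappa>"], of 1 1]
      by (simp add: \<eta>m_def[abs_def] defs algebra_simps)
    then show ?thesis
      by (rule primitive_on_cong_AE)
        (auto intro!: eventually_mono[OF ae] simp: is_interval_ic km_def)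
  qed
  note right = diagonal_to_uv[OF rho_root one_minus_sq_nonzero(1) x1[unfolded \<mu>_def] y1[unfolded \<mu>_def],
      folded up_def vp_def]
  have k: "\<i> * ((z + \<i>) - of_real m * \<sigma>) = - \<kappa>" by (simp add: \<kappa>_def)
  note left = diagonal_to_uv[OF sigma_root one_minus_sq_nonzero(2), unfolded k minus_minus, OF x2 y2,
      folded um_def vm_def]
  define u v where "u x = (if x \<in> {0..} then up x else um x)" and "v x = (if x \<in> {0..} then vp x else vm x)" for x
  have uv: "u x = up x" "v x = vp x" if "x \<in> {0..}" for x using that by (simp_all add: u_def v_def)
  have uv': "u x = um x" "v x = vm x" if "x \<in> {..0}" for x
    using that at0 by (cases "x = 0"; simp add: u_def v_def)+
  \<comment> \<open>as \<open>c - \<rho> d = (1 - \<rho>\<^sup>2) c - \<rho> (\<xi>p 0)\<close>, the coefficient of the decaying exponential is resonant only through \<open>c\<close>\<close>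
  define Eu Ev where "Eu x = (if x \<in> {0..} then (1 * \<alpha>p x + \<rho> * \<xi>p x - (\<rho> * \<xi>p 0) * decay \<mu> x 0) / (1 - \<rho>\<^sup>2)
      else (1 * \<alpha>m x + \<sigma> * \<xi>m x - (\<sigma> * \<xi>m 0) * decay \<kappa> 0 x) / (1 - \<sigma>\<^sup>2))"
    and "Ev x = (if x \<in> {0..} then (1 * \<xi>p x + \<rho> * \<alpha>p x - (\<rho>\<^sup>2 * \<xi>p 0) * decay \<mu> x 0) / (1 - \<rho>\<^sup>2)
      else (1 * \<xi>m x + \<sigma> * \<alpha>m x - (\<sigma>\<^sup>2 * \<xi>m 0) * decay \<kappa> 0 x) / (1 - \<sigma>\<^sup>2))" for x
  have split: "(\<alpha> + (c - r * d) * e + r * \<xi>) / (1 - r\<^sup>2) = c * e + (1 * \<alpha> + r * \<xi> - (r * \<xi>0) * e) / (1 - r\<^sup>2)"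
    "(\<xi> + r * (\<alpha> + (c - r * d) * e)) / (1 - r\<^sup>2) = c * (r * e) + (1 * \<xi> + r * \<alpha> - (r\<^sup>2 * \<xi>0) * e) / (1 - r\<^sup>2)"
    if "1 - r\<^sup>2 \<noteq> 0" "d = \<xi>0 + r * c" for \<alpha> \<xi> e r \<xi>0
    using that(1) by (simp_all add: that(2) divide_eq_eq add_divide_eq_iff) (simp_all add: power2_eq_square algebra_simps)
  have u_split: "u x = c * \<Phi>\<^sub>u x + Eu x" and v_split: "v x = c * \<Phi>\<^sub>v x + Ev x" for x
  proof -
    have "u x = c * \<Phi>\<^sub>u x + Eu x \<and> v x = c * \<Phi>\<^sub>v x + Ev x"
    proof (cases "x \<in> {0..}")
      case True
      then have "decay \<mu> x 0 = exp (- \<mu> * of_real x)" by (simp add: decay_def)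
      then show ?thesis
        using True split[OF one_minus_sq_nonzero(1) d_def]
        by (simp only: u_def v_def up_def vp_def \<eta>p_def \<Phi>\<^sub>u_def \<Phi>\<^sub>v_def Eu_def Ev_def if_True)
    next
      case False
      then have "decay \<kappa> 0 x = exp (\<kappa> * of_real x)" by (simp add: decay_def)
      then show ?thesis
        using False split[OF one_minus_sq_nonzero(2) d]
        by (simp only: u_def v_def um_def vm_def \<eta>m_def \<Phi>\<^sub>u_def \<Phi>\<^sub>v_def Eu_def Ev_def if_False)
    qed
    then show "u x = c * \<Phi>\<^sub>u x + Eu x" "v x = c * \<Phi>\<^sub>v x + Ev x" by auto
  qed
  have one: "cmod 1 \<le> 1" by simp
  note t1 = L2_fun_three_terms[OF L(3,1) L2_fun_decay_right(1) one le1(1), of "\<rho> * \<xi>p 0" "1 - \<rho>\<^sup>2"]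
  note t2 = L2_fun_three_terms[OF L(4,2) L2_fun_decay_left(1) one le1(2), of "\<sigma> * \<xi>m 0" "1 - \<sigma>\<^sup>2"]
  note t3 = L2_fun_three_terms[OF L(1,3) L2_fun_decay_right(1) one le1(1), of "\<rho>\<^sup>2 * \<xi>p 0" "1 - \<rho>\<^sup>2"]
  note t4 = L2_fun_three_terms[OF L(2,4) L2_fun_decay_left(1) one le1(2), of "\<sigma>\<^sup>2 * \<xi>m 0" "1 - \<sigma>\<^sup>2"]
  have meas: "{0::real..} \<in> sets borel" by simp
  note eu = L2_fun_if[OF t1(1) t2(1) meas]
  note ev = L2_fun_if[OF t3(1) t4(1) meas]
  have LE: "L2_fun Eu" "L2_fun Ev" using eu(1) ev(1) by (simp_all add: Eu_def[abs_def] Ev_def[abs_def])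
  have Luv: "L2_fun u" "L2_fun v"
    using L2_fun_linear(1)[OF L2_fun_Phi(1) LE(1), of c 1] L2_fun_linear(1)[OF L2_fun_Phi(2) LE(2), of c 1]
    by (simp_all add: u_split[abs_def] v_split[abs_def] flip: fun_eq_iff)
  have [measurable]: "u \<in> borel_measurable borel" "v \<in> borel_measurable borel"
    using Luv by (auto simp: L2_fun_def)
  have pu: "primitive_on UNIV u (\<lambda>x. \<i> * m * v x - \<i> * (z - \<i> * of_real (sgn x)) * u x - \<i> * Gu x)"
    by (subst primitive_sgn_iff[where g = "\<lambda>s x. \<i> * m * v x - \<i> * (z - \<i> * of_real s) * u x - \<i> * Gu x"];
        (intro conjI primitive_on_cong[OF right(1)] primitive_on_cong[OF left(1)])?)
      (simp_all add: uv uv' is_interval_ci is_interval_ic)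
  have pv: "primitive_on UNIV v (\<lambda>x. - \<i> * m * u x + \<i> * (z - \<i> * of_real (sgn x)) * v x + \<i> * Gv x)"
    by (subst primitive_sgn_iff[where g = "\<lambda>s x. - \<i> * m * u x + \<i> * (z - \<i> * of_real s) * v x + \<i> * Gv x"];
        (intro conjI primitive_on_cong[OF right(2)] primitive_on_cong[OF left(2)])?)
      (simp_all add: uv uv' is_interval_ci is_interval_ic)
  have bound: "L2_sq Eu + L2_sq Ev \<le> 68 * (L2_sq Gu + L2_sq Gv) / ((1 - \<bar>Im z\<bar>)\<^sup>2 * \<delta>\<^sup>2)"
  proof -
    \<comment> \<open>\<open>17 = 4 \<cdot> 2 + 4 \<cdot> 2 + 1\<close>; two components on two half-lines then give \<open>68 = 4 \<cdot> 17\<close>\<close>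
    have piece: "X \<le> 17 * S / (g\<^sup>2 * \<delta>\<^sup>2)"
      if X: "X \<le> (4 * A + 4 * A' + 2 * (cmod (r * \<xi>0))\<^sup>2 * e) / D\<^sup>2"
        and "A \<le> 2 * S / g\<^sup>2" "A' \<le> 2 * S / g\<^sup>2" "cmod r \<le> 1" "(cmod \<xi>0)\<^sup>2 \<le> S / g"
        "e = 1 / (2 * t)" "g \<le> t" "\<delta> \<le> D" for X A A' r \<xi>0 e t D
    proof -
      have "(cmod (r * \<xi>0))\<^sup>2 \<le> (cmod \<xi>0)\<^sup>2"
        using that(4) by (simp add: norm_mult power_mult_distrib mult_left_le_one_le power_le_one)
      then have "(cmod (r * \<xi>0))\<^sup>2 \<le> S / g" by (rule order_trans[OF _ that(5)])
      moreover have "e \<le> 1 / (2 * g)" "0 \<le> e" using that(6,7) g by (auto intro!: divide_left_mono)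
      ultimately have "(cmod (r * \<xi>0))\<^sup>2 * e \<le> S / g * (1 / (2 * g))"
        using S g by (intro mult_mono) auto
      then have "2 * (cmod (r * \<xi>0))\<^sup>2 * e \<le> S / g\<^sup>2"
        by (simp add: power2_eq_square field_simps)
      then have "4 * A + 4 * A' + 2 * (cmod (r * \<xi>0))\<^sup>2 * e \<le> 17 * S / g\<^sup>2"
        using that(2,3) by simp
      then have "X \<le> (17 * S / g\<^sup>2) / D\<^sup>2"
        using X by (meson divide_right_mono order_trans zero_le_power2)
      also have "\<dots> \<le> (17 * S / g\<^sup>2) / \<delta>\<^sup>2"
        using that(8) \<delta>(1) S by (intro divide_left_mono power_mono) auto
      finally show ?thesis by (simp add: field_simps)
    qed
    have "L2_sq Eu \<le> 17 * S / (g\<^sup>2 * \<delta>\<^sup>2) + 17 * S / (g\<^sup>2 * \<delta>\<^sup>2)"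
      unfolding Eu_def[abs_def]
      by (rule order_trans[OF eu(2)
          add_mono[OF piece[OF t1(2) B(3,1) le1(1) T(1) L2_fun_decay_right(2) g(2) \<delta>(2)]
            piece[OF t2(2) B(4,2) le1(2) T(2) L2_fun_decay_left(2) g(3) \<delta>(3)]]])
    moreover have "L2_sq Ev \<le> 17 * S / (g\<^sup>2 * \<delta>\<^sup>2) + 17 * S / (g\<^sup>2 * \<delta>\<^sup>2)"
      unfolding Ev_def[abs_def]
      by (rule order_trans[OF ev(2)
          add_mono[OF piece[OF t3(2) B(1,3) le1(3) T(1) L2_fun_decay_right(2) g(2) \<delta>(2)]
            piece[OF t4(2) B(2,4) le1(4) T(2) L2_fun_decay_left(2) g(3) \<delta>(3)]]])
    ultimately have "L2_sq Eu + L2_sq Ev \<le> (17 * S / (g\<^sup>2 * \<delta>\<^sup>2) + 17 * S / (g\<^sup>2 * \<delta>\<^sup>2)) +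
        (17 * S / (g\<^sup>2 * \<delta>\<^sup>2) + 17 * S / (g\<^sup>2 * \<delta>\<^sup>2))"
      by (rule add_mono)
    also have "\<dots> = 68 * S / (g\<^sup>2 * \<delta>\<^sup>2)" unfolding add_divide_distrib[symmetric] by simp
    finally have "L2_sq Eu + L2_sq Ev \<le> 68 * S / (g\<^sup>2 * \<delta>\<^sup>2)" .
    then show ?thesis unfolding S_def g_def .
  qed
  have "\<xi>p 0 - \<xi>m 0 = - \<i> * \<Lambda> Gu Gv"
    unfolding defs hp_def[abs_def] hm_def[abs_def] by (rule trace_difference[OF G])
  moreover have "c * (\<rho> - \<sigma>) = - (c * (\<sigma> - \<rho>))" by (simp add: algebra_simps)
  ultimately have "c * (\<rho> - \<sigma>) = \<i> * \<Lambda> Gu Gv" unfolding c by simp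
  from that[OF Luv LE pu pv u_split v_split this bound] show thesis .
qed

end

section \<open>The resolvent and its rank-one part\<close>

lemma L2_fun_sgn:
  assumes "L2_fun h"
  shows "L2_fun (\<lambda>x. of_real (sgn x) * h x)"
proof (rule L2_fun_bound(1))
  show "integrable lborel (\<lambda>x. (cmod (h x))\<^sup>2)" using assms by (simp add: L2_fun_def)
  have [measurable]: "h \<in> borel_measurable borel" using assms by (simp add: L2_fun_def)
  have "(\<lambda>x. of_real (sgn x) * h x) = (\<lambda>x. if x \<in> {0<..} then h x else if x \<in> {0} then 0 else - h x)"
    by (auto simp: fun_eq_iff sgn_if)
  then show "(\<lambda>x. of_real (sgn x) * h x) \<in> borel_measurable lborel"
    by (simp only:) (intro measurable_If_set; simp)
  show "(cmod (of_real (sgn x) * h x))\<^sup>2 \<le> (cmod (h x))\<^sup>2" for x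
    by (auto simp: sgn_if norm_mult)
qed

text \<open>The densities occurring in the Dirac system, and the components of the Dirac expression, have this shape.\<close>

lemma L2_fun_four_terms:
  assumes "L2_fun f" "L2_fun g" "L2_fun h" "L2_fun k"
  shows "L2_fun (\<lambda>x. a * f x + b * g x + c * h x + d * k x)"
  using L2_fun_linear(1)[OF L2_fun_linear(1)[OF assms(1,2), of a b] L2_fun_linear(1)[OF assms(3,4), of c d], of 1 1]
  by (simp add: add.assoc)

lemma L2_fun_dirac:
  assumes "L2_fun u" "L2_fun v" "L2_fun w"
  shows "L2_fun (\<lambda>x. a * v x + b * w x + c * of_real (sgn x) * u x)"
    "L2_fun (\<lambda>x. a * v x - b * w x + c * of_real (sgn x) * u x)"
  using L2_fun_four_terms[OF assms(2,3) L2_fun_sgn[OF assms(1)] L2_fun_zero(1), of a b c 0]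
    L2_fun_four_terms[OF assms(2,3) L2_fun_sgn[OF assms(1)] L2_fun_zero(1), of a "- b" c 0]
  by (simp_all add: mult.assoc)

lemma dirac_op_uv:
  assumes L: "L2_fun u" "L2_fun v" "L2_fun u'" "L2_fun v'"
    and p: "primitive_on UNIV u u'" "primitive_on UNIV v v'"
  shows "L2_uv u v \<in> H1"
    "dirac_op m (L2_uv u v) = L2_uv (\<lambda>x. of_real m * v x + \<i> * u' x + \<i> * of_real (sgn x) * u x)
       (\<lambda>x. of_real m * u x - \<i> * v' x + \<i> * of_real (sgn x) * v x)"
proof -
  note w = has_weak_deriv_uvI[OF L p]
  show "L2_uv u v \<in> H1" using w by (auto simp: H1_def)
  show "dirac_op m (L2_uv u v) = L2_uv (\<lambda>x. of_real m * v x + \<i> * u' x + \<i> * of_real (sgn x) * u x)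
       (\<lambda>x. of_real m * u x - \<i> * v' x + \<i> * of_real (sgn x) * v x)"
    unfolding dirac_op_def weak_deriv_uv[OF L w] by (rule L2_uv_dirac_expr[OF L])
qed

text \<open>Elements of the domain are represented by absolutely continuous functions.\<close>

lemma H1_cases_uv:
  assumes "f \<in> H1"
  obtains u v u' v' where "L2_fun u" "L2_fun v" "L2_fun u'" "L2_fun v'" "f = L2_uv u v"
    "primitive_on UNIV u u'" "primitive_on UNIV v v'"
proof -
  obtain g where g: "has_weak_deriv f g" using assms by (auto simp: H1_def)
  obtain p q where pq: "L2_fun p" "L2_fun q" "f = L2_uv p q" by (rule L2_cases_uv)
  obtain u' v' where uv: "L2_fun u'" "L2_fun v'" "g = L2_uv u' v'" by (rule L2_cases_uv)
  have "has_weak_deriv (L2_uv p q) (L2_uv u' v')" using g pq(3) uv(3) by simp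
  then obtain u v where "L2_fun u" "L2_fun v" "L2_uv p q = L2_uv u v" "primitive_on UNIV u u'" "primitive_on UNIV v v'"
    by (rule has_weak_deriv_uvE[OF pq(1,2) uv(1,2)])
  with that uv pq show thesis by blast
qed

lemma L2_uv_combine:
  assumes "L2_fun u" "L2_fun v" "L2_fun p" "L2_fun q"
  shows "r *\<^sub>R L2_uv u v + s *\<^sub>R L2_uv p q =
    L2_uv (\<lambda>x. of_real r * u x + of_real s * p x) (\<lambda>x. of_real r * v x + of_real s * q x)"
  using assms L2_fun_cmult(1)
  by (simp add: L2_uv_scaleR scaleR_conv_of_real L2_uv_add)

lemma dirac_op_combine:
  assumes "f \<in> H1" "g \<in> H1"
  shows "r *\<^sub>R f + s *\<^sub>R g \<in> H1"
    "dirac_op m (r *\<^sub>R f + s *\<^sub>R g) = r *\<^sub>R dirac_op m f + s *\<^sub>R dirac_op m g"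
proof -
  obtain u v u' v' where L: "L2_fun u" "L2_fun v" "L2_fun u'" "L2_fun v'" and f: "f = L2_uv u v"
    and P: "primitive_on UNIV u u'" "primitive_on UNIV v v'"
    using H1_cases_uv[OF assms(1)] by blast
  obtain p q p' q' where L': "L2_fun p" "L2_fun q" "L2_fun p'" "L2_fun q'" and g: "g = L2_uv p q"
    and P': "primitive_on UNIV p p'" "primitive_on UNIV q q'"
    using H1_cases_uv[OF assms(2)] by blast
  note D = dirac_op_uv[OF L2_fun_linear(1)[OF L(1) L'(1), of "of_real r" "of_real s"] L2_fun_linear(1)[OF L(2) L'(2), of "of_real r" "of_real s"]
      L2_fun_linear(1)[OF L(3) L'(3)] L2_fun_linear(1)[OF L(4) L'(4)]
      primitive_on_linear[OF P(1) P'(1)] primitive_on_linear[OF P(2) P'(2)]]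
  have e: "r *\<^sub>R f + s *\<^sub>R g = L2_uv (\<lambda>x. of_real r * u x + of_real s * p x) (\<lambda>x. of_real r * v x + of_real s * q x)"
    unfolding f g by (rule L2_uv_combine[OF L(1,2) L'(1,2)])
  show "r *\<^sub>R f + s *\<^sub>R g \<in> H1" unfolding e by (rule D(1))
  show "dirac_op m (r *\<^sub>R f + s *\<^sub>R g) = r *\<^sub>R dirac_op m f + s *\<^sub>R dirac_op m g"
    unfolding e D(2) unfolding f g dirac_op_uv(2)[OF L P] dirac_op_uv(2)[OF L' P']
      L2_uv_combine[OF L2_fun_dirac(1)[OF L(1,2,3)] L2_fun_dirac(2)[OF L(2,1,4)]
        L2_fun_dirac(1)[OF L'(1,2,3)] L2_fun_dirac(2)[OF L'(2,1,4)]]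
    by (intro arg_cong2[of _ _ _ _ L2_uv] ext) (simp_all add: algebra_simps)
qed

lemma scaleC_combine: "scaleC_L2 z (r *\<^sub>R f + s *\<^sub>R g) = r *\<^sub>R scaleC_L2 z f + s *\<^sub>R scaleC_L2 z g"
proof -
  obtain u v where L: "L2_fun u" "L2_fun v" and f: "f = L2_uv u v" by (rule L2_cases_uv)
  obtain p q where L': "L2_fun p" "L2_fun q" and g: "g = L2_uv p q" by (rule L2_cases_uv)
  show ?thesis
    unfolding f g using L L'
    by (simp add: L2_uv_combine L2_uv_scaleC L2_fun_linear L2_fun_cmult algebra_simps)
qed

lemma norm_scaleC: "norm (scaleC_L2 c f) = cmod c * norm f"
proof -
  obtain u v where L: "L2_fun u" "L2_fun v" and f: "f = L2_uv u v" by (rule L2_cases_uv)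
  have "(norm (scaleC_L2 c f))\<^sup>2 = (cmod c * norm f)\<^sup>2"
    using L by (simp add: f L2_uv_scaleC norm_L2_uv L2_fun_cmult power_mult_distrib algebra_simps)
  then show ?thesis by (simp add: power2_eq_iff_nonneg)
qed

context dirac_gap
begin

definition \<Phi> :: L2 where "\<Phi> = L2_uv \<Phi>\<^sub>u \<Phi>\<^sub>v"

lemma norm_Phi: "norm \<Phi> = sqrt (\<Phi>_sq / 2)"
  using norm_L2_uv[OF L2_fun_Phi] by (simp add: \<Phi>_def \<Phi>_sq_def real_sqrt_unique)

abbreviation op_minus_z :: "L2 \<Rightarrow> L2" where "op_minus_z f \<equiv> dirac_op m f - scaleC_L2 z f"

lemma determinant_bound:
  obtains \<delta> where "0 < \<delta>" "\<delta> \<le> cmod (1 - \<rho>\<^sup>2)" "\<delta> \<le> cmod (1 - \<sigma>\<^sup>2)"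
  using that[of "min (cmod (1 - \<rho>\<^sup>2)) (cmod (1 - \<sigma>\<^sup>2))"] one_minus_sq_nonzero by simp

lemma op_minus_z_solution:
  assumes G: "L2_fun Gu" "L2_fun Gv"
    and d: "0 < d" "d \<le> cmod (1 - \<rho>\<^sup>2)" "d \<le> cmod (1 - \<sigma>\<^sup>2)"
  obtains f c E where "f \<in> H1" "op_minus_z f = L2_uv Gu Gv" "f = scaleC_L2 c \<Phi> + E" "c * (\<rho> - \<sigma>) = \<i> * \<Lambda> Gu Gv"
    "norm E \<le> 9 / ((1 - \<bar>Im z\<bar>) * d) * norm (L2_uv Gu Gv)"
proof -
  obtain u v c Eu Ev where L: "L2_fun u" "L2_fun v" "L2_fun Eu" "L2_fun Ev"
    and p: "primitive_on UNIV u (\<lambda>x. \<i> * m * v x - \<i> * (z - \<i> * of_real (sgn x)) * u x - \<i> * Gu x)"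
      "primitive_on UNIV v (\<lambda>x. - \<i> * m * u x + \<i> * (z - \<i> * of_real (sgn x)) * v x + \<i> * Gv x)"
    and s: "\<And>x. u x = c * \<Phi>\<^sub>u x + Eu x" "\<And>x. v x = c * \<Phi>\<^sub>v x + Ev x"
    and c: "c * (\<rho> - \<sigma>) = \<i> * \<Lambda> Gu Gv"
    and E: "L2_sq Eu + L2_sq Ev \<le> 68 * (L2_sq Gu + L2_sq Gv) / ((1 - \<bar>Im z\<bar>)\<^sup>2 * d\<^sup>2)"
    by (rule inhomogeneous_solution[OF G d]) (rule that; assumption)
  have Lu': "L2_fun (\<lambda>x. \<i> * m * v x - \<i> * (z - \<i> * of_real (sgn x)) * u x - \<i> * Gu x)"
    using L2_fun_four_terms[OF L(2,1) L2_fun_sgn[OF L(1)] G(1), of "\<i> * m" "- (\<i> * z)" "-1" "- \<i>"]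
    by (simp add: algebra_simps)
  have Lv': "L2_fun (\<lambda>x. - \<i> * m * u x + \<i> * (z - \<i> * of_real (sgn x)) * v x + \<i> * Gv x)"
    using L2_fun_four_terms[OF L(1,2) L2_fun_sgn[OF L(2)] G(2), of "- (\<i> * m)" "\<i> * z" 1 "\<i>"]
    by (simp add: algebra_simps)
  note D = dirac_op_uv[OF L(1,2) Lu' Lv' p]
  have "op_minus_z (L2_uv u v) = L2_uv Gu Gv"
    unfolding D(2) L2_uv_scaleC[OF L(1,2)]
      L2_uv_minus[OF L2_fun_dirac(1)[OF L(1,2) Lu'] L2_fun_dirac(2)[OF L(2,1) Lv']
        L2_fun_cmult(1)[OF L(1)] L2_fun_cmult(1)[OF L(2)]]
    by (intro arg_cong2[of _ _ _ _ L2_uv] ext) (simp_all add: algebra_simps)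
  moreover have "L2_uv u v = scaleC_L2 c \<Phi> + L2_uv Eu Ev"
    using L L2_fun_Phi by (simp add: \<Phi>_def L2_uv_scaleC L2_uv_add L2_fun_cmult s[abs_def])
  moreover have "norm (L2_uv Eu Ev) \<le> 9 / ((1 - \<bar>Im z\<bar>) * d) * norm (L2_uv Gu Gv)"
  proof (rule power2_le_imp_le)
    have g: "0 < 1 - \<bar>Im z\<bar>" using Im_z by simp
    have "(norm (L2_uv Eu Ev))\<^sup>2 \<le> 68 / ((1 - \<bar>Im z\<bar>)\<^sup>2 * d\<^sup>2) * (norm (L2_uv Gu Gv))\<^sup>2"
    proof -
      have "(L2_sq Eu + L2_sq Ev) / 2 \<le> 68 * (L2_sq Gu + L2_sq Gv) / ((1 - \<bar>Im z\<bar>)\<^sup>2 * d\<^sup>2) / 2"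
        by (rule divide_right_mono[OF E]) simp
      then show ?thesis unfolding norm_L2_uv[OF L(3,4)] norm_L2_uv[OF G] by simp
    qed
    \<comment> \<open>rounding \<open>68\<close> up to a square\<close>
    also have "\<dots> \<le> 81 / ((1 - \<bar>Im z\<bar>)\<^sup>2 * d\<^sup>2) * (norm (L2_uv Gu Gv))\<^sup>2"
      using g d(1) by (intro mult_right_mono divide_right_mono) auto
    also have "\<dots> = (9 / ((1 - \<bar>Im z\<bar>) * d) * norm (L2_uv Gu Gv))\<^sup>2"
      by (simp add: power_mult_distrib power_divide)
    finally show "(norm (L2_uv Eu Ev))\<^sup>2 \<le> (9 / ((1 - \<bar>Im z\<bar>) * d) * norm (L2_uv Gu Gv))\<^sup>2" .
    show "0 \<le> 9 / ((1 - \<bar>Im z\<bar>) * d) * norm (L2_uv Gu Gv)" using g d(1) by simp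
  qed
  ultimately show thesis using that D(1) c by blast
qed

text \<open>The difference of two solutions solves the homogeneous system almost everywhere and is therefore zero.\<close>

lemma op_minus_z_inj: "inj_on op_minus_z H1"
proof (rule inj_onI)
  fix f g assume fg: "f \<in> H1" "g \<in> H1" "op_minus_z f = op_minus_z g"
  obtain u v u' v' where L: "L2_fun u" "L2_fun v" "L2_fun u'" "L2_fun v'" and f: "f = L2_uv u v"
    and P: "primitive_on UNIV u u'" "primitive_on UNIV v v'"
    using H1_cases_uv[OF fg(1)] by blast
  obtain p q p' q' where L': "L2_fun p" "L2_fun q" "L2_fun p'" "L2_fun q'" and g: "g = L2_uv p q"
    and P': "primitive_on UNIV p p'" "primitive_on UNIV q q'"
    using H1_cases_uv[OF fg(2)] by blast
  have sub: "L2_fun (\<lambda>x. a x - b x)" if "L2_fun a" "L2_fun b" for a b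
    using L2_fun_linear(1)[OF that, of 1 "-1"] by simp
  let ?A = "\<lambda>a b a' x. of_real m * b x + \<i> * a' x + \<i> * of_real (sgn x) * a x - z * a x"
  let ?B = "\<lambda>a b b' x. of_real m * a x - \<i> * b' x + \<i> * of_real (sgn x) * b x - z * b x"
  have LL: "L2_fun (?A a b a')" "L2_fun (?B a b b')"
    if "L2_fun a" "L2_fun b" "L2_fun a'" "L2_fun b'" for a b a' b'
    using that by (auto intro!: sub L2_fun_dirac L2_fun_cmult)
  have ae: "AE x in lborel. ?A u v u' x = ?A p q p' x \<and> ?B u v v' x = ?B p q q' x"
  proof -
    have "op_minus_z f = L2_uv (?A u v u') (?B u v v')"
      unfolding f dirac_op_uv(2)[OF L P] L2_uv_scaleC[OF L(1,2)]
      by (rule L2_uv_minus) (auto intro!: L2_fun_dirac L2_fun_cmult L)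
    moreover have "op_minus_z g = L2_uv (?A p q p') (?B p q q')"
      unfolding g dirac_op_uv(2)[OF L' P'] L2_uv_scaleC[OF L'(1,2)]
      by (rule L2_uv_minus) (auto intro!: L2_fun_dirac L2_fun_cmult L')
    ultimately show ?thesis
      using fg(3) L2_uv_eq_iff[OF LL[OF L] LL[OF L']] by metis
  qed
  define a b where "a x = u x - p x" and "b x = v x - q x" for x
  have Lab: "L2_fun a" "L2_fun b"
    unfolding a_def[abs_def] b_def[abs_def] by (intro sub L L')+
  have solve: "\<i> * X = Y \<Longrightarrow> X = - \<i> * Y" for X Y :: complex
    by (metis mult.assoc mult_minus_left i_times_eq_iff mult_minus_right minus_minus)
  have pa: "primitive_on UNIV a (\<lambda>x. u' x - p' x)" and pb: "primitive_on UNIV b (\<lambda>x. v' x - q' x)"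
    using primitive_on_linear[OF P(1) P'(1), of 1 "-1"] primitive_on_linear[OF P(2) P'(2), of 1 "-1"]
    by (simp_all add: a_def[abs_def] b_def[abs_def])
  have Ha: "L2_fun (\<lambda>x. \<i> * m * b x - \<i> * (z - \<i> * of_real (sgn x)) * a x)"
    using L2_fun_four_terms[OF Lab(2,1) L2_fun_sgn[OF Lab(1)] L2_fun_zero(1), of "\<i> * m" "- (\<i> * z)" "-1" 0]
    by (simp add: algebra_simps)
  have Hb: "L2_fun (\<lambda>x. - \<i> * m * a x + \<i> * (z - \<i> * of_real (sgn x)) * b x)"
    using L2_fun_four_terms[OF Lab(1,2) L2_fun_sgn[OF Lab(2)] L2_fun_zero(1), of "- (\<i> * m)" "\<i> * z" 1 0]
    by (simp add: algebra_simps)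
  have Qa: "primitive_on UNIV a (\<lambda>x. \<i> * m * b x - \<i> * (z - \<i> * of_real (sgn x)) * a x)"
  proof (rule primitive_on_cong_AE[OF pa])
    show "AE x in lborel. x \<in> UNIV \<longrightarrow> u' x - p' x = \<i> * m * b x - \<i> * (z - \<i> * of_real (sgn x)) * a x"
      using ae
    proof eventually_elim
      case (elim x)
      then have "\<i> * (u' x - p' x) = z * a x - of_real m * b x - \<i> * of_real (sgn x) * a x"
        by (simp add: a_def b_def algebra_simps)
      from solve[OF this] show ?case by (simp add: algebra_simps)
    qed
  qed (use Ha sub[OF L(3) L'(3)] in \<open>auto simp: L2_fun_def\<close>)
  have Qb: "primitive_on UNIV b (\<lambda>x. - \<i> * m * a x + \<i> * (z - \<i> * of_real (sgn x)) * b x)"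
  proof (rule primitive_on_cong_AE[OF pb])
    show "AE x in lborel. x \<in> UNIV \<longrightarrow> v' x - q' x = - \<i> * m * a x + \<i> * (z - \<i> * of_real (sgn x)) * b x"
      using ae
    proof eventually_elim
      case (elim x)
      then have "\<i> * (v' x - q' x) = of_real m * a x + \<i> * of_real (sgn x) * b x - z * b x"
        by (simp add: a_def b_def algebra_simps)
      from solve[OF this] show ?case by (simp add: algebra_simps)
    qed
  qed (use Hb sub[OF L(4) L'(4)] in \<open>auto simp: L2_fun_def\<close>)
  have zero: "a x = 0" "b x = 0" for x
    by (rule homogeneous_solution_zero[OF Lab Qa Qb])+
  have eq: "u x = p x" "v x = q x" for x
    using zero[of x] by (simp_all add: a_def b_def)
  have "u = p" by (rule ext) (rule eq)
  moreover have "v = q" by (rule ext) (rule eq)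
  ultimately show "f = g" by (simp add: f g)
qed

lemma op_minus_z_bij: "bij_betw op_minus_z H1 UNIV"
  unfolding bij_betw_def
proof (intro conjI op_minus_z_inj)
  have "G \<in> op_minus_z ` H1" for G
  proof -
    obtain Gu Gv where G: "L2_fun Gu" "L2_fun Gv" "G = L2_uv Gu Gv" by (rule L2_cases_uv)
    obtain \<delta> where "0 < \<delta>" "\<delta> \<le> cmod (1 - \<rho>\<^sup>2)" "\<delta> \<le> cmod (1 - \<sigma>\<^sup>2)" by (rule determinant_bound)
    from op_minus_z_solution[OF G(1,2) this] obtain f where "f \<in> H1" "op_minus_z f = L2_uv Gu Gv" by metis
    then show ?thesis using G(3) by (intro image_eqI[of G op_minus_z f]) simp_all
  qed
  then show "op_minus_z ` H1 = UNIV" by blast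
qed

abbreviation res :: "L2 \<Rightarrow> L2" where "res \<equiv> resolvent H1 (dirac_op m) z"

lemma res_eq: "f \<in> H1 \<Longrightarrow> op_minus_z f = G \<Longrightarrow> res G = f"
  unfolding resolvent_def by (rule inv_into_f_eq[OF op_minus_z_inj])

lemma res_in: "res G \<in> H1" "op_minus_z (res G) = G"
  using op_minus_z_bij inv_into_into[of G op_minus_z H1] f_inv_into_f[of G op_minus_z H1] unfolding resolvent_def bij_betw_def by auto

lemma res_linear: "linear res"
proof -
  have *: "res (r *\<^sub>R F + s *\<^sub>R G) = r *\<^sub>R res F + s *\<^sub>R res G" for r s F G
  proof (rule res_eq)
    show "r *\<^sub>R res F + s *\<^sub>R res G \<in> H1" by (rule dirac_op_combine(1)[OF res_in(1) res_in(1)])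
    have "op_minus_z (r *\<^sub>R res F + s *\<^sub>R res G) = r *\<^sub>R op_minus_z (res F) + s *\<^sub>R op_minus_z (res G)"
      by (simp add: dirac_op_combine(2)[OF res_in(1) res_in(1)] scaleC_combine algebra_simps)
    then show "op_minus_z (r *\<^sub>R res F + s *\<^sub>R res G) = r *\<^sub>R F + s *\<^sub>R G" by (simp add: res_in)
  qed
  show ?thesis
    by (rule linearI) (use *[of 1 _ 1] *[of _ _ 0] in auto)
qed

lemma res_decomposition:
  assumes G: "L2_fun Gu" "L2_fun Gv" and d: "0 < d" "d \<le> cmod (1 - \<rho>\<^sup>2)" "d \<le> cmod (1 - \<sigma>\<^sup>2)"
  obtains c E where "res (L2_uv Gu Gv) = scaleC_L2 c \<Phi> + E" "cmod c = cmod (\<Lambda> Gu Gv) / cmod (\<rho> - \<sigma>)"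
    "norm E \<le> 9 / ((1 - \<bar>Im z\<bar>) * d) * norm (L2_uv Gu Gv)"
proof -
  obtain f c E where f: "f \<in> H1" "op_minus_z f = L2_uv Gu Gv" "f = scaleC_L2 c \<Phi> + E" "c * (\<rho> - \<sigma>) = \<i> * \<Lambda> Gu Gv"
    and E: "norm E \<le> 9 / ((1 - \<bar>Im z\<bar>) * d) * norm (L2_uv Gu Gv)"
    by (rule op_minus_z_solution[OF G d]) (rule that; assumption)
  have "cmod c * cmod (\<rho> - \<sigma>) = cmod (\<Lambda> Gu Gv)"
    using arg_cong[OF f(4), of cmod] by (simp add: norm_mult)
  then have "cmod c = cmod (\<Lambda> Gu Gv) / cmod (\<rho> - \<sigma>)"
    using rho_neq_sigma by (simp add: field_simps)
  then show thesis using that res_eq[OF f(1,2)] f(3) E by blast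
qed

lemma norm_res_le:
  assumes d: "0 < d" "d \<le> cmod (1 - \<rho>\<^sup>2)" "d \<le> cmod (1 - \<sigma>\<^sup>2)"
  shows "norm (res G) \<le> (\<Phi>_sq / cmod (\<rho> - \<sigma>) + 9 / ((1 - \<bar>Im z\<bar>) * d)) * norm G"
proof -
  obtain Gu Gv where G: "L2_fun Gu" "L2_fun Gv" "G = L2_uv Gu Gv" by (rule L2_cases_uv)
  obtain c E where E: "res G = scaleC_L2 c \<Phi> + E" "cmod c = cmod (\<Lambda> Gu Gv) / cmod (\<rho> - \<sigma>)"
    "norm E \<le> 9 / ((1 - \<bar>Im z\<bar>) * d) * norm G"
    using res_decomposition[OF G(1,2) d] G(3) by metis
  have "cmod (\<Lambda> Gu Gv) \<le> sqrt (2 * \<Phi>_sq) * norm G"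
  proof (rule power2_le_imp_le)
    show "(cmod (\<Lambda> Gu Gv))\<^sup>2 \<le> (sqrt (2 * \<Phi>_sq) * norm G)\<^sup>2"
      using cmod_Lambda_le[OF G(1,2)] \<Phi>_sq_pos by (simp add: G norm_L2_uv power_mult_distrib)
  qed (use \<Phi>_sq_pos in simp)
  then have "cmod (\<Lambda> Gu Gv) * sqrt (\<Phi>_sq / 2) \<le> (sqrt (2 * \<Phi>_sq) * norm G) * sqrt (\<Phi>_sq / 2)"
    using \<Phi>_sq_pos by (intro mult_right_mono) auto
  also have "\<dots> = \<Phi>_sq * norm G"
  proof -
    have "sqrt (2 * \<Phi>_sq) * sqrt (\<Phi>_sq / 2) = \<Phi>_sq"
      using \<Phi>_sq_pos by (simp add: real_sqrt_mult[symmetric])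
    then show ?thesis by (metis mult.assoc mult.commute)
  qed
  finally have "cmod c * norm \<Phi> \<le> \<Phi>_sq / cmod (\<rho> - \<sigma>) * norm G"
    by (simp add: E(2) norm_Phi divide_right_mono)
  moreover have "norm (res G) \<le> cmod c * norm \<Phi> + norm E"
    unfolding E(1) using norm_triangle_ineq[of "scaleC_L2 c \<Phi>" E] by (simp add: norm_scaleC)
  ultimately show ?thesis using E(3) by (simp add: distrib_right)
qed

lemma res_bounded_linear: "bounded_linear res"
proof -
  obtain \<delta> where "0 < \<delta>" "\<delta> \<le> cmod (1 - \<rho>\<^sup>2)" "\<delta> \<le> cmod (1 - \<sigma>\<^sup>2)" by (rule determinant_bound)
  then have "norm (res G) \<le> norm G * (\<Phi>_sq / cmod (\<rho> - \<sigma>) + 9 / ((1 - \<bar>Im z\<bar>) * \<delta>))" for G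
    using norm_res_le[of \<delta> G] by (simp add: mult.commute)
  then show ?thesis
    using res_linear by (auto simp: bounded_linear_def bounded_linear_axioms_def)
qed

lemma z_in_resolvent_set: "z \<in> resolvent_set H1 (dirac_op m)"
  using op_minus_z_bij res_bounded_linear by (simp add: resolvent_set_def)

text \<open>The norm of the rank-one part is attained at the conjugate of \<open>\<Phi>\<close> with exchanged components, where \<open>\<Lambda>\<close> takes the value
\<open>\<parallel>\<Phi>\<parallel>\<^sup>2\<close>; the triangle inequality does the rest.\<close>

lemma onorm_res_near:
  assumes d: "0 < d" "d \<le> cmod (1 - \<rho>\<^sup>2)" "d \<le> cmod (1 - \<sigma>\<^sup>2)"
  shows "\<bar>onorm res - \<Phi>_sq / cmod (\<rho> - \<sigma>)\<bar> \<le> 9 / ((1 - \<bar>Im z\<bar>) * d)"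
proof -
  have "0 \<le> \<Phi>_sq / cmod (\<rho> - \<sigma>) + 9 / ((1 - \<bar>Im z\<bar>) * d)"
    using \<Phi>_sq_pos d Im_z by simp
  then have upper: "onorm res \<le> \<Phi>_sq / cmod (\<rho> - \<sigma>) + 9 / ((1 - \<bar>Im z\<bar>) * d)"
    by (rule onorm_bound) (rule norm_res_le[OF d])
  have cnj: "L2_fun (\<lambda>x. cnj (h x))" "L2_sq (\<lambda>x. cnj (h x)) = L2_sq h"
    "(LBINT x. h x * cnj (h x)) = of_real (L2_sq h)" if "L2_fun h" for h
  proof -
    have "h \<in> borel_measurable borel" using that by (simp add: L2_fun_def)
    moreover have "cnj \<in> borel_measurable borel"
      by (intro borel_measurable_continuous_onI linear_continuous_on bounded_linear_cnj)
    ultimately have "(\<lambda>x. cnj (h x)) \<in> borel_measurable borel" by (rule measurable_compose)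
    then show "L2_fun (\<lambda>x. cnj (h x))" "L2_sq (\<lambda>x. cnj (h x)) = L2_sq h"
      using that by (simp_all add: L2_fun_def L2_sq_def)
    have "h x * cnj (h x) = of_real ((cmod (h x))\<^sup>2)" for x by (simp only: complex_norm_square)
    then show "(LBINT x. h x * cnj (h x)) = of_real (L2_sq h)"
      by (simp only: L2_sq_def integral_complex_of_real)
  qed
  define Gu Gv where "Gu x = cnj (\<Phi>\<^sub>v x)" and "Gv x = cnj (\<Phi>\<^sub>u x)" for x
  have L: "L2_fun Gu" "L2_fun Gv"
    unfolding Gu_def[abs_def] Gv_def[abs_def] by (intro cnj L2_fun_Phi)+
  have "L2_sq Gu = L2_sq \<Phi>\<^sub>v" "L2_sq Gv = L2_sq \<Phi>\<^sub>u"
    unfolding Gu_def[abs_def] Gv_def[abs_def] by (intro cnj L2_fun_Phi)+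
  then have "(norm (L2_uv Gu Gv))\<^sup>2 = \<Phi>_sq / 2"
    by (simp add: norm_L2_uv[OF L] \<Phi>_sq_def)
  then have nG: "norm (L2_uv Gu Gv) = norm \<Phi>"
    by (simp add: norm_Phi real_sqrt_unique)
  have "\<Lambda> Gu Gv = of_real \<Phi>_sq"
    unfolding \<Lambda>_def \<Phi>_sq_def Gu_def Gv_def by (simp add: cnj(3) L2_fun_Phi)
  then have "cmod (\<Lambda> Gu Gv) = \<Phi>_sq" using \<Phi>_sq_pos by simp
  then obtain c E where E: "res (L2_uv Gu Gv) = scaleC_L2 c \<Phi> + E" "cmod c = \<Phi>_sq / cmod (\<rho> - \<sigma>)"
    "norm E \<le> 9 / ((1 - \<bar>Im z\<bar>) * d) * norm \<Phi>"
    using res_decomposition[OF L d] nG by metis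
  have "cmod c * norm \<Phi> \<le> norm (res (L2_uv Gu Gv)) + norm E"
    using norm_triangle_ineq4[of "res (L2_uv Gu Gv)" E] unfolding E(1) by (simp add: norm_scaleC)
  also have "\<dots> \<le> onorm res * norm \<Phi> + 9 / ((1 - \<bar>Im z\<bar>) * d) * norm \<Phi>"
    using onorm[OF res_bounded_linear, of "L2_uv Gu Gv"] E(3) nG by simp
  finally have "\<Phi>_sq / cmod (\<rho> - \<sigma>) * norm \<Phi> \<le> (onorm res + 9 / ((1 - \<bar>Im z\<bar>) * d)) * norm \<Phi>"
    by (simp add: E(2) distrib_right)
  moreover have "0 < norm \<Phi>" using \<Phi>_sq_pos by (simp add: norm_Phi)
  ultimately have "\<Phi>_sq / cmod (\<rho> - \<sigma>) \<le> onorm res + 9 / ((1 - \<bar>Im z\<bar>) * d)"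
    by (simp only: mult_le_cancel_right_pos)
  with upper show ?thesis by linarith
qed

end

section \<open>Asymptotics of the resolvent norm\<close>

text \<open>The two roots are reciprocal, and neither lies on the unit circle.\<close>

lemma char_root_exists:
  fixes m :: real
  assumes "0 < m" "Im w \<noteq> 0"
  obtains \<rho> where "cmod \<rho> < 1" "of_real m * \<rho>\<^sup>2 - 2 * w * \<rho> + of_real m = 0"
proof -
  define s where "s = csqrt (w\<^sup>2 - (of_real m)\<^sup>2)"
  have s: "s * s = w * w - of_real m * of_real m" by (simp add: s_def flip: power2_eq_square)
  have m: "complex_of_real m \<noteq> 0" using assms by simp
  define r1 r2 where "r1 = (w + s) / of_real m" and "r2 = (w - s) / of_real m"
  have root: "of_real m * r\<^sup>2 - 2 * w * r + of_real m = 0" if "r = (w + t) / of_real m" "t * t = s * s" for r t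
  proof -
    have "of_real m * (of_real m * r\<^sup>2 - 2 * w * r + of_real m) =
        (of_real m * r) * (of_real m * r) - 2 * w * (of_real m * r) + of_real m * of_real m"
      by (simp add: power2_eq_square algebra_simps)
    also have "of_real m * r = w + t" using that(1) m by simp
    also have "(w + t) * (w + t) - 2 * w * (w + t) + of_real m * of_real m = 0"
      using that(2) by (simp add: s algebra_simps)
    finally show ?thesis using m by simp
  qed
  have R1: "of_real m * r1\<^sup>2 - 2 * w * r1 + of_real m = 0" by (rule root[OF r1_def refl])
  have R2: "of_real m * r2\<^sup>2 - 2 * w * r2 + of_real m = 0" by (rule root[of _ "- s"]) (simp_all add: r2_def)
  have "r1 * r2 = (w * w - s * s) / (of_real m * of_real m)"
    by (simp add: r1_def r2_def algebra_simps)
  then have "r1 * r2 = 1" using m by (simp add: s)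
  then have prod: "cmod r1 * cmod r2 = 1" by (metis norm_mult norm_one)
  have ne: "cmod r1 \<noteq> 1"
  proof
    assume "cmod r1 = 1"
    then show False using char_root_Im[OF R1] assms(2) by simp
  qed
  show thesis
  proof (cases "cmod r1 < 1")
    case True
    then show ?thesis using that R1 by blast
  next
    case False
    then have "1 < cmod r1" using ne by simp
    then have "cmod r2 < 1"
      using prod mult_le_cancel_left_pos[of "cmod r1" 1 "cmod r2"] by (smt (verit))
    then show ?thesis using that R2 by blast
  qed
qed

lemma char_root_bound:
  fixes m :: real
  assumes "of_real m * \<rho>\<^sup>2 - 2 * w * \<rho> + of_real m = 0" "cmod \<rho> < 1" "0 < m"
  shows "cmod w * cmod \<rho> \<le> m" "2 * cmod w * cmod \<rho> = m * cmod (1 + \<rho>\<^sup>2)"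
proof -
  have "2 * w * \<rho> = of_real m * (1 + \<rho>\<^sup>2)" using assms(1) by (simp add: algebra_simps)
  from arg_cong[OF this, of cmod] show e: "2 * cmod w * cmod \<rho> = m * cmod (1 + \<rho>\<^sup>2)"
    using assms(3) by (simp add: norm_mult)
  have "cmod (1 + \<rho>\<^sup>2) \<le> 1 + (cmod \<rho>)\<^sup>2"
    using norm_triangle_ineq[of 1 "\<rho>\<^sup>2"] by (simp add: norm_power)
  also have "\<dots> \<le> 2" using assms(2) by (simp add: power_le_one)
  finally have "m * cmod (1 + \<rho>\<^sup>2) \<le> m * 2" using assms(3) by (intro mult_left_mono) auto
  then show "cmod w * cmod \<rho> \<le> m" using e by simp
qed

context dirac_gap
begin

text \<open>Eliminating \<open>z\<close> from the two characteristic equations gives \<open>m (\<rho> - \<sigma>) (1 - \<rho> \<sigma>) = 4 i \<rho> \<sigma>\<close>, and their product expresses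
\<open>\<rho> \<sigma>\<close> through \<open>(z - i) (z + i)\<close>.\<close>

lemma rho_minus_sigma:
  "cmod (\<rho> - \<sigma>) * cmod (1 - \<rho> * \<sigma>) * (cmod (z - \<i>) * cmod (z + \<i>)) = m * (cmod (1 + \<rho>\<^sup>2) * cmod (1 + \<sigma>\<^sup>2))"
proof -
  have a: "2 * (z - \<i>) * \<rho> = of_real m * (1 + \<rho>\<^sup>2)" using rho_root by (simp add: algebra_simps)
  have b: "2 * (z + \<i>) * \<sigma> = of_real m * (1 + \<sigma>\<^sup>2)" using sigma_root by (simp add: algebra_simps)
  have "of_real m * ((\<rho> - \<sigma>) * (1 - \<rho> * \<sigma>)) = of_real m * (1 + \<sigma>\<^sup>2) * \<rho> - of_real m * (1 + \<rho>\<^sup>2) * \<sigma>"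
    by (simp add: power2_eq_square algebra_simps)
  also have "\<dots> = 4 * \<i> * (\<rho> * \<sigma>)"
    unfolding a[symmetric] b[symmetric] by (simp add: algebra_simps)
  finally have c: "of_real m * ((\<rho> - \<sigma>) * (1 - \<rho> * \<sigma>)) = 4 * \<i> * (\<rho> * \<sigma>)" .
  have "of_real m * ((\<rho> - \<sigma>) * (1 - \<rho> * \<sigma>) * ((z - \<i>) * (z + \<i>))) = \<i> * ((2 * (z - \<i>) * \<rho>) * (2 * (z + \<i>) * \<sigma>))"
    using arg_cong[OF c, of "\<lambda>t. t * ((z - \<i>) * (z + \<i>))"] by (simp only: mult_ac) (simp add: mult_ac)
  also have "\<dots> = of_real m * (\<i> * (of_real m * ((1 + \<rho>\<^sup>2) * (1 + \<sigma>\<^sup>2))))"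
    unfolding a b by (simp add: mult_ac)
  finally have "(\<rho> - \<sigma>) * (1 - \<rho> * \<sigma>) * ((z - \<i>) * (z + \<i>)) = \<i> * (of_real m * ((1 + \<rho>\<^sup>2) * (1 + \<sigma>\<^sup>2)))"
    using m_pos by (simp only: mult_cancel_left) simp
  from arg_cong[OF this, of cmod] show ?thesis using m_pos by (simp only: norm_mult) simp
qed

text \<open>By the closed forms of \<open>\<parallel>\<Phi>\<parallel>\<^sup>2\<close> and \<open>|\<rho> - \<sigma>|\<close> the quotient to be estimated is \<open>A B\<^sub>1 D / (B\<^sub>2 B\<^sub>3)\<close> with five
factors that differ from \<open>1\<close> by at most \<open>\<delta>\<close>. The summand \<open>4\<close> in \<open>\<delta>\<close> accounts for the imaginary parts of \<open>z \<plusminus> i\<close>, and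
the lower bound for \<open>|Re z|\<close> makes \<open>\<delta> \<le> 1 / 4\<close>.\<close>

lemma rank_one_norm_asymptotics:
  assumes M: "m \<le> M" and T: "2 * (M + 2) \<le> \<bar>Re z\<bar>"
  defines "\<delta> \<equiv> (M\<^sup>2 + 4) / \<bar>Re z\<bar>\<^sup>2"
  shows "(cmod \<rho>)\<^sup>2 \<le> \<delta>" "(cmod \<sigma>)\<^sup>2 \<le> \<delta>" "\<delta> \<le> 1 / 4"
    "\<bar>\<Phi>_sq / cmod (\<rho> - \<sigma>) * (m * (1 - \<bar>Im z\<bar>\<^sup>2) / \<bar>Re z\<bar>\<^sup>2) - 1\<bar> \<le> 8 * \<delta>"
proof -
  define t where "t = \<bar>Re z\<bar>"
  have M0: "0 < M" using M m_pos by simp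
  have t: "0 < t" using T M0 by (simp add: t_def)
  have \<delta>: "\<delta> = (M\<^sup>2 + 4) / t\<^sup>2" by (simp add: \<delta>_def t_def)
  have "(2 * (M + 2))\<^sup>2 \<le> t\<^sup>2" using T M0 by (intro power_mono) (auto simp: t_def)
  then have "4 * (M\<^sup>2 + 4) \<le> t\<^sup>2"
    using M0 by (simp add: power2_eq_square algebra_simps)
  then show d4: "\<delta> \<le> 1 / 4" using t by (simp add: \<delta> field_simps)
  have d0: "0 < \<delta>" using t by (simp add: \<delta> add_nonneg_pos)
  have w: "t\<^sup>2 \<le> (cmod (z - \<i>))\<^sup>2" "(cmod (z - \<i>))\<^sup>2 \<le> t\<^sup>2 + 4" "t\<^sup>2 \<le> (cmod (z + \<i>))\<^sup>2" "(cmod (z + \<i>))\<^sup>2 \<le> t\<^sup>2 + 4"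
  proof -
    have *: "(cmod (z - \<i>))\<^sup>2 = t\<^sup>2 + (Im z - 1)\<^sup>2" "(cmod (z + \<i>))\<^sup>2 = t\<^sup>2 + (Im z + 1)\<^sup>2"
      by (simp_all add: cmod_power2 t_def)
    have "\<bar>Im z - 1\<bar> \<le> 2" "\<bar>Im z + 1\<bar> \<le> 2" using Im_z by auto
    then have "(Im z - 1)\<^sup>2 \<le> 2\<^sup>2" "(Im z + 1)\<^sup>2 \<le> 2\<^sup>2" by (metis abs_le_square_iff abs_numeral)+
    then show "t\<^sup>2 \<le> (cmod (z - \<i>))\<^sup>2" "(cmod (z - \<i>))\<^sup>2 \<le> t\<^sup>2 + 4" "t\<^sup>2 \<le> (cmod (z + \<i>))\<^sup>2" "(cmod (z + \<i>))\<^sup>2 \<le> t\<^sup>2 + 4"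
      unfolding * by auto
  qed
  have small: "(cmod r)\<^sup>2 \<le> \<delta>" if "cmod v * cmod r \<le> m" "t\<^sup>2 \<le> (cmod v)\<^sup>2" for r v
  proof -
    have "t\<^sup>2 * (cmod r)\<^sup>2 \<le> (cmod v)\<^sup>2 * (cmod r)\<^sup>2" using that(2) by (rule mult_right_mono) simp
    also have "\<dots> \<le> m\<^sup>2" using power_mono[OF that(1), of 2] by (simp add: power_mult_distrib)
    also have "\<dots> \<le> M\<^sup>2 + 4" using power_mono[OF M, of 2] m_pos by simp
    finally show ?thesis using t by (simp add: \<delta> field_simps)
  qed
  show r: "(cmod \<rho>)\<^sup>2 \<le> \<delta>" by (rule small[OF char_root_bound(1)[OF rho_root rho_less m_pos] w(1)])
  show s: "(cmod \<sigma>)\<^sup>2 \<le> \<delta>" by (rule small[OF char_root_bound(1)[OF sigma_root sigma_less m_pos] w(3)])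
  have rs: "cmod \<rho> * cmod \<sigma> \<le> \<delta>"
    using sum_squares_bound[of "cmod \<rho>" "cmod \<sigma>"] r s by simp
  define A where "A = cmod (z - \<i>) * cmod (z + \<i>) / t\<^sup>2"
  have A: "1 \<le> A" "A \<le> 1 + \<delta>"
  proof -
    have "t \<le> cmod (z - \<i>)" "t \<le> cmod (z + \<i>)"
      using w(1,3) power2_le_imp_le norm_ge_zero by blast+
    then have "t * t \<le> cmod (z - \<i>) * cmod (z + \<i>)" using t by (intro mult_mono) auto
    then show "1 \<le> A" using t by (simp add: A_def power2_eq_square)
    have "cmod (z - \<i>) * cmod (z + \<i>) \<le> t\<^sup>2 + 4"
      using sum_squares_bound[of "cmod (z - \<i>)" "cmod (z + \<i>)"] w(2,4) by simp
    then have "A \<le> (t\<^sup>2 + 4) / t\<^sup>2" by (simp add: A_def divide_right_mono)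
    also have "\<dots> = 1 + 4 / t\<^sup>2" using t by (simp add: field_simps)
    also have "\<dots> \<le> 1 + \<delta>" by (simp add: \<delta> divide_right_mono)
    finally show "A \<le> 1 + \<delta>" .
  qed
  have near: "1 - \<delta> \<le> cmod (1 + x)" "cmod (1 + x) \<le> 1 + \<delta>" if "cmod x \<le> \<delta>" for x
    using that norm_triangle_ineq[of 1 x] norm_triangle_ineq4[of "1 + x" x] by auto
  define B1 B2 B3 where "B1 = cmod (1 - \<rho> * \<sigma>)" and "B2 = cmod (1 + \<rho>\<^sup>2)" and "B3 = cmod (1 + \<sigma>\<^sup>2)"
  have B1: "1 - \<delta> \<le> B1" "B1 \<le> 1 + \<delta>" using near[of "- (\<rho> * \<sigma>)"] rs by (simp_all add: B1_def norm_mult)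
  have B2: "1 - \<delta> \<le> B2" "B2 \<le> 1 + \<delta>" using near[of "\<rho>\<^sup>2"] r by (simp_all add: B2_def norm_power)
  have B3: "1 - \<delta> \<le> B3" "B3 \<le> 1 + \<delta>" using near[of "\<sigma>\<^sup>2"] s by (simp_all add: B3_def norm_power)
  define D where "D = \<Phi>_sq * (1 - \<bar>Im z\<bar>\<^sup>2)"
  have D_eq: "D = ((1 - (cmod \<rho>)\<^sup>2) * (1 + Im z) + (1 - (cmod \<sigma>)\<^sup>2) * (1 - Im z)) / 2"
  proof -
    define y where "y = Im z"
    have y: "1 - y \<noteq> 0" "1 + y \<noteq> 0" using Im_z by (auto simp: y_def)
    have f: "1 - \<bar>y\<bar>\<^sup>2 = (1 - y) * (1 + y)" by (simp add: power2_eq_square algebra_simps)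
    have "(a / (2 * c) + b / (2 * d)) * (c * d) = (a * d + b * c) / 2" if "c \<noteq> 0" "d \<noteq> 0" for a b c d :: real
      using that by (simp add: field_simps)
    from this[OF y] show ?thesis unfolding D_def \<Phi>_sq_eq y_def[symmetric] f .
  qed
  have D: "1 - \<delta> \<le> D" "D \<le> 1"
  proof -
    have p: "0 \<le> 1 + Im z" "0 \<le> 1 - Im z" using Im_z by auto
    have "(1 - \<delta>) * (1 + Im z) \<le> (1 - (cmod \<rho>)\<^sup>2) * (1 + Im z)" "(1 - (cmod \<rho>)\<^sup>2) * (1 + Im z) \<le> 1 * (1 + Im z)"
      by (rule mult_right_mono; use p r in simp)+
    moreover have "(1 - \<delta>) * (1 - Im z) \<le> (1 - (cmod \<sigma>)\<^sup>2) * (1 - Im z)" "(1 - (cmod \<sigma>)\<^sup>2) * (1 - Im z) \<le> 1 * (1 - Im z)"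
      by (rule mult_right_mono; use p s in simp)+
    moreover have "(1 - \<delta>) * (1 + Im z) + (1 - \<delta>) * (1 - Im z) = 2 * (1 - \<delta>)" by (simp add: algebra_simps)
    ultimately show "1 - \<delta> \<le> D" "D \<le> 1"
      unfolding D_eq by simp_all
  qed
  have pos: "0 < B1" "0 < B2" "0 < B3" using B1 B2 B3 d4 by auto
  define X where "X = \<Phi>_sq / cmod (\<rho> - \<sigma>) * (m * (1 - \<bar>Im z\<bar>\<^sup>2) / \<bar>Re z\<bar>\<^sup>2)"
  have X: "X = A * B1 * D / (B2 * B3)"
  proof -
    have n: "0 < cmod (\<rho> - \<sigma>)" using rho_neq_sigma by simp
    have "cmod (\<rho> - \<sigma>) * B1 * (A * t\<^sup>2) = m * (B2 * B3)"
      using rho_minus_sigma t by (simp add: A_def B1_def B2_def B3_def)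
    then have "m = cmod (\<rho> - \<sigma>) * B1 * (A * t\<^sup>2) / (B2 * B3)" using pos by (simp add: field_simps)
    then have "X = \<Phi>_sq / cmod (\<rho> - \<sigma>) * (cmod (\<rho> - \<sigma>) * B1 * (A * t\<^sup>2) / (B2 * B3) * (1 - \<bar>Im z\<bar>\<^sup>2) / t\<^sup>2)"
      by (simp add: X_def t_def)
    also have "\<dots> = A * B1 * D / (B2 * B3)"
      using n t by (simp add: D_def)
    finally show ?thesis .
  qed
  have up: "X \<le> 1 + 8 * \<delta>"
  proof -
    have "A * B1 * D \<le> (1 + \<delta>) * (1 + \<delta>) * 1"
      using A B1 D d0 d4 pos by (intro mult_mono) auto
    also have "\<dots> \<le> (1 + 8 * \<delta>) * ((1 - \<delta>) * (1 - \<delta>))"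
    proof -
      have "(1 + 8 * \<delta>) * ((1 - \<delta>) * (1 - \<delta>)) - (1 + \<delta>) * (1 + \<delta>) = \<delta> * (4 - 16 * \<delta> + 8 * (\<delta> * \<delta>))"
        by (simp add: algebra_simps)
      also have "0 \<le> \<dots>" using d0 d4 by (intro mult_nonneg_nonneg) auto
      finally show ?thesis by simp
    qed
    also have "\<dots> \<le> (1 + 8 * \<delta>) * (B2 * B3)"
      using B2 B3 d0 d4 by (intro mult_left_mono mult_mono) auto
    finally show ?thesis using pos by (simp add: X divide_le_eq)
  qed
  have lo: "1 - 8 * \<delta> \<le> X"
  proof -
    have "(1 - 8 * \<delta>) * (B2 * B3) \<le> 1 * (1 - \<delta>) * (1 - \<delta>)"
    proof (cases "0 \<le> 1 - 8 * \<delta>")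
      case True
      have "(1 - 8 * \<delta>) * (B2 * B3) \<le> (1 - 8 * \<delta>) * ((1 + \<delta>) * (1 + \<delta>))"
        using True B2 B3 d0 pos by (intro mult_left_mono mult_mono) auto
      also have "\<dots> \<le> 1 * (1 - \<delta>) * (1 - \<delta>)"
      proof -
        have "1 * (1 - \<delta>) * (1 - \<delta>) - (1 - 8 * \<delta>) * ((1 + \<delta>) * (1 + \<delta>)) = \<delta> * (4 + 16 * \<delta> + 8 * (\<delta> * \<delta>))"
          by (simp add: algebra_simps)
        also have "0 \<le> \<dots>" using d0 by (intro mult_nonneg_nonneg) auto
        finally show ?thesis by simp
      qed
      finally show ?thesis .
    next
      case False
      then have "(1 - 8 * \<delta>) * (B2 * B3) \<le> 0" using pos by (intro mult_nonpos_nonneg) auto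
      also have "0 \<le> 1 * (1 - \<delta>) * (1 - \<delta>)" using d4 by simp
      finally show ?thesis .
    qed
    also have "\<dots> \<le> A * B1 * D"
      using A B1 D d0 d4 by (intro mult_mono) auto
    finally show ?thesis using pos by (simp add: X le_divide_eq)
  qed
  show "\<bar>\<Phi>_sq / cmod (\<rho> - \<sigma>) * (m * (1 - \<bar>Im z\<bar>\<^sup>2) / \<bar>Re z\<bar>\<^sup>2) - 1\<bar> \<le> 8 * \<delta>"
    using up lo by (simp add: X_def abs_le_iff)
qed

text \<open>In units of \<open>|Re z|\<^sup>2 / (m (1 - |Im z|\<^sup>2))\<close> the remainder contributes at most \<open>24 M / |Re z|\<^sup>2\<close>, because
\<open>1 - |Im z|\<^sup>2 \<le> 2 (1 - |Im z|)\<close> makes up for the singularity of its bound at \<open>|Im z| = 1\<close>.\<close>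

lemma onorm_res_asymptotics:
  assumes M: "m \<le> M" and T: "2 * (M + 2) \<le> \<bar>Re z\<bar>"
  shows "\<exists>\<epsilon> :: real. \<bar>\<epsilon>\<bar> \<le> (8 * (M\<^sup>2 + 4) + 24 * M) / \<bar>Re z\<bar>\<^sup>2 \<and>
    onorm res = \<bar>Re z\<bar>\<^sup>2 / (m * (1 - \<bar>Im z\<bar>\<^sup>2)) * (1 + \<epsilon>)"
proof -
  define t where "t = \<bar>Re z\<bar>"
  define \<delta> where "\<delta> = (M\<^sup>2 + 4) / t\<^sup>2"
  note asym = rank_one_norm_asymptotics[OF M T, folded t_def, folded \<delta>_def]
  have t: "0 < t" using T M m_pos by (simp add: t_def)
  define g where "g = 1 - \<bar>Im z\<bar>"
  have g: "0 < g" using Im_z by (simp add: g_def)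
  define q where "q = 1 - \<bar>Im z\<bar>\<^sup>2"
  have q: "q = g * (1 + \<bar>Im z\<bar>)" by (simp add: q_def g_def power2_eq_square algebra_simps)
  then have q0: "0 < q" and q2: "q \<le> 2 * g"
    using g Im_z by (auto simp: mult.commute[of 2] intro!: mult_left_mono)
  have far: "3 / 4 \<le> cmod (1 - r\<^sup>2)" if "(cmod r)\<^sup>2 \<le> \<delta>" for r
    using norm_triangle_ineq2[of 1 "r\<^sup>2"] that asym(3) by (simp add: norm_power)
  define K where "K = m * q / t\<^sup>2"
  have K: "0 < K" using m_pos q0 t by (simp add: K_def)
  have "\<bar>onorm res - \<Phi>_sq / cmod (\<rho> - \<sigma>)\<bar> \<le> 9 / (g * (3 / 4))"
    unfolding g_def by (rule onorm_res_near) (use far[OF asym(1)] far[OF asym(2)] in auto)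
  also have "\<dots> = 12 / g" by simp
  finally have "\<bar>onorm res - \<Phi>_sq / cmod (\<rho> - \<sigma>)\<bar> * K \<le> 12 / g * K"
    using K by (intro mult_right_mono) auto
  also have "12 / g * K \<le> 24 * M / t\<^sup>2"
  proof -
    have "12 / g * K = 12 * (m * (q / g)) / t\<^sup>2" by (simp add: K_def)
    also have "\<dots> \<le> 12 * (M * 2) / t\<^sup>2"
      using q2 g M m_pos q0 by (intro divide_right_mono mult_left_mono mult_mono) (auto simp: divide_le_eq)
    finally show ?thesis by simp
  qed
  finally have e1: "\<bar>onorm res * K - \<Phi>_sq / cmod (\<rho> - \<sigma>) * K\<bar> \<le> 24 * M / t\<^sup>2"
    using K unfolding left_diff_distrib[symmetric] abs_mult by simp
  have e2: "\<bar>\<Phi>_sq / cmod (\<rho> - \<sigma>) * K - 1\<bar> \<le> 8 * (M\<^sup>2 + 4) / t\<^sup>2"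
    using asym(4) unfolding K_def q_def \<delta>_def by simp
  define \<epsilon> where "\<epsilon> = onorm res * K - 1"
  have triangle: "\<bar>a - b\<bar> \<le> x \<Longrightarrow> \<bar>b - 1\<bar> \<le> y \<Longrightarrow> \<bar>a - 1\<bar> \<le> y + x" for a b x y :: real
    by linarith
  have "\<bar>\<epsilon>\<bar> \<le> 8 * (M\<^sup>2 + 4) / t\<^sup>2 + 24 * M / t\<^sup>2"
    unfolding \<epsilon>_def by (rule triangle[OF e1 e2])
  then have "\<bar>\<epsilon>\<bar> \<le> (8 * (M\<^sup>2 + 4) + 24 * M) / t\<^sup>2" by (simp only: add_divide_distrib)
  moreover have "onorm res = t\<^sup>2 / (m * q) * (1 + \<epsilon>)"
    using m_pos q0 t by (simp add: \<epsilon>_def K_def)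
  ultimately show ?thesis unfolding t_def q_def by blast
qed

end

theorem theorem2p1:
  fixes K :: "real set"
  assumes "compact K" and "K \<subseteq> {0<..}"
  shows "\<exists>C R :: real. R > 0 \<and>
    (\<forall>m\<in>K. \<forall>z :: complex. \<bar>Im z\<bar> < 1 \<longrightarrow>
       z \<in> resolvent_set H1 (dirac_op m) \<and>
       (\<bar>Re z\<bar> \<ge> R \<longrightarrow>
         (\<exists>\<epsilon> :: real. \<bar>\<epsilon>\<bar> \<le> C / \<bar>Re z\<bar>\<^sup>2 \<and>
            onorm (resolvent H1 (dirac_op m) z)
              = \<bar>Re z\<bar>\<^sup>2 / (m * (1 - \<bar>Im z\<bar>\<^sup>2)) * (1 + \<epsilon>))))"
proof -
  obtain B where B: "\<And>m. m \<in> K \<Longrightarrow> \<bar>m\<bar> \<le> B"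
    using compact_imp_bounded[OF assms(1)] unfolding bounded_iff by (metis real_norm_def)
  define M where "M = \<bar>B\<bar>"
  have M: "0 \<le> M" "m \<le> M" if "m \<in> K" for m using B[OF that] by (auto simp: M_def)
  have "z \<in> resolvent_set H1 (dirac_op m) \<and> (\<bar>Re z\<bar> \<ge> 2 * (M + 2) \<longrightarrow>
         (\<exists>\<epsilon> :: real. \<bar>\<epsilon>\<bar> \<le> (8 * (M\<^sup>2 + 4) + 24 * M) / \<bar>Re z\<bar>\<^sup>2 \<and>
            onorm (resolvent H1 (dirac_op m) z)
              = \<bar>Re z\<bar>\<^sup>2 / (m * (1 - \<bar>Im z\<bar>\<^sup>2)) * (1 + \<epsilon>)))"
    if m: "m \<in> K" and z: "\<bar>Im z\<bar> < 1" for m z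
  proof -
    have m0: "0 < m" using m assms(2) by auto
    obtain \<rho> where \<rho>: "cmod \<rho> < 1" "of_real m * \<rho>\<^sup>2 - 2 * (z - \<i>) * \<rho> + of_real m = 0"
      by (rule char_root_exists[OF m0, of "z - \<i>"]) (use z in auto)
    obtain \<sigma> where \<sigma>: "cmod \<sigma> < 1" "of_real m * \<sigma>\<^sup>2 - 2 * (z + \<i>) * \<sigma> + of_real m = 0"
      by (rule char_root_exists[OF m0, of "z + \<i>"]) (use z in auto)
    interpret dirac_gap m z \<rho> \<sigma>
      by unfold_locales (fact m0 z \<rho> \<sigma>)+
    show ?thesis using z_in_resolvent_set onorm_res_asymptotics[OF M(2)[OF m]] by blast
  qed
  moreover have "0 < 2 * (M + 2)" by (simp add: M_def)
  ultimately show ?thesis by blast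
qed

end
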